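(* Let $H\subset\mathbb{R}^2$ be a regular hexagon of unit edge length, and let $D_t$ $(0\le t\le 1)$ be the closed circular disks concentric with $H$ that shrink monotonically and continuously in $t$ from the disk $D_0$ circumscribed about $H$ (radius $1$) to the disk $D_1$ inscribed in $H$ (radius $\sqrt3/2$). Put $K_t=D_t\cap H$ and $L_t=\mathrm{Conv}(D_t\cup H)$, and let $\alpha=\{(\delta(K_t),\vartheta(K_t)):0\le t\le1\}$ and $\beta=\{(\delta(L_t),\vartheta(L_t)):0\le t\le 1\}$. Then: (1) For every $t\in[0,1]$, $\delta(K_t)=\delta_T(K_t)=\delta_L(K_t)$, $\vartheta(K_t)=\vartheta_T(K_t)=\vartheta_L(K_t)$, $\delta(L_t)=\delta_T(L_t)=\delta_L(L_t)$ and $\vartheta(L_t)=\vartheta_T(L_t)=\vartheta_L(L_t)$. (2) $\alpha$ is the curve with parametric presentation $$x=\frac{2\pi-12\arcsin(u/2)+3u\sqrt{4-u^2}}{\sqrt3\,(4-u^2)},\qquad y=\frac{2\pi-12\arcsin(u/2)+3u\sqrt{4-u^2}}{3\sqrt3}\qquad(0\le u\le 1),$$ and $\beta$ is the curve with parametric presentation $$x=\sqrt3\left(\frac{\pi}{6}-\arcsin(v/2)+\frac{v}{\sqrt{4-v^2}}\right),\qquad y=\frac{\sqrt3}{3}\left((4-v^2)\left(\frac{\pi}{6}-\arcsin(v/2)\right)+v\sqrt{4-v^2}\right)\qquad(0\le v\le1).$$ (3) Each of $\alpha$ and $\beta$ is an arc joining the points $(1,1)$ and $(\pi/\sqrt{12},\,2\pi/\sqrt{27})$,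 and $\alpha\cup\beta$ is a simple closed curve that bounds a convex disk $\Lambda$. (4) $\Lambda$ is contained in each of the six sets $\Omega$, $\Omega_T$, $\Omega_L$, $\Omega^*$, $\Omega^*_T$, $\Omega^*_L$.
   Context: A convex disk is a compact convex subset of $\mathbb{R}^2$ with nonempty interior; $\mathcal{K}^2$ denotes the set of all convex disks and $\mathcal{K}^{*2}\subset\mathcal{K}^2$ the set of centrally symmetric ones. $\mathrm{Conv}(S)$ is the convex hull of $S$, and $|S|$ is the area of $S$. A family $\mathcal F=\{K_i\}$ of sets congruent to a convex disk $K$ is a packing if the interiors of its members are mutually disjoint, and a covering if the union of its members is $\mathbb{R}^2$. With $B_r$ the disk of radius $r$ centered at the origin and $|\mathcal F\cap B_r|=\sum_i|K_i\cap B_r|$, the density of $\mathcal F$ is $d(\mathcal F)=\lim_{r\to\infty}|\mathcal F\cap B_r|/|B_r|$; if the limit does not exist, the upper limit is used for a packing and the lower limit for a covering. The packing density $\delta(K)$ is the supremum of $d(\mathcal F)$ over all packings with congruent copies of $K$, and the covering density $\vartheta(K)$ is the infimum of $d(\mathcal F)$ over all coverings with congruent copies of $K$. The translative densities $\delta_T(K),\vartheta_T(K)$ are defined in the same way, using only packings/coverings by translates of $K$, and the lattice densities $\delta_L(K),\vartheta_L(K)$ using only families of translates of $K$ by the vectors of a lattice. Define $\Omega=\{(\delta(K),\vartheta(K)):K\in\mathcal K^2\}$, $\Omega_T=\{(\delta_T(K),\vartheta_T(K)):K\in\mathcal K^2\}$, $\Omega_L=\{(\delta_L(K),\vartheta_L(K)):K\in\mathcal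 K^2\}$ as subsets of $\mathbb{R}^2$, and define $\Omega^*,\Omega_T^*,\Omega_L^*$ in the same way with $\mathcal K^2$ replaced by $\mathcal K^{*2}$. *)

theory Defs
  imports "HOL-Analysis.Analysis"
begin

type_synonym plane = "real \<times> real"

definition convex_disk :: "plane set \<Rightarrow> bool" where
  "convex_disk K \<longleftrightarrow> compact K \<and> convex K \<and> interior K \<noteq> {}"

definition centrally_symmetric :: "plane set \<Rightarrow> bool" where
  "centrally_symmetric K \<longleftrightarrow> (\<exists>c. \<forall>x\<in>K. 2 *\<^sub>R c - x \<in> K)"

(* Reflections are allowed. A distance-preserving self-map of the plane is onto,
   so surjectivity need not be required. *)
definition congruent_to :: "plane set \<Rightarrow> plane set \<Rightarrow> bool" where
  "congruent_to K C \<longleftrightarrow> (\<exists>f :: plane \<Rightarrow> plane. (\<forall>x y. dist (f x) (f y) = dist x y) \<and> C = f ` K)"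

definition translate_of :: "plane set \<Rightarrow> plane set \<Rightarrow> bool" where
  "translate_of K C \<longleftrightarrow> (\<exists>v. C = (+) v ` K)"

definition is_lattice :: "plane set \<Rightarrow> bool" where
  "is_lattice G \<longleftrightarrow> (\<exists>a b. a \<noteq> b \<and> independent {a, b} \<and>
     G = {of_int m *\<^sub>R a + of_int n *\<^sub>R b | m n :: int. True})"

(* A family is a set of sets, of arbitrary cardinality. Multiplicities are not
   recorded: a packing by sets with nonempty interior has no repeated member, and
   deleting repetitions from a covering leaves a covering whose density is not larger. *)

definition is_packing :: "plane set set \<Rightarrow> bool" where
  "is_packing F \<longleftrightarrow> pairwise (\<lambda>A B. interior A \<inter> interior B = {}) F"

definition is_covering :: "plane set set \<Rightarrow> bool" where
  "is_covering F \<longleftrightarrow> \<Union>F = UNIV"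

definition density_in_disk :: "plane set set \<Rightarrow> real \<Rightarrow> ennreal" where
  "density_in_disk F r =
     (\<Sum>\<^sub>\<infinity>C\<in>F. emeasure lborel (C \<inter> cball 0 r)) / emeasure lborel (cball 0 r :: plane set)"

(* Whenever the limit as r tends to infinity exists, it equals both the upper and
   the lower limit. *)

definition upper_density :: "plane set set \<Rightarrow> ennreal" where
  "upper_density F = Limsup at_top (density_in_disk F)"

definition lower_density :: "plane set set \<Rightarrow> ennreal" where
  "lower_density F = Liminf at_top (density_in_disk F)"

definition congruent_families :: "plane set \<Rightarrow> plane set set set" where
  "congruent_families K = {F. \<forall>C\<in>F. congruent_to K C}"

definition translative_families :: "plane set \<Rightarrow> plane set set set" where
  "translative_families K = {F. \<forall>C\<in>F. translate_of K C}"

definition lattice_families :: "plane set \<Rightarrow> plane set set set" where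
  "lattice_families K = {(\<lambda>v. (+) v ` K) ` G | G. is_lattice G}"

(* The suprema and infima are taken among extended nonnegative numbers. For a convex
   disk all of them are finite, so the conversion to real loses nothing. *)

definition max_packing_density :: "plane set set set \<Rightarrow> real" where
  "max_packing_density \<A> = enn2real (SUP F\<in>{F \<in> \<A>. is_packing F}. upper_density F)"

definition min_covering_density :: "plane set set set \<Rightarrow> real" where
  "min_covering_density \<A> = enn2real (INF F\<in>{F \<in> \<A>. is_covering F}. lower_density F)"

definition packing_density :: "plane set \<Rightarrow> real" where
  "packing_density K = max_packing_density (congruent_families K)"

definition packing_density_T :: "plane set \<Rightarrow> real" where
  "packing_density_T K = max_packing_density (translative_families K)"

definition packing_density_L :: "plane set \<Rightarrow> real" where
  "packing_density_L K = max_packing_density (lattice_families K)"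

definition covering_density :: "plane set \<Rightarrow> real" where
  "covering_density K = min_covering_density (congruent_families K)"

definition covering_density_T :: "plane set \<Rightarrow> real" where
  "covering_density_T K = min_covering_density (translative_families K)"

definition covering_density_L :: "plane set \<Rightarrow> real" where
  "covering_density_L K = min_covering_density (lattice_families K)"

definition Omega :: "(real \<times> real) set" where
  "Omega = {(packing_density K, covering_density K) | K. convex_disk K}"

definition Omega_T :: "(real \<times> real) set" where
  "Omega_T = {(packing_density_T K, covering_density_T K) | K. convex_disk K}"

definition Omega_L :: "(real \<times> real) set" where
  "Omega_L = {(packing_density_L K, covering_density_L K) | K. convex_disk K}"

definition Omega_sym :: "(real \<times> real) set" where
  "Omega_sym = {(packing_density K, covering_density K) | K.
     convex_disk K \<and> centrally_symmetric K}"

definition Omega_T_sym :: "(real \<times> real) set" where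
  "Omega_T_sym = {(packing_density_T K, covering_density_T K) | K.
     convex_disk K \<and> centrally_symmetric K}"

definition Omega_L_sym :: "(real \<times> real) set" where
  "Omega_L_sym = {(packing_density_L K, covering_density_L K) | K.
     convex_disk K \<and> centrally_symmetric K}"

(* Regular hexagon (as a closed region) with center c and edge length s; the
   circumradius of a regular hexagon equals its edge length. *)
definition regular_hexagon :: "plane \<Rightarrow> real \<Rightarrow> plane set \<Rightarrow> bool" where
  "regular_hexagon c s H \<longleftrightarrow> s > 0 \<and>
     (\<exists>\<theta>. H = convex hull ((\<lambda>k::nat. c + s *\<^sub>R (cos (\<theta> + real k * pi / 3), sin (\<theta> + real k * pi / 3))) ` {..<6}))"

definition arc_joining :: "(real \<times> real) set \<Rightarrow> real \<times> real \<Rightarrow> real \<times> real \<Rightarrow> bool" where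
  "arc_joining C p q \<longleftrightarrow> (\<exists>g. arc g \<and> path_image g = C \<and> pathstart g = p \<and> pathfinish g = q)"

definition simple_closed_curve :: "(real \<times> real) set \<Rightarrow> bool" where
  "simple_closed_curve C \<longleftrightarrow>
     (\<exists>g. simple_path g \<and> path_image g = C \<and> pathfinish g = pathstart g)"

end

(* A body M that contains the disk of radius r = R cos phi and a regular hexagon of circumradius R,
   and lies in the disk of radius R and in the parallel regular hexagon of inradius r, inherits the
   optimal packing bound from its inner disk (Thue) and the optimal covering bound from its outer
   disk (Kershner); the two hexagons tile by lattices, so both bounds are attained by lattice
   families. Hence (delta, theta) depends only on phi and on the area of M: it lies on the ray
   y = (4/3) (cos phi)^2 x, and the area runs continuously from that of the smallest such body,
   which is L_t, to that of the largest, which is similar to K_t. These segments sweep out Lambda.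

   Thue: three points at mutual distance at least 2r do not fit into a disk of radius 2r/sqrt 3
   unless they lie on its boundary, so the segments which the bisectors cut off from such a disk
   around a center have disjoint sectors; a segment fills a bounded fraction of its sector.
   Kershner: a triangle inscribed in a unit disk has area at most 3 sqrt 3/4, and by the angle sum
   a Delaunay triangulation of N centers has at most 2N triangles. *)
theory Submission
  imports Defs "HOL-Computational_Algebra.Polynomial"
begin

section \<open>Areas in the plane\<close>

text \<open>Both extremal bounds are proved as counts for finite point sets in a large disk
  (\<open>disk_packing_card\<close>, \<open>disk_covering_card\<close>), so that one limit argument
  with boundary layers of fixed width serves congruent, translative and lattice families alike. For
  packings, truncating each Voronoi cell by the disk of radius \<open>2 * r / sqrt 3\<close> leaves
  a disk without some segments, and its area can be bounded without knowing the shape of the cell.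
  For coverings the obstacle is global: triangles have to be counted against centers. Instead of
  Euler's formula the count compares areas: the corners of a triangle fill at least half a small
  disk, and the corners meeting at a center fill at most a whole one. The convexity of Lambda is the
  analytic point. The angle phi is constant on rays through the origin, so a central projection
  turns the two arcs into graphs over \<open>(tan \<phi>)\<^sup>2\<close>, and only the monotonicity
  of two explicit slopes remains.\<close>

definition perp :: "plane \<Rightarrow> plane" where "perp x = (- snd x, fst x)"

definition cross :: "plane \<Rightarrow> plane \<Rightarrow> real" where "cross x y = fst x * snd y - snd x * fst y"

text \<open>For a unit vector \<open>e\<close> this is the isometry placing the origin at
  \<open>p\<close> and the first axis along \<open>e\<close>. Segments, sectors and triangular tips
  are symmetric about such an axis, so their areas become integrals in one variable.\<close>

definition frame_map :: "plane \<Rightarrow> plane \<Rightarrow> plane \<Rightarrow> plane" where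
  "frame_map p e z = p + fst z *\<^sub>R e + snd z *\<^sub>R perp e"

text \<open>The change of variables for linear maps and the area of a triangle are formulated in
  \<open>real^2\<close>; this mutually inverse pair of linear isometries carries them over to pairs
  of reals.\<close>

definition to_plane :: "real^2 \<Rightarrow> plane" where "to_plane x = (x $ 1, x $ 2)"
definition of_plane :: "plane \<Rightarrow> real^2" where "of_plane x = vector [fst x, snd x]"

lemma to_of_plane [simp]: "to_plane (of_plane x) = x"
  by (simp add: to_plane_def of_plane_def)

lemma of_to_plane [simp]: "of_plane (to_plane x) = x"
  by (simp add: to_plane_def of_plane_def vec_eq_iff forall_2)

lemma norm_to_plane: "norm (to_plane x) = norm x"
  by (simp add: to_plane_def norm_Pair norm_vec_def L2_set_def sum_2)

lemma linear_to_plane: "linear to_plane"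
  by (rule linearI) (auto simp: to_plane_def)

lemma linear_of_plane: "linear of_plane"
  by (rule linearI) (auto simp: of_plane_def vec_eq_iff forall_2)

lemma norm_of_plane: "norm (of_plane x) = norm x"
  by (metis norm_to_plane to_of_plane)

lemma compact_linear_image_plane:
  fixes f :: "'a::euclidean_space \<Rightarrow> 'b::real_normed_vector"
  assumes "compact S" "linear f"
  shows "compact (f ` S)"
  using assms by (simp add: compact_continuous_image linear_continuous_on linear_conv_bounded_linear)

text \<open>Lebesgue measure is determined by its values on boxes, and the preimage of a box is the
  box with the same side lengths.\<close>

lemma distr_to_plane: "distr lborel borel to_plane = (lborel :: plane measure)"
proof (rule lborel_eqI[symmetric])
  have meas: "to_plane \<in> borel_measurable borel"
    by (intro borel_measurable_continuous_onI linear_continuous_on linear_conv_bounded_linear[THEN iffD1]) (rule linear_to_plane)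
  fix l u :: plane
  assume *: "\<And>b. b \<in> Basis \<Longrightarrow> l \<bullet> b \<le> u \<bullet> b"
  have lu: "fst l \<le> fst u" "snd l \<le> snd u"
    using *[of "(1,0)"] *[of "(0,1)"] by (cases l; cases u; auto simp: Basis_prod_def)+
  have eq: "to_plane -` box l u = box (of_plane l) (of_plane u)"
    by (cases l; cases u) (auto simp: mem_box_cart forall_2 to_plane_def of_plane_def box_prod)
  have "emeasure (distr lborel borel to_plane) (box l u) = emeasure lborel (box (of_plane l) (of_plane u))"
    using meas by (subst emeasure_distr) (auto simp: eq)
  also have "\<dots> = ennreal (\<Prod>b\<in>Basis. (of_plane u - of_plane l) \<bullet> b)"
  proof (rule emeasure_lborel_box)
    fix b :: "real^2" assume "b \<in> Basis"
    then obtain i where "b = axis i 1" by (auto simp: Basis_vec_def)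
    then show "of_plane l \<bullet> b \<le> of_plane u \<bullet> b"
      using lu exhaust_2[of i] by (auto simp: inner_axis of_plane_def)
  qed
  also have "(\<Prod>b\<in>Basis. (of_plane u - of_plane l) \<bullet> b) = (fst u - fst l) * (snd u - snd l)"
  proof -
    have B: "(Basis :: (real^2) set) = {axis 1 1, axis 2 1}"
      by (auto simp: Basis_vec_def) (metis exhaust_2)
    have "axis 1 1 \<noteq> (axis 2 1 :: real^2)" by (simp add: axis_eq_axis)
    then show ?thesis unfolding B by (simp add: inner_axis of_plane_def)
  qed
  also have "\<dots> = (\<Prod>b\<in>Basis. (u - l) \<bullet> b)"
    by (cases l; cases u) (simp add: Basis_prod_def inner_prod_def)
  finally show "emeasure (distr lborel borel to_plane) (box l u) = ennreal (\<Prod>b\<in>Basis. (u - l) \<bullet> b)" .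
qed auto

lemma emeasure_to_plane_vimage:
  assumes "S \<in> sets borel"
  shows "emeasure lborel (to_plane -` S) = emeasure lborel S"
proof -
  have meas: "to_plane \<in> borel_measurable borel"
    by (intro borel_measurable_continuous_onI linear_continuous_on linear_conv_bounded_linear[THEN iffD1]) (rule linear_to_plane)
  have "emeasure (distr lborel borel to_plane) S = emeasure lborel (to_plane -` S)"
    using meas assms by (subst emeasure_distr) auto
  then show ?thesis by (simp add: distr_to_plane)
qed

lemma measure_of_plane_image:
  assumes "compact S"
  shows "measure lebesgue (of_plane ` S) = measure lebesgue S"
proof -
  have eq: "of_plane ` S = to_plane -` S"
    by (auto simp: image_iff) (metis of_to_plane)
  have "compact (of_plane ` S)"
    using assms linear_of_plane by (simp add: compact_linear_image_plane)
  then show ?thesis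
    using emeasure_to_plane_vimage[of S] assms
    by (simp add: measure_def eq[symmetric] borel_compact)
qed

lemma measure_orthogonal_image_plane:
  fixes f :: "plane \<Rightarrow> plane"
  assumes f: "orthogonal_transformation f" and S: "compact S"
  shows "measure lebesgue (f ` S) = measure lebesgue S"
proof -
  define g where "g = of_plane \<circ> f \<circ> to_plane"
  have lin: "linear f" using f orthogonal_transformation_linear by blast
  have "linear g" unfolding g_def
    by (intro linear_compose linear_to_plane linear_of_plane lin)
  moreover have "norm (g x) = norm x" for x
    using f by (simp add: g_def norm_of_plane norm_to_plane orthogonal_transformation_norm)
  ultimately have g: "orthogonal_transformation g"
    by (simp add: orthogonal_transformation)
  have c: "compact (f ` S)" using S lin by (simp add: compact_linear_image_plane)
  have "of_plane ` f ` S = g ` of_plane ` S"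
    by (simp add: g_def image_comp o_def)
  then have "measure lebesgue (f ` S) = measure lebesgue (g ` of_plane ` S)"
    using measure_of_plane_image[OF c] by simp
  also have "\<dots> = measure lebesgue (of_plane ` S)"
    using S by (intro measure_orthogonal_image g lmeasurable_compact) (simp add: compact_linear_image_plane linear_of_plane)
  finally show ?thesis using measure_of_plane_image[OF S] by simp
qed

section \<open>Isometries of the plane and areas\<close>

lemma plane_isometry:
  fixes f :: "plane \<Rightarrow> plane"
  assumes "\<forall>x y. dist (f x) (f y) = dist x y"
  obtains g where "orthogonal_transformation g" "f = (\<lambda>x. f 0 + g x)"
proof -
  have "orthogonal_transformation (\<lambda>x. f x - f 0)"
    using assms by (auto simp: orthogonal_transformation_isometry dist_norm)
  then show ?thesis using that[of "\<lambda>x. f x - f 0"] by (auto simp: fun_eq_iff)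
qed

lemma measure_isometry_image:
  fixes f :: "plane \<Rightarrow> plane"
  assumes iso: "\<forall>x y. dist (f x) (f y) = dist x y" and S: "compact S"
  shows "measure lebesgue (f ` S) = measure lebesgue S" "compact (f ` S)"
proof -
  obtain g where g: "orthogonal_transformation g" "f = (\<lambda>x. f 0 + g x)"
    using plane_isometry[OF iso] by blast
  have lin: "linear g" using g orthogonal_transformation_linear by blast
  have eq: "f ` S = (+) (f 0) ` (g ` S)" by (subst g(2)) (auto simp: image_comp o_def)
  have c: "compact (g ` S)" using S lin by (simp add: compact_linear_image_plane)
  show "measure lebesgue (f ` S) = measure lebesgue S"
    unfolding eq using measure_orthogonal_image_plane[OF g(1) S] by (simp add: measure_translation)
  show "compact (f ` S)" unfolding eq using c by (rule compact_translation)
qed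

lemma isometry_cball_image:
  fixes f :: "plane \<Rightarrow> plane"
  assumes iso: "\<forall>x y. dist (f x) (f y) = dist x y"
  shows "f ` cball c r = cball (f c) r" "f ` ball c r = ball (f c) r"
proof -
  obtain g where g: "orthogonal_transformation g" "f = (\<lambda>x. f 0 + g x)"
    using plane_isometry[OF iso] by blast
  \<comment> \<open>Only the inclusion of the image in the ball is immediate; the converse needs
    that the orthogonal part is onto.\<close>
  have "surj f"
  proof (rule surjI)
    show "f (inv g (y - f 0)) = y" for y
      using orthogonal_transformation_surj[OF g(1)]
      by (subst g(2)) (simp add: surj_f_inv_f)
  qed
  then have onto: "\<exists>x. y = f x" for y by (rule surjD)
  show "f ` cball c r = cball (f c) r"
  proof (intro equalityI subsetI)
    fix y assume "y \<in> cball (f c) r"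
    moreover obtain x where "y = f x" using onto by blast
    ultimately show "y \<in> f ` cball c r" using iso[rule_format, of c x] by auto
  next
    fix y assume "y \<in> f ` cball c r"
    then obtain x where "y = f x" "x \<in> cball c r" by blast
    then show "y \<in> cball (f c) r" using iso[rule_format, of c x] by simp
  qed
  show "f ` ball c r = ball (f c) r"
  proof (intro equalityI subsetI)
    fix y assume "y \<in> ball (f c) r"
    moreover obtain x where "y = f x" using onto by blast
    ultimately show "y \<in> f ` ball c r" using iso[rule_format, of c x] by auto
  next
    fix y assume "y \<in> f ` ball c r"
    then obtain x where "y = f x" "x \<in> ball c r" by blast
    then show "y \<in> ball (f c) r" using iso[rule_format, of c x] by simp
  qed
qed

lemma frame_coords:
  assumes "norm e = 1"
  shows "(frame_map p e z - p) \<bullet> e = fst z" "(frame_map p e z - p) \<bullet> perp e = snd z"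
    "frame_map p e ((q - p) \<bullet> e, (q - p) \<bullet> perp e) = q"
    "dist (frame_map p e z) (frame_map p e z') = dist z z'"
proof -
  obtain a b where e: "e = (a, b)" by (cases e)
  have ab: "a\<^sup>2 + b\<^sup>2 = 1" using assms by (simp add: e norm_Pair)
  have "(frame_map p e z - p) \<bullet> e = fst z * (a\<^sup>2 + b\<^sup>2)"
    by (simp add: frame_map_def perp_def e power2_eq_square algebra_simps)
  then show "(frame_map p e z - p) \<bullet> e = fst z" using ab by simp
  have "(frame_map p e z - p) \<bullet> perp e = snd z * (a\<^sup>2 + b\<^sup>2)"
    by (simp add: frame_map_def perp_def e power2_eq_square algebra_simps)
  then show "(frame_map p e z - p) \<bullet> perp e = snd z" using ab by simp
  have "frame_map p e ((q - p) \<bullet> e, (q - p) \<bullet> perp e) = p + (a\<^sup>2 + b\<^sup>2) *\<^sub>R (q - p)"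
    by (cases p; cases q) (simp add: frame_map_def perp_def e power2_eq_square algebra_simps)
  then show "frame_map p e ((q - p) \<bullet> e, (q - p) \<bullet> perp e) = q" using ab by simp
  obtain x y where xy: "z - z' = (x, y)" by (cases "z - z'")
  have "frame_map p e z - frame_map p e z' = (x * a - y * b, x * b + y * a)"
    using xy by (cases z; cases z') (auto simp: frame_map_def perp_def e algebra_simps)
  moreover have "(x * a - y * b)\<^sup>2 + (x * b + y * a)\<^sup>2 = (a\<^sup>2 + b\<^sup>2) * (x\<^sup>2 + y\<^sup>2)"
    by (simp add: power2_eq_square algebra_simps)
  ultimately show "dist (frame_map p e z) (frame_map p e z') = dist z z'"
    using ab xy by (simp add: dist_norm norm_Pair)
qed

lemma frame_norm:
  assumes "norm e = 1"
  shows "(dist q p)\<^sup>2 = ((q - p) \<bullet> e)\<^sup>2 + ((q - p) \<bullet> perp e)\<^sup>2"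
proof -
  have "dist q p = dist ((q - p) \<bullet> e, (q - p) \<bullet> perp e) (0,0)"
    using frame_coords(4)[OF assms, of p "((q - p) \<bullet> e, (q - p) \<bullet> perp e)" "(0,0)"]
    by (simp add: frame_coords(3)[OF assms]) (simp add: frame_map_def)
  then show ?thesis by (simp add: dist_norm norm_Pair)
qed

text \<open>Tonelli: the section over \<open>x\<close> is the interval from \<open>- g x\<close> to
  \<open>g x\<close>, of length \<open>2 * g x\<close>. Compactness is recorded because the transfer
  of areas along isometries is stated for compact sets.\<close>

lemma area_symmetric_strip:
  fixes g :: "real \<Rightarrow> real"
  assumes "a \<le> b" and cont: "continuous_on {a..b} g" and nn: "\<And>x. x \<in> {a..b} \<Longrightarrow> 0 \<le> g x"
    and I: "(g has_integral I) {a..b}"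
  defines "S \<equiv> {(x, y). a \<le> x \<and> x \<le> b \<and> \<bar>y\<bar> \<le> g x}"
  shows "compact S" "measure lebesgue S = 2 * I"
proof -
  have S_eq: "S = {z \<in> {a..b} \<times> UNIV. \<bar>snd z\<bar> \<le> g (fst z)}" by (auto simp: S_def)
  have "continuous_on ({a..b} \<times> UNIV) (\<lambda>z::plane. g (fst z))"
    by (rule continuous_on_compose2[OF cont]) (auto intro: continuous_intros)
  then have "closed S" unfolding S_eq
    by (intro continuous_on_closed_Collect_le continuous_intros) (auto intro: closed_Times)
  moreover have "bounded S"
  proof -
    have "bounded (g ` {a..b})" using compact_continuous_image[OF cont] compact_imp_bounded by blast
    then obtain B where B: "\<forall>x\<in>{a..b}. \<bar>g x\<bar> \<le> B"
      by (auto simp: bounded_iff)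
    have "S \<subseteq> {a..b} \<times> {-B..B}" using B by (force simp: S_def)
    then show ?thesis by (rule bounded_subset[rotated]) (intro bounded_Times bounded_closed_interval)
  qed
  ultimately show c: "compact S" by (simp add: compact_eq_bounded_closed)
  have sl: "emeasure lborel (Pair x -` S) = ennreal (2 * g x) * indicator {a..b} x" for x
  proof (cases "x \<in> {a..b}")
    case True
    then have "Pair x -` S = {- g x .. g x}" by (auto simp: S_def)
    then show ?thesis using True nn[OF True] by simp
  next
    case False
    then have "Pair x -` S = {}" by (auto simp: S_def)
    then show ?thesis using False by simp
  qed
  have "emeasure (lborel :: plane measure) S = (\<integral>\<^sup>+x. emeasure lborel (Pair x -` S) \<partial>lborel)"
    using c by (subst lborel_prod[symmetric], intro lborel.emeasure_pair_measure_alt)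
      (metis borel_compact borel_prod sets_lborel sets_pair_measure_cong)
  also have "\<dots> = ennreal (2 * I)" unfolding sl
    by (rule nn_integral_has_integral_lebesgue') (use nn has_integral_mult_right[OF I, of 2] in auto)
  finally have e: "emeasure lborel S = ennreal (2 * I)" .
  have "0 \<le> I" using has_integral_nonneg[OF I] nn by auto
  with e show "measure lebesgue S = 2 * I"
    using c by (simp add: measure_def borel_compact)
qed

lemma area_framed_strip:
  fixes g :: "real \<Rightarrow> real" and p :: plane
  assumes e: "norm e = 1" and "a \<le> b" and cont: "continuous_on {a..b} g" and nn: "\<And>x. x \<in> {a..b} \<Longrightarrow> 0 \<le> g x"
    and I: "(g has_integral I) {a..b}"
  defines "S \<equiv> {q. a \<le> (q - p) \<bullet> e \<and> (q - p) \<bullet> e \<le> b \<and> \<bar>(q - p) \<bullet> perp e\<bar> \<le> g ((q - p) \<bullet> e)}"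
  shows "compact S" "measure lebesgue S = 2 * I"
proof -
  let ?S = "{(x, y). a \<le> x \<and> x \<le> b \<and> \<bar>y\<bar> \<le> g x}"
  note st = area_symmetric_strip[OF assms(2-5)]
  have eq: "S = frame_map p e ` ?S"
  proof (intro equalityI subsetI)
    fix q assume "q \<in> S"
    then have "((q - p) \<bullet> e, (q - p) \<bullet> perp e) \<in> ?S" by (simp add: S_def)
    then show "q \<in> frame_map p e ` ?S" by (rule rev_image_eqI) (simp only: frame_coords(3)[OF e])
  next
    fix q assume "q \<in> frame_map p e ` ?S"
    then obtain z where z: "q = frame_map p e z" "z \<in> ?S" by blast
    then show "q \<in> S" by (simp add: S_def frame_coords[OF e] case_prod_beta)
  qed
  have iso: "\<forall>x y. dist (frame_map p e x) (frame_map p e y) = dist x y"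
    using frame_coords(4)[OF e] by blast
  show "compact S" "measure lebesgue S = 2 * I"
    unfolding eq using measure_isometry_image[OF iso st(1)] st(2) by simp_all
qed


section \<open>Disks, circular segments and circular sectors\<close>

lemma measure_cball_plane: "0 \<le> r \<Longrightarrow> measure lebesgue (cball (p::plane) r) = pi * r\<^sup>2"
  by (simp add: content_cball unit_ball_vol_2 power2_eq_square)

lemma measure_ball_plane: "0 \<le> r \<Longrightarrow> measure lebesgue (ball (p::plane) r) = pi * r\<^sup>2"
  by (simp add: content_ball unit_ball_vol_2 power2_eq_square)

lemma has_integral_sqrt_circle:
  fixes R \<theta> :: real
  assumes "R > 0" "0 \<le> \<theta>" "\<theta> \<le> pi/2"
  shows "((\<lambda>x. sqrt (R\<^sup>2 - x\<^sup>2)) has_integral R\<^sup>2 * (\<theta> - sin \<theta> * cos \<theta>) / 2) {R * cos \<theta>..R}"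
proof -
  \<comment> \<open>The antiderivative is, up to sign, the area of a circular sector with angle
    \<open>arccos (x / R)\<close> less the right triangle under it.\<close>
  define F where "F x = (x * sqrt (R\<^sup>2 - x\<^sup>2) - R\<^sup>2 * arccos (x / R)) / 2" for x
  have cos0: "0 \<le> cos \<theta>" using assms by (intro cos_ge_zero) auto
  have le: "R * cos \<theta> \<le> R" using assms(1) by (simp add: mult_left_le)
  have c0: "0 \<le> R * cos \<theta>" using assms(1) cos0 by simp
  \<comment> \<open>At \<open>x = R\<close> neither the square root nor \<open>arccos\<close> is
    differentiable, so derivatives are supplied in the open interval only and continuity covers the
    end points.\<close>
  have main: "((\<lambda>x. sqrt (R\<^sup>2 - x\<^sup>2)) has_integral F R - F (R * cos \<theta>)) {R * cos \<theta>..R}"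
  proof (rule fundamental_theorem_of_calculus_interior[OF le])
    have "\<And>x. x \<in> {R * cos \<theta>..R} \<Longrightarrow> - 1 \<le> x / R \<and> x / R \<le> 1"
      using assms(1) c0 by (auto simp: field_simps)
    then show "continuous_on {R * cos \<theta>..R} F"
      unfolding F_def using assms(1) by (intro continuous_intros) auto
    fix x assume "x \<in> {R * cos \<theta><..<R}"
    then have x: "0 \<le> x" "x < R" using c0 by auto
    then have pos: "R\<^sup>2 - x\<^sup>2 > 0" using power_strict_mono[of x R 2] by simp
    have xR: "-1 < x / R" "x / R < 1" using x assms(1) by (auto simp: field_simps)
    have "1 - (x / R)\<^sup>2 = (R\<^sup>2 - x\<^sup>2) / R\<^sup>2" using assms(1) by (simp add: field_simps)
    then have sq: "sqrt (1 - (x / R)\<^sup>2) = sqrt (R\<^sup>2 - x\<^sup>2) / R"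
      using assms(1) by (simp add: real_sqrt_divide)
    have "(F has_field_derivative
       ((1 * sqrt (R\<^sup>2 - x\<^sup>2) + (- 2 * x) * (inverse (sqrt (R\<^sup>2 - x\<^sup>2)) / 2) * x)
         - R\<^sup>2 * (inverse (- sqrt (1 - (x / R)\<^sup>2)) * (1 / R))) / 2) (at x)"
      unfolding F_def using pos xR by (auto intro!: derivative_eq_intros)
    also have "((1 * sqrt (R\<^sup>2 - x\<^sup>2) + (- 2 * x) * (inverse (sqrt (R\<^sup>2 - x\<^sup>2)) / 2) * x)
         - R\<^sup>2 * (inverse (- sqrt (1 - (x / R)\<^sup>2)) * (1 / R))) / 2
       = (sqrt (R\<^sup>2 - x\<^sup>2) + (R\<^sup>2 - x\<^sup>2) / sqrt (R\<^sup>2 - x\<^sup>2)) / 2"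
      unfolding sq using assms(1) pos by (simp add: field_simps power2_eq_square)
    also have "\<dots> = sqrt (R\<^sup>2 - x\<^sup>2)" using pos by (simp add: real_div_sqrt)
    finally show "(F has_vector_derivative sqrt (R\<^sup>2 - x\<^sup>2)) (at x)"
      by (simp add: has_real_derivative_iff_has_vector_derivative)
  qed
  have "F R = 0" using assms(1) by (simp add: F_def)
  moreover have "F (R * cos \<theta>) = R\<^sup>2 * (sin \<theta> * cos \<theta> - \<theta>) / 2"
  proof -
    have "R\<^sup>2 - (R * cos \<theta>)\<^sup>2 = (R * sin \<theta>)\<^sup>2"
      by (simp add: power_mult_distrib sin_squared_eq algebra_simps)
    moreover have "0 \<le> R * sin \<theta>" using assms by (simp add: sin_ge_zero)
    ultimately have "sqrt (R\<^sup>2 - (R * cos \<theta>)\<^sup>2) = R * sin \<theta>" by simp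
    moreover have "arccos (R * cos \<theta> / R) = \<theta>" using assms by (simp add: arccos_cos)
    ultimately have "F (R * cos \<theta>) = (R * cos \<theta> * (R * sin \<theta>) - R\<^sup>2 * \<theta>) / 2"
      unfolding F_def by (simp only:)
    then show ?thesis by (simp add: power2_eq_square algebra_simps)
  qed
  ultimately have "F R - F (R * cos \<theta>) = R\<^sup>2 * (\<theta> - sin \<theta> * cos \<theta>) / 2"
    by (simp add: field_simps)
  with main show ?thesis by (simp only:)
qed

text \<open>Puts the half disk in direction \<open>e\<close> into the form of a region under a
  graph, as \<open>area_framed_strip\<close> requires.\<close>

lemma framed_abs_le_sqrt:
  assumes "norm e = 1" "R > 0" "0 \<le> (q - p) \<bullet> e"
  shows "dist q p \<le> R \<longleftrightarrow> (q - p) \<bullet> e \<le> R \<and> \<bar>(q - p) \<bullet> perp e\<bar> \<le> sqrt (R\<^sup>2 - ((q - p) \<bullet> e)\<^sup>2)"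
proof -
  have "dist q p \<le> R \<longleftrightarrow> (dist q p)\<^sup>2 \<le> R\<^sup>2"
    using assms(2) abs_le_square_iff[of "dist q p" R] by simp
  then have 1: "dist q p \<le> R \<longleftrightarrow> ((q - p) \<bullet> perp e)\<^sup>2 \<le> R\<^sup>2 - ((q - p) \<bullet> e)\<^sup>2"
    by (simp add: frame_norm[OF assms(1)] algebra_simps)
  have 2: "(q - p) \<bullet> e \<le> R" if "((q - p) \<bullet> perp e)\<^sup>2 \<le> R\<^sup>2 - ((q - p) \<bullet> e)\<^sup>2"
  proof -
    have "((q - p) \<bullet> e)\<^sup>2 \<le> R\<^sup>2" using that zero_le_power2[of "(q - p) \<bullet> perp e"] by linarith
    then show ?thesis using assms(2) by (rule power2_le_imp_le[OF _ less_imp_le])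
  qed
  show ?thesis
  proof
    assume "dist q p \<le> R"
    with 1 2 show "(q - p) \<bullet> e \<le> R \<and> \<bar>(q - p) \<bullet> perp e\<bar> \<le> sqrt (R\<^sup>2 - ((q - p) \<bullet> e)\<^sup>2)"
      by (auto intro!: real_le_rsqrt)
  next
    assume *: "(q - p) \<bullet> e \<le> R \<and> \<bar>(q - p) \<bullet> perp e\<bar> \<le> sqrt (R\<^sup>2 - ((q - p) \<bullet> e)\<^sup>2)"
    then have "((q - p) \<bullet> e)\<^sup>2 \<le> R\<^sup>2" using assms by (simp add: power_mono)
    then have "(sqrt (R\<^sup>2 - ((q - p) \<bullet> e)\<^sup>2))\<^sup>2 = R\<^sup>2 - ((q - p) \<bullet> e)\<^sup>2" by simp
    moreover have "\<bar>(q - p) \<bullet> perp e\<bar>\<^sup>2 \<le> (sqrt (R\<^sup>2 - ((q - p) \<bullet> e)\<^sup>2))\<^sup>2"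
      using * by (intro power_mono) auto
    ultimately show "dist q p \<le> R" unfolding 1 by simp
  qed
qed

text \<open>The chord at distance \<open>R * cos \<theta>\<close> from the center is seen under the
  angle \<open>2 * \<theta>\<close>; the area is that of a sector less a triangle.\<close>

lemma circular_segment:
  fixes p e :: plane
  assumes e: "norm e = 1" and "R > 0" "0 \<le> \<theta>" "\<theta> \<le> pi/2"
  defines "S \<equiv> {q. R * cos \<theta> \<le> (q - p) \<bullet> e \<and> dist q p \<le> R}"
  shows "compact S" "measure lebesgue S = R\<^sup>2 * (\<theta> - sin \<theta> * cos \<theta>)"
proof -
  have c0: "0 \<le> R * cos \<theta>" using assms by (intro mult_nonneg_nonneg cos_ge_zero) auto
  have eq: "S = {q. R * cos \<theta> \<le> (q - p) \<bullet> e \<and> (q - p) \<bullet> e \<le> R \<and>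
      \<bar>(q - p) \<bullet> perp e\<bar> \<le> (\<lambda>x. sqrt (R\<^sup>2 - x\<^sup>2)) ((q - p) \<bullet> e)}" (is "_ = ?T")
    unfolding S_def
  proof (rule Collect_cong)
    fix q show "(R * cos \<theta> \<le> (q - p) \<bullet> e \<and> dist q p \<le> R) \<longleftrightarrow> (R * cos \<theta> \<le> (q - p) \<bullet> e \<and> (q - p) \<bullet> e \<le> R \<and>
      \<bar>(q - p) \<bullet> perp e\<bar> \<le> (\<lambda>x. sqrt (R\<^sup>2 - x\<^sup>2)) ((q - p) \<bullet> e))"
      using framed_abs_le_sqrt[OF e \<open>R > 0\<close>, of q p] c0 by argo
  qed
  have "R * cos \<theta> \<le> R" using \<open>R > 0\<close> by (simp add: mult_left_le)
  moreover have "\<And>x. x \<in> {R * cos \<theta>..R} \<Longrightarrow> 0 \<le> sqrt (R\<^sup>2 - x\<^sup>2)"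
    using c0 by (auto intro!: power_mono)
  moreover have "continuous_on {R * cos \<theta>..R} (\<lambda>x. sqrt (R\<^sup>2 - x\<^sup>2))"
    by (intro continuous_intros)
  ultimately show "compact S" "measure lebesgue S = R\<^sup>2 * (\<theta> - sin \<theta> * cos \<theta>)"
    unfolding eq using area_framed_strip[OF e _ _ _ has_integral_sqrt_circle[OF assms(2-4)], of p]
    by simp_all
qed

text \<open>Above the axis the sector is bounded by the line \<open>x * tan \<theta>\<close> and
  then by the circle. They cross at \<open>R * cos \<theta>\<close>, so the integral splits into a
  triangle and a segment.\<close>

lemma circular_sector:
  fixes p e :: plane
  assumes e: "norm e = 1" and R: "R > 0" and th: "0 \<le> \<theta>" "\<theta> < pi/2"
  defines "S \<equiv> {q. dist q p \<le> R \<and> dist q p * cos \<theta> \<le> (q - p) \<bullet> e}"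
  shows "compact S" "measure lebesgue S = R\<^sup>2 * \<theta>"
proof -
  let ?g = "\<lambda>x. min (x * tan \<theta>) (sqrt (R\<^sup>2 - x\<^sup>2))"
  have c: "cos \<theta> > 0" using th by (intro cos_gt_zero_pi) auto
  have s0: "sin \<theta> \<ge> 0" using th by (intro sin_ge_zero) auto
  have t: "tan \<theta> = sin \<theta> / cos \<theta>" by (simp add: tan_def)
  \<comment> \<open>The condition says that the angle between \<open>q - p\<close> and
    \<open>e\<close> is at most \<open>\<theta>\<close>; in this product form it also makes sense at
    the apex.\<close>
  have cone: "dist q p * cos \<theta> \<le> X \<longleftrightarrow> 0 \<le> X \<and> \<bar>Y\<bar> \<le> X * tan \<theta>"
    if XY: "X = (q - p) \<bullet> e" "Y = (q - p) \<bullet> perp e" for q X Y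
  proof -
    have d: "(dist q p)\<^sup>2 = X\<^sup>2 + Y\<^sup>2" using frame_norm[OF e] XY by simp
    have "dist q p * cos \<theta> \<le> X \<longleftrightarrow> 0 \<le> X \<and> (dist q p * cos \<theta>)\<^sup>2 \<le> X\<^sup>2"
    proof -
      have "0 \<le> dist q p * cos \<theta>" using c by simp
      then show ?thesis using abs_le_square_iff[of "dist q p * cos \<theta>" X] by (cases "0 \<le> X") auto
    qed
    also have "(dist q p * cos \<theta>)\<^sup>2 \<le> X\<^sup>2 \<longleftrightarrow> (\<bar>Y\<bar> * cos \<theta>)\<^sup>2 \<le> (X * sin \<theta>)\<^sup>2"
      by (simp add: power_mult_distrib d sin_squared_eq algebra_simps)
    also have "0 \<le> X \<and> (\<bar>Y\<bar> * cos \<theta>)\<^sup>2 \<le> (X * sin \<theta>)\<^sup>2 \<longleftrightarrow> 0 \<le> X \<and> \<bar>Y\<bar> * cos \<theta> \<le> X * sin \<theta>"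
      using abs_le_square_iff[of "\<bar>Y\<bar> * cos \<theta>" "X * sin \<theta>"] c s0 by (auto simp: abs_mult)
    also have "\<bar>Y\<bar> * cos \<theta> \<le> X * sin \<theta> \<longleftrightarrow> \<bar>Y\<bar> \<le> X * tan \<theta>"
      using c by (simp add: t field_simps)
    finally show ?thesis .
  qed
  have eq: "S = {q. 0 \<le> (q - p) \<bullet> e \<and> (q - p) \<bullet> e \<le> R \<and> \<bar>(q - p) \<bullet> perp e\<bar> \<le> ?g ((q - p) \<bullet> e)}"
    unfolding S_def
  proof (rule Collect_cong)
    fix q
    show "(dist q p \<le> R \<and> dist q p * cos \<theta> \<le> (q - p) \<bullet> e) \<longleftrightarrow> (0 \<le> (q - p) \<bullet> e \<and> (q - p) \<bullet> e \<le> R \<and> \<bar>(q - p) \<bullet> perp e\<bar> \<le> ?g ((q - p) \<bullet> e))"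
      using cone[of "(q - p) \<bullet> e" q "(q - p) \<bullet> perp e"] framed_abs_le_sqrt[OF e R, of q p]
      unfolding min.bounded_iff by argo
  qed
  have le: "R * cos \<theta> \<le> R" using R by (simp add: mult_left_le)
  have c0: "0 \<le> R * cos \<theta>" using R c by simp
  have key: "x * tan \<theta> \<le> sqrt (R\<^sup>2 - x\<^sup>2) \<longleftrightarrow> x \<le> R * cos \<theta>" if "0 \<le> x" for x
  proof -
    have "0 \<le> x * tan \<theta>" using that s0 c by (simp add: t)
    then have "x * tan \<theta> \<le> sqrt (R\<^sup>2 - x\<^sup>2) \<longleftrightarrow> (x * tan \<theta>)\<^sup>2 \<le> R\<^sup>2 - x\<^sup>2"
      using real_le_rsqrt real_le_lsqrt sqrt_le_D real_sqrt_le_iff[of "(x * tan \<theta>)\<^sup>2" "R\<^sup>2 - x\<^sup>2"] by simp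
    also have "\<dots> \<longleftrightarrow> x\<^sup>2 * ((sin \<theta>)\<^sup>2 + (cos \<theta>)\<^sup>2) \<le> (R * cos \<theta>)\<^sup>2"
      using c by (simp add: t power_mult_distrib power_divide field_simps del: sin_cos_squared_add sin_cos_squared_add2)
    also have "\<dots> \<longleftrightarrow> x \<le> R * cos \<theta>"
      using that c0 abs_le_square_iff[of x "R * cos \<theta>"] by simp
    finally show ?thesis .
  qed
  have "(?g has_integral (R * cos \<theta>)\<^sup>2 * tan \<theta> / 2) {0..R * cos \<theta>}"
  proof -
    have "((\<lambda>x. x * tan \<theta>) has_integral (R * cos \<theta>)\<^sup>2 / 2 * tan \<theta>) {0..R * cos \<theta>}"
      using has_integral_mult_left[OF ident_has_integral[OF c0], of "tan \<theta>"] by simp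
    then have "(?g has_integral (R * cos \<theta>)\<^sup>2 / 2 * tan \<theta>) {0..R * cos \<theta>}"
      by (rule has_integral_eq[rotated]) (use key in auto)
    then show ?thesis by simp
  qed
  moreover have "(?g has_integral R\<^sup>2 * (\<theta> - sin \<theta> * cos \<theta>) / 2) {R * cos \<theta>..R}"
  proof (rule has_integral_eq[rotated, OF has_integral_sqrt_circle[OF R]])
    fix x assume x: "x \<in> {R * cos \<theta>..R}"
    then have "0 \<le> x" using c0 by auto
    show "sqrt (R\<^sup>2 - x\<^sup>2) = ?g x"
    proof (cases "x = R * cos \<theta>")
      case True
      have "R\<^sup>2 - (R * cos \<theta>)\<^sup>2 = (R * sin \<theta>)\<^sup>2"
        by (simp add: power_mult_distrib sin_squared_eq algebra_simps)
      moreover have "0 \<le> R * sin \<theta>" using R s0 by simp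
      ultimately have "sqrt (R\<^sup>2 - x\<^sup>2) = x * tan \<theta>" using True c by (simp add: t)
      then show ?thesis by simp
    next
      case False
      then show ?thesis using key[OF \<open>0 \<le> x\<close>] x by auto
    qed
  qed (use th in auto)
  ultimately have "(?g has_integral (R * cos \<theta>)\<^sup>2 * tan \<theta> / 2 + R\<^sup>2 * (\<theta> - sin \<theta> * cos \<theta>) / 2) {0..R}"
    by (rule has_integral_combine[OF c0 le])
  moreover have "(R * cos \<theta>)\<^sup>2 * tan \<theta> / 2 + R\<^sup>2 * (\<theta> - sin \<theta> * cos \<theta>) / 2 = R\<^sup>2 * \<theta> / 2"
    using c by (simp add: t power2_eq_square field_simps)
  ultimately have I: "(?g has_integral R\<^sup>2 * \<theta> / 2) {0..R}" by simp
  have "continuous_on {0..R} ?g" by (intro continuous_intros)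
  moreover have "0 \<le> ?g x" if "x \<in> {0..R}" for x
    using that s0 c by (auto simp: t intro!: power_mono)
  ultimately show "compact S" "measure lebesgue S = R\<^sup>2 * \<theta>"
    unfolding eq using area_framed_strip[OF e _ _ _ I, of p] R by simp_all
qed

section \<open>Packings of disks\<close>

text \<open>The three squared distances add up to at most three times the sum of the squared norms,
  here less than \<open>9 * R\<^sup>2\<close>. One point may lie on the circle: in the application
  it is the packing center whose neighbors are studied, and only the neighbors are strictly
  inside.\<close>

lemma three_points_in_disk:
  fixes a b c :: "'a::real_inner"
  assumes "norm a \<le> R" "norm b < R" "norm c < R" "d \<ge> 0" "3 * R\<^sup>2 \<le> d\<^sup>2"
    "d \<le> dist a b" "d \<le> dist b c" "d \<le> dist a c"
  shows False
proof -
  have sq: "(dist a b)\<^sup>2 + (dist b c)\<^sup>2 + (dist a c)\<^sup>2 + (norm (a + b + c))\<^sup>2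
      = 3 * ((norm a)\<^sup>2 + (norm b)\<^sup>2 + (norm c)\<^sup>2)"
    by (simp add: dist_norm power2_norm_eq_inner inner_commute algebra_simps)
  have "d\<^sup>2 \<le> (dist a b)\<^sup>2" "d\<^sup>2 \<le> (dist b c)\<^sup>2" "d\<^sup>2 \<le> (dist a c)\<^sup>2"
    using assms by (auto intro!: power_mono)
  moreover have "(norm a)\<^sup>2 \<le> R\<^sup>2" "(norm b)\<^sup>2 < R\<^sup>2" "(norm c)\<^sup>2 < R\<^sup>2"
    using assms by (auto intro!: power_mono power_strict_mono)
  moreover have "0 \<le> (norm (a + b + c))\<^sup>2" by simp
  ultimately show False using sq assms(5) by argo
qed

text \<open>The bisector of \<open>0\<close> and \<open>v\<close> has distance
  \<open>norm v / 2\<close> from the origin, so the \<open>arccos\<close> is half the angle under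
  which its chord in the disk of radius \<open>R\<close> is seen. Sectors with these half-angles
  that do not overlap have total area at most that of the disk.\<close>

lemma sum_visible_angles:
  fixes P :: "plane set"
  assumes fin: "finite P" and R: "R > 0" and d: "d \<ge> 0" "3 * R\<^sup>2 \<le> d\<^sup>2"
    and near: "\<And>v. v \<in> P \<Longrightarrow> d \<le> norm v \<and> norm v < 2 * R"
    and sep: "\<And>v w. v \<in> P \<Longrightarrow> w \<in> P \<Longrightarrow> v \<noteq> w \<Longrightarrow> d \<le> dist v w"
  shows "(\<Sum>v\<in>P. arccos (norm v / (2 * R))) \<le> pi"
proof -
  have d0: "d > 0" using R d by (metis less_le mult_pos_pos not_less power2_eq_square power_zero_numeral zero_less_numeral zero_less_power)
  let ?\<theta> = "\<lambda>v :: plane. arccos (norm v / (2 * R))"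
  have th: "0 < ?\<theta> v" "?\<theta> v < pi / 2" "cos (?\<theta> v) = norm v / (2 * R)" if "v \<in> P" for v
  proof -
    have r: "0 < norm v / (2 * R)" "norm v / (2 * R) < 1"
      using near[OF that] d0 R by (auto intro!: divide_pos_pos)
    show "0 < ?\<theta> v" using arccos_less_arccos[of "norm v / (2 * R)" 1] r by simp
    show "?\<theta> v < pi / 2" using arccos_less_arccos[of 0 "norm v / (2 * R)"] r by simp
    show "cos (?\<theta> v) = norm v / (2 * R)" using r by simp
  qed
  \<comment> \<open>The sectors are shrunk by a factor \<open>l < 1\<close>, so that they meet only at the center.\<close>
  have *: "l * (\<Sum>v\<in>P. ?\<theta> v) \<le> pi" if l: "0 < l" "l < 1" for l
  proof -
    define S where "S v = {q :: plane. dist q 0 \<le> R \<and> dist q 0 * cos (l * ?\<theta> v) \<le> (q - 0) \<bullet> (v /\<^sub>R norm v)}" for v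
    have nv: "norm (v /\<^sub>R norm v) = 1" if "v \<in> P" for v
      using near[OF that] d0 by (cases "v = 0") auto
    have lt: "0 \<le> l * ?\<theta> v" "l * ?\<theta> v < ?\<theta> v" "l * ?\<theta> v < pi / 2" if "v \<in> P" for v
    proof -
      show "0 \<le> l * ?\<theta> v" "l * ?\<theta> v < ?\<theta> v" using th[OF that] l by simp_all
      then show "l * ?\<theta> v < pi / 2" using th(2)[OF that] by linarith
    qed
    have S: "compact (S v)" "measure lebesgue (S v) = R\<^sup>2 * (l * ?\<theta> v)" if "v \<in> P" for v
      unfolding S_def using circular_sector[OF nv[OF that] R lt(1,3)[OF that], of 0] by blast+
    have "measure lebesgue (\<Union>v\<in>P. S v) = (\<Sum>v\<in>P. measure lebesgue (S v))"
    proof (rule measure_negligible_finite_Union_image[OF fin])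
      show "S v \<in> lmeasurable" if "v \<in> P" for v using S(1)[OF that] by (rule lmeasurable_compact)
      show "pairwise (\<lambda>v w. negligible (S v \<inter> S w)) P"
      proof (rule pairwiseI)
        fix v w assume vw: "v \<in> P" "w \<in> P" "v \<noteq> w"
        have "S v \<inter> S w \<subseteq> {0}"
        proof (rule ccontr)
          assume "\<not> S v \<inter> S w \<subseteq> {0}"
          then obtain q where q: "q \<in> S v" "q \<in> S w" "q \<noteq> 0" by blast
          \<comment> \<open>The point of the circle in a direction common to both sectors lies
            beyond both bisectors, hence nearer than \<open>R\<close> to \<open>v\<close> and to
            \<open>w\<close>, while its distance from the origin is \<open>R\<close>.\<close>
          define u where "u = (R / norm q) *\<^sub>R q"
          have nu: "norm u = R" using q R by (simp add: u_def)
          have close: "dist z u < R" if z: "z \<in> P" "q \<in> S z" for z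
          proof -
            have "cos (?\<theta> z) < cos (l * ?\<theta> z)"
              using lt[OF z(1)] th[OF z(1)] by (intro cos_monotone_0_pi) auto
            then have "norm q * (norm z / (2 * R)) < norm q * cos (l * ?\<theta> z)"
              using q unfolding th(3)[OF z(1)] by (intro mult_strict_left_mono) auto
            also have "\<dots> \<le> q \<bullet> (z /\<^sub>R norm z)" using z(2) by (simp add: S_def)
            also have "q \<bullet> (z /\<^sub>R norm z) = (q \<bullet> z) / norm z"
              by (simp only: inner_scaleR_right divide_inverse mult.commute)
            finally have "norm q * (norm z / (2 * R)) < (q \<bullet> z) / norm z" .
            then have "norm q * (norm z)\<^sup>2 < 2 * R * (q \<bullet> z)"
            proof -
              have "norm z > 0" using near[OF z(1)] d0 by linarith
              with \<open>norm q * (norm z / (2 * R)) < (q \<bullet> z) / norm z\<close> R show ?thesis by (simp add: field_simps power2_eq_square)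
            qed
            then have "(norm z)\<^sup>2 < 2 * (u \<bullet> z)"
              using q by (simp add: u_def field_simps)
            moreover have "(dist z u)\<^sup>2 = (norm z)\<^sup>2 - 2 * (u \<bullet> z) + R\<^sup>2"
              by (simp add: dist_norm nu[symmetric] power2_norm_eq_inner inner_commute algebra_simps)
            ultimately have "(dist z u)\<^sup>2 < R\<^sup>2" by simp
            then show ?thesis by (rule power2_less_imp_less) (use R in simp)
          qed
          have "norm (0 - u) \<le> R" "norm (v - u) < R" "norm (w - u) < R"
            using nu close[of v] close[of w] vw q by (auto simp: dist_norm)
          moreover have "d \<le> dist (0 - u) (v - u)" "d \<le> dist (v - u) (w - u)" "d \<le> dist (0 - u) (w - u)"
            using near[OF vw(1)] near[OF vw(2)] sep[OF vw] by (simp_all add: dist_norm)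
          ultimately show False using three_points_in_disk d by blast
        qed
        then show "negligible (S v \<inter> S w)" using negligible_subset by blast
      qed
    qed
    moreover have "measure lebesgue (\<Union>v\<in>P. S v) \<le> measure lebesgue (cball (0::plane) R)"
      using S(1) fin by (intro measure_mono_fmeasurable) (auto simp: S_def dist_commute lmeasurable_compact compact_UN fmeasurableD)
    ultimately have "(\<Sum>v\<in>P. R\<^sup>2 * (l * ?\<theta> v)) \<le> pi * R\<^sup>2"
      using S(2) R measure_cball_plane[of R 0] by simp
    then have "R\<^sup>2 * (l * (\<Sum>v\<in>P. ?\<theta> v)) \<le> R\<^sup>2 * pi"
      by (simp add: sum_distrib_left mult.commute mult.left_commute)
    then show ?thesis using R by simp
  qed
  show ?thesis
  proof (rule field_le_mult_one_interval)
    fix z :: real assume "0 < z" "z < 1"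
    then show "z * (\<Sum>v\<in>P. ?\<theta> v) \<le> pi" by (rule *)
  qed
qed

text \<open>Sine is concave on this interval and so lies above its chord, whose slope is
  \<open>sin (pi / 3)\<close> divided by \<open>pi / 3\<close>.\<close>

lemma sin_ge_chord:
  assumes "0 \<le> x" "x \<le> pi / 3"
  shows "3 * sqrt 3 / (2 * pi) * x \<le> sin x"
proof -
  have cv: "convex_on {0..pi/3} (\<lambda>x. - sin x)"
  proof (rule f''_ge0_imp_convex[where f' = "\<lambda>x. - cos x" and f'' = "\<lambda>x. sin x"])
    show "0 \<le> sin x" if "x \<in> {0..pi/3}" for x using that pi_gt_zero by (intro sin_ge_zero) auto
  qed (auto intro!: derivative_eq_intros)
  define t where "t = x / (pi / 3)"
  have t: "0 \<le> t" "t \<le> 1" "x = t * (pi/3)" using assms by (auto simp: t_def field_simps)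
  have "- sin ((1 - t) *\<^sub>R 0 + t *\<^sub>R (pi/3)) \<le> (1 - t) * (- sin 0) + t * (- sin (pi/3))"
    using convex_onD[OF cv t(1,2), of 0 "pi/3"] pi_gt_zero by simp
  then have "t * (sqrt 3 / 2) \<le> sin (t * (pi / 3))" by (simp add: sin_60)
  then have "t * (sqrt 3 / 2) \<le> sin x" unfolding t(3)[symmetric] .
  then show ?thesis by (simp add: t_def field_simps)
qed

text \<open>The factor is the ratio of segment to sector at \<open>\<theta> = pi / 6\<close>, the
  segments outside a regular hexagon inscribed in the circle. Equality there is what makes the
  packing bound sharp.\<close>

lemma segment_le_sector:
  assumes "0 \<le> \<theta>" "\<theta> \<le> pi / 6"
  shows "\<theta> - sin \<theta> * cos \<theta> \<le> (1 - 3 * sqrt 3 / (2 * pi)) * \<theta>"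
proof -
  have "3 * sqrt 3 / (2 * pi) * (2 * \<theta>) \<le> sin (2 * \<theta>)"
    using assms by (intro sin_ge_chord) auto
  also have "sin (2 * \<theta>) = 2 * (sin \<theta> * cos \<theta>)" by (simp add: sin_double)
  finally have "3 * sqrt 3 / (2 * pi) * \<theta> * 2 \<le> (sin \<theta> * cos \<theta>) * 2" by (simp only: mult_ac)
  then have "3 * sqrt 3 / (2 * pi) * \<theta> \<le> sin \<theta> * cos \<theta>" by (rule mult_right_le_imp_le) simp
  then show ?thesis by (simp add: left_diff_distrib)
qed

text \<open>The set \<open>V p\<close> is the open Voronoi cell of \<open>p\<close> truncated by the
  disk of radius \<open>R\<close>. Its area is at least \<open>pi * R\<^sup>2\<close> less the share
  of the segments, which is the area \<open>2 * sqrt 3 * r\<^sup>2\<close> of the regular hexagon of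
  inradius \<open>r\<close>, and these sets are disjoint subsets of a slightly larger disk.\<close>

theorem disk_packing_card:
  fixes P :: "plane set"
  assumes fin: "finite P" and r: "r > 0" and sep: "pairwise (\<lambda>p q. 2 * r \<le> dist p q) P"
    and sub: "P \<subseteq> cball 0 s" and s: "s \<ge> 0"
  shows "card P * (2 * sqrt 3 * r\<^sup>2) \<le> pi * (s + 2 * r)\<^sup>2"
proof -
  \<comment> \<open>The circumradius of the regular hexagon with inradius \<open>r\<close>. Centers
    at distance \<open>2 * R\<close> or more cut nothing off the open disk of this radius.\<close>
  define R where "R = 2 * r / sqrt 3"
  have R: "R > 0" using r by (simp add: R_def)
  have R2: "R\<^sup>2 = 4 * r\<^sup>2 / 3" by (simp add: R_def power_divide power_mult_distrib)
  have Rr: "R \<le> 2 * r" using r by (simp add: R_def field_simps)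
  define N where "N p = {q \<in> P. q \<noteq> p \<and> dist q p < 2 * R}" for p
  define seg where "seg p q = {x. R * cos (arccos (dist q p / (2 * R))) \<le> (x - p) \<bullet> ((q - p) /\<^sub>R norm (q - p)) \<and> dist x p \<le> R}" for p q :: plane
  define V where "V p = ball p R - (\<Union>q\<in>N p. seg p q)" for p
  have Nd: "2 * r \<le> dist q p" "dist q p < 2 * R" "q \<in> P" "q \<noteq> p" if "q \<in> N p" "p \<in> P" for p q
    using that sep by (auto simp: N_def pairwise_def)
  have th: "0 \<le> arccos (dist q p / (2 * R))" "arccos (dist q p / (2 * R)) \<le> pi / 6"
    "cos (arccos (dist q p / (2 * R))) = dist q p / (2 * R)"
    if "q \<in> N p" "p \<in> P" for p q
  proof -
    have q: "2 * r / (2 * R) \<le> dist q p / (2 * R)" "dist q p / (2 * R) \<le> 1" "0 \<le> dist q p / (2 * R)"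
      using Nd[OF that] R by (simp_all add: field_simps)
    have "2 * r / (2 * R) = cos (pi / 6)" using r by (simp add: R_def cos_30)
    then have "arccos (dist q p / (2 * R)) \<le> arccos (cos (pi / 6))"
      using q by (intro arccos_le_arccos) auto
    then show "arccos (dist q p / (2 * R)) \<le> pi / 6" by (simp add: arccos_cos)
    show "0 \<le> arccos (dist q p / (2 * R))" using q by (intro arccos_lbound) auto
    show "cos (arccos (dist q p / (2 * R))) = dist q p / (2 * R)" using q by simp
  qed
  have seg: "compact (seg p q)" "measure lebesgue (seg p q) \<le> R\<^sup>2 * ((1 - 3 * sqrt 3 / (2 * pi)) * arccos (dist q p / (2 * R)))"
    if "q \<in> N p" "p \<in> P" for p q
  proof -
    have e: "norm ((q - p) /\<^sub>R norm (q - p)) = 1" using Nd[OF that] by simp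
    note cs = circular_segment[OF e R th(1)[OF that], of p]
    have h: "arccos (dist q p / (2 * R)) \<le> pi / 2" using th(2)[OF that] pi_gt_zero by linarith
    show "compact (seg p q)" using cs(1)[OF h] by (simp add: seg_def)
    have "measure lebesgue (seg p q) = R\<^sup>2 * (arccos (dist q p / (2 * R)) - sin (arccos (dist q p / (2 * R))) * cos (arccos (dist q p / (2 * R))))"
      using cs(2)[OF h] unfolding seg_def .
    also have "\<dots> \<le> R\<^sup>2 * ((1 - 3 * sqrt 3 / (2 * pi)) * arccos (dist q p / (2 * R)))"
      using segment_le_sector[OF th(1,2)[OF that]] by (intro mult_left_mono) auto
    finally show "measure lebesgue (seg p q) \<le> \<dots>" .
  qed
  have Nfin: "finite (N p)" for p using fin by (simp add: N_def)
  have Us: "compact (\<Union>q\<in>N p. seg p q)" if "p \<in> P" for p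
    using Nfin seg(1) that by (intro compact_UN) auto
  have Vm: "V p \<in> lmeasurable" if "p \<in> P" for p
    unfolding V_def using Us[OF that] by (intro fmeasurable_Diff) (auto simp: lmeasurable_compact fmeasurableD)
  have kap: "0 \<le> 1 - 3 * sqrt 3 / (2 * pi)"
  proof -
    have "sin (pi/3) \<le> pi/3" by (rule sin_x_le_x) simp
    then show ?thesis by (simp add: sin_60 field_simps)
  qed
  have Vlow: "2 * sqrt 3 * r\<^sup>2 \<le> measure lebesgue (V p)" if p: "p \<in> P" for p
  proof -
    have "(\<Sum>v\<in>(\<lambda>q. q - p) ` N p. arccos (norm v / (2 * R))) \<le> pi"
    proof (rule sum_visible_angles[OF _ R, where d = "2 * r"])
      show "3 * R\<^sup>2 \<le> (2 * r)\<^sup>2" by (simp add: R2 power_mult_distrib)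
      show "2 * r \<le> norm v \<and> norm v < 2 * R" if "v \<in> (\<lambda>q. q - p) ` N p" for v
        using that Nd[OF _ p] by (auto simp: dist_norm)
      show "2 * r \<le> dist v w" if "v \<in> (\<lambda>q. q - p) ` N p" "w \<in> (\<lambda>q. q - p) ` N p" "v \<noteq> w" for v w
      proof -
        from that obtain x y where xy: "v = x - p" "w = y - p" "x \<in> N p" "y \<in> N p" by (elim imageE)
        then have "x \<in> P" "y \<in> P" "x \<noteq> y" using \<open>v \<noteq> w\<close> by (simp_all add: N_def)
        then have "2 * r \<le> dist x y" by (rule pairwiseD[OF sep])
        then show ?thesis by (simp add: xy dist_norm)
      qed
    qed (use Nfin r in auto)
    note vis = this
    have ang: "(\<Sum>q\<in>N p. arccos (dist q p / (2 * R))) \<le> pi"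
    proof -
      have "inj_on (\<lambda>q. q - p) (N p)" by (rule inj_onI) simp
      from sum.reindex[OF this, of "\<lambda>v. arccos (norm v / (2 * R))"] show ?thesis
        using vis by (simp add: dist_norm)
    qed
    have "measure lebesgue (\<Union>q\<in>N p. seg p q) \<le> (\<Sum>q\<in>N p. measure lebesgue (seg p q))"
      using seg(1)[OF _ p] Nfin by (intro measure_UNION_le) (auto simp: lmeasurable_compact fmeasurableD)
    also have "\<dots> \<le> (\<Sum>q\<in>N p. R\<^sup>2 * ((1 - 3 * sqrt 3 / (2 * pi)) * arccos (dist q p / (2 * R))))"
      using seg(2)[OF _ p] by (rule sum_mono)
    also have "\<dots> = R\<^sup>2 * ((1 - 3 * sqrt 3 / (2 * pi)) * (\<Sum>q\<in>N p. arccos (dist q p / (2 * R))))"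
      by (simp add: sum_distrib_left)
    also have "\<dots> \<le> R\<^sup>2 * ((1 - 3 * sqrt 3 / (2 * pi)) * pi)"
      using ang kap by (intro mult_left_mono) auto
    finally have u: "measure lebesgue (\<Union>q\<in>N p. seg p q) \<le> R\<^sup>2 * ((1 - 3 * sqrt 3 / (2 * pi)) * pi)" .
    have "measure lebesgue (ball p R) \<le> measure lebesgue (V p \<union> (\<Union>q\<in>N p. seg p q))"
      using Vm[OF p] lmeasurable_compact[OF Us[OF p]]
      by (intro measure_mono_fmeasurable) (auto simp: V_def fmeasurable.Un)
    also have "\<dots> \<le> measure lebesgue (V p) + measure lebesgue (\<Union>q\<in>N p. seg p q)"
      using Vm[OF p] lmeasurable_compact[OF Us[OF p]] by (intro measure_Un_le) (auto simp: fmeasurableD)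
    finally have "pi * R\<^sup>2 \<le> measure lebesgue (V p) + R\<^sup>2 * ((1 - 3 * sqrt 3 / (2 * pi)) * pi)"
      using u R measure_ball_plane[of R p] by linarith
    moreover have "pi * R\<^sup>2 - R\<^sup>2 * ((1 - 3 * sqrt 3 / (2 * pi)) * pi) = 2 * sqrt 3 * r\<^sup>2"
      by (simp add: R2 field_simps)
    ultimately show ?thesis by linarith
  qed
  have half: "(x - p) \<bullet> (q - p) < (dist q p)\<^sup>2 / 2" if "x \<in> V p" "q \<in> N p" "p \<in> P" for x p q
  proof -
    have d: "dist q p > 0" "norm (q - p) = dist q p" using Nd[OF that(2,3)] by (auto simp: dist_norm)
    have "x \<notin> seg p q" "dist x p \<le> R" using that by (auto simp: V_def dist_commute)
    then have "(x - p) \<bullet> ((q - p) /\<^sub>R norm (q - p)) < R * (dist q p / (2 * R))"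
      unfolding seg_def mem_Collect_eq th(3)[OF that(2,3)] by argo
    then have "((x - p) \<bullet> (q - p)) / dist q p < dist q p / 2"
    proof -
      have "(x - p) \<bullet> ((q - p) /\<^sub>R norm (q - p)) = ((x - p) \<bullet> (q - p)) / dist q p"
        by (simp only: inner_scaleR_right d(2) divide_inverse mult.commute)
      moreover have "R * (dist q p / (2 * R)) = dist q p / 2" using R by simp
      ultimately show ?thesis using \<open>_ < R * (dist q p / (2 * R))\<close> by linarith
    qed
    then show ?thesis using d by (simp add: field_simps power2_eq_square)
  qed
  have disj: "V p \<inter> V q = {}" if pq: "p \<in> P" "q \<in> P" "p \<noteq> q" for p q
  proof (rule ccontr)
    assume "V p \<inter> V q \<noteq> {}"
    then obtain x where x: "x \<in> V p" "x \<in> V q" by blast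
    then have "dist x p < R" "dist x q < R" by (auto simp: V_def dist_commute)
    then have "dist q p < 2 * R" using dist_triangle2[of q p x] by (simp add: dist_commute)
    then have "q \<in> N p" "p \<in> N q" using pq by (auto simp: N_def dist_commute)
    then have "(x - p) \<bullet> (q - p) < (dist q p)\<^sup>2 / 2" "(x - q) \<bullet> (p - q) < (dist p q)\<^sup>2 / 2"
      using half x pq by auto
    \<comment> \<open>Each projection is less than half of the squared distance, yet together they
      make up all of it.\<close>
    moreover have "(x - p) \<bullet> (q - p) + (x - q) \<bullet> (p - q) = (dist q p)\<^sup>2"
      by (simp add: dist_norm power2_norm_eq_inner inner_commute algebra_simps)
    ultimately show False by (simp add: dist_commute)
  qed
  have "card P * (2 * sqrt 3 * r\<^sup>2) \<le> (\<Sum>p\<in>P. measure lebesgue (V p))"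
    using sum_mono[of P "\<lambda>_. 2 * sqrt 3 * r\<^sup>2" "\<lambda>p. measure lebesgue (V p)"] Vlow by simp
  also have "\<dots> = measure lebesgue (\<Union>p\<in>P. V p)"
    using disj Vm by (intro measure_negligible_finite_Union_image[symmetric] fin) (auto simp: pairwise_def)
  also have "\<dots> \<le> measure lebesgue (cball (0::plane) (s + 2 * r))"
  proof (rule measure_mono_fmeasurable)
    show "(\<Union>p\<in>P. V p) \<subseteq> cball 0 (s + 2 * r)"
    proof safe
      fix p x assume "p \<in> P" "x \<in> V p"
      then have "norm p \<le> s" "dist x p < R" using sub by (auto simp: V_def dist_commute)
      then show "x \<in> cball 0 (s + 2 * r)" using norm_triangle_sub[of x p] Rr by (simp add: dist_norm)
    qed
    show "(\<Union>p\<in>P. V p) \<in> sets lebesgue" using Vm fin by (intro sets.finite_UN) (auto simp: fmeasurableD)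
  qed auto
  also have "\<dots> = pi * (s + 2 * r)\<^sup>2" using s r by (intro measure_cball_plane) simp
  finally show ?thesis .
qed

section \<open>Coverings by disks\<close>

text \<open>Twice the signed area of the triangle. Divided by \<open>orient a b c\<close>, the
  numbers \<open>orient x b c\<close>, \<open>orient a x c\<close> and \<open>orient a b x\<close>
  are the barycentric coordinates of \<open>x\<close>.\<close>

definition orient :: "plane \<Rightarrow> plane \<Rightarrow> plane \<Rightarrow> real" where
  "orient a b c = cross (b - a) (c - a)"

lemma orient_coords:
  "orient (a1, a2) (b1, b2) (c1, c2) = (b1 - a1) * (c2 - a2) - (b2 - a2) * (c1 - a1)"
  by (simp add: orient_def cross_def)

lemma orient_rotate: "orient b c a = orient a b c"
  by (cases a; cases b; cases c) (simp add: orient_coords algebra_simps)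

lemma orient_swap: "orient a c b = - orient a b c"
  by (cases a; cases b; cases c) (simp add: orient_coords algebra_simps)

lemma orient_degenerate [simp]: "orient a a b = 0" "orient a b a = 0" "orient a b b = 0"
  by (cases a; cases b; simp add: orient_coords)+

lemma orient_sum: "orient x b c + orient a x c + orient a b x = orient a b c"
  by (cases a; cases b; cases c; cases x) (simp add: orient_coords algebra_simps)

lemma orient_barycentric:
  "orient a b c *\<^sub>R x = orient x b c *\<^sub>R a + orient a x c *\<^sub>R b + orient a b x *\<^sub>R c"
  by (cases a; cases b; cases c; cases x) (simp add: orient_coords algebra_simps)

text \<open>A three-term Grassmann-Pluecker relation. When \<open>p\<close> replaces
  \<open>a\<close>, its right side compares barycentric coordinates of \<open>p\<close> and
  \<open>x\<close>, and its left side tells on which side of the new edge from \<open>p\<close> to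
  \<open>c\<close> the point \<open>x\<close> lies.\<close>

lemma orient_exchange:
  "orient p x c * orient a b c = orient p b c * orient a x c - orient a p c * orient x b c"
  by (cases a; cases b; cases c; cases x; cases p) (simp add: orient_coords algebra_simps)

lemma orient_convex_combination:
  assumes "u + v + w = 1" "x = u *\<^sub>R a + v *\<^sub>R b + w *\<^sub>R c"
  shows "orient x b c = u * orient a b c" "orient a x c = v * orient a b c" "orient a b x = w * orient a b c"
proof -
  have u: "u = 1 - v - w" using assms(1) by simp
  show "orient x b c = u * orient a b c" "orient a x c = v * orient a b c" "orient a b x = w * orient a b c"
    unfolding assms(2) u
    by (cases a; cases b; cases c; simp add: orient_coords algebra_simps)+
qed

lemma measure_triangle: "measure lebesgue (convex hull {a, b, c}) = \<bar>orient a b c\<bar> / 2"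
proof -
  have "of_plane ` (convex hull {a, b, c}) = convex hull {of_plane a, of_plane b, of_plane c}"
    by (simp add: convex_hull_linear_image[OF linear_of_plane])
  moreover have "compact (convex hull {a, b, c})" by (simp add: finite_imp_compact_convex_hull)
  ultimately have "measure lebesgue (convex hull {a, b, c}) = measure lborel (convex hull {of_plane a, of_plane b, of_plane c})"
    by (metis measure_of_plane_image measure_completion finite.emptyI finite_insert finite_imp_compact_convex_hull borel_compact sets_lborel)
  also have "\<dots> = \<bar>orient a b c\<bar> / 2"
    by (subst content_triangle) (cases a; cases b; cases c; simp add: orient_coords of_plane_def abs_minus_commute algebra_simps)
  finally show ?thesis .
qed

text \<open>Weitzenboeck's inequality bounds the area by the sum of the squared sides, and that sum
  is at most \<open>9 * \<rho>\<^sup>2\<close> by the same identity as for three points in a disk.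
  Equality in both characterizes the inscribed equilateral triangle.\<close>

lemma triangle_in_disk_area:
  assumes "a \<in> cball v \<rho>" "b \<in> cball v \<rho>" "c \<in> cball v \<rho>"
  shows "\<bar>orient a b c\<bar> / 2 \<le> 3 * sqrt 3 / 4 * \<rho>\<^sup>2"
proof -
  have tri: "2 * sqrt 3 * \<bar>orient a b c\<bar> \<le> (dist a b)\<^sup>2 + (dist b c)\<^sup>2 + (dist a c)\<^sup>2"
  proof -
    obtain p1 p2 q1 q2 where pq: "b - a = (p1, p2)" "c - a = (q1, q2)" by (meson surj_pair)
    have "b - c = (p1 - q1, p2 - q2)" using pq by (cases a; cases b; cases c) auto
    then have d: "(dist a b)\<^sup>2 + (dist b c)\<^sup>2 + (dist a c)\<^sup>2 = 2 * (p1\<^sup>2 + p2\<^sup>2 + q1\<^sup>2 + q2\<^sup>2 - p1 * q1 - p2 * q2)"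
    proof -
      have "(dist a b)\<^sup>2 = p1\<^sup>2 + p2\<^sup>2" "(dist a c)\<^sup>2 = q1\<^sup>2 + q2\<^sup>2"
        by (simp_all add: dist_norm norm_minus_commute[of a] pq norm_Pair)
      moreover have "(dist b c)\<^sup>2 = (p1 - q1)\<^sup>2 + (p2 - q2)\<^sup>2"
        by (simp add: dist_norm \<open>b - c = _\<close> norm_Pair)
      ultimately show ?thesis by (simp add: power2_eq_square algebra_simps)
    qed
    \<comment> \<open>For \<open>t = sqrt 3\<close> or \<open>t = - sqrt 3\<close> the squares
      vanish exactly when the third vertex completes an equilateral triangle, and the coefficient
      \<open>(1 + t\<^sup>2) / 4\<close> is 1. The two signs account for the two
      orientations.\<close>
    have "(p1 - q1 / 2 - t / 2 * q2)\<^sup>2 + (p2 - q2 / 2 + t / 2 * q1)\<^sup>2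
        = p1\<^sup>2 + p2\<^sup>2 + (1 + t\<^sup>2) / 4 * (q1\<^sup>2 + q2\<^sup>2) - p1 * q1 - p2 * q2 - t * (p1 * q2 - p2 * q1)" for t
      by (simp add: power2_eq_square field_simps)
    moreover have "0 \<le> (p1 - q1 / 2 - t / 2 * q2)\<^sup>2 + (p2 - q2 / 2 + t / 2 * q1)\<^sup>2" for t by simp
    ultimately have *: "t * (p1 * q2 - p2 * q1) \<le> p1\<^sup>2 + p2\<^sup>2 + (1 + t\<^sup>2) / 4 * (q1\<^sup>2 + q2\<^sup>2) - p1 * q1 - p2 * q2" for t
      by (metis diff_ge_0_iff_ge)
    have "sqrt 3 * \<bar>p1 * q2 - p2 * q1\<bar> \<le> p1\<^sup>2 + p2\<^sup>2 + q1\<^sup>2 + q2\<^sup>2 - p1 * q1 - p2 * q2"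
      using *[of "sqrt 3"] *[of "- sqrt 3"] by (cases "0 \<le> p1 * q2 - p2 * q1") (simp_all add: abs_if algebra_simps)
    then show ?thesis unfolding d orient_def cross_def pq by simp
  qed
  have "(dist a b)\<^sup>2 + (dist b c)\<^sup>2 + (dist a c)\<^sup>2 + (norm ((a - v) + (b - v) + (c - v)))\<^sup>2
      = 3 * ((dist v a)\<^sup>2 + (dist v b)\<^sup>2 + (dist v c)\<^sup>2)"
    by (simp add: dist_norm power2_norm_eq_inner inner_commute algebra_simps)
  moreover have "(dist v a)\<^sup>2 \<le> \<rho>\<^sup>2" "(dist v b)\<^sup>2 \<le> \<rho>\<^sup>2" "(dist v c)\<^sup>2 \<le> \<rho>\<^sup>2"
    using assms by (auto intro!: power_mono)
  moreover have "0 \<le> (norm ((a - v) + (b - v) + (c - v)))\<^sup>2" by simp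
  ultimately have "2 * sqrt 3 * \<bar>orient a b c\<bar> \<le> 9 * \<rho>\<^sup>2" using tri by argo
  then have "sqrt 3 * (2 * sqrt 3 * \<bar>orient a b c\<bar>) \<le> sqrt 3 * (9 * \<rho>\<^sup>2)"
    by (rule mult_left_mono) simp
  moreover have "sqrt 3 * (2 * sqrt 3 * \<bar>orient a b c\<bar>) = 6 * \<bar>orient a b c\<bar>" by simp
  ultimately have "6 * \<bar>orient a b c\<bar> \<le> sqrt 3 * (9 * \<rho>\<^sup>2)" by simp
  then show ?thesis by simp
qed

text \<open>Lifting the points to \<open>|p|\<^sup>2 + s ^ Suc (k p)\<close> with distinct exponents makes every coplanarity of
  four lifted points a nonzero polynomial in \<open>s\<close>. The perturbation excludes ties, at the price of
  circumscribed circles that are only almost empty.\<close>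
lemma generic_heights:
  fixes P :: "plane set"
  assumes fin: "finite P" and eps: "\<epsilon> > 0"
  obtains h where "\<And>p. p \<in> P \<Longrightarrow> (norm p)\<^sup>2 \<le> h p \<and> h p \<le> (norm p)\<^sup>2 + \<epsilon>"
    "\<And>a b c d. a \<in> P \<Longrightarrow> b \<in> P \<Longrightarrow> c \<in> P \<Longrightarrow> d \<in> P \<Longrightarrow> d \<notin> {a, b, c} \<Longrightarrow> orient a b c \<noteq> 0 \<Longrightarrow>
       h d * orient a b c \<noteq> h a * orient d b c + h b * orient a d c + h c * orient a b d"
proof -
  obtain k :: "plane \<Rightarrow> nat" where k: "inj_on k P"
    using finite_imp_inj_to_nat_seg[OF fin] by metis
  \<comment> \<open>The successor keeps the exponents positive, so the perturbation is at most
    \<open>s\<close> for \<open>s < 1\<close> and does not mix with the constant coefficient of the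
    polynomials.\<close>
  define g where "g s p = (norm p)\<^sup>2 + s ^ Suc (k p)" for s :: real and p
  define E where "E s = (\<lambda>(a, b, c, d). g s d * orient a b c - (g s a * orient d b c + g s b * orient a d c + g s c * orient a b d))" for s
  define pol where "pol = (\<lambda>(a, b, c, d).
     [: (norm d)\<^sup>2 * orient a b c - ((norm a)\<^sup>2 * orient d b c + (norm b)\<^sup>2 * orient a d c + (norm c)\<^sup>2 * orient a b d) :]
     + monom (orient a b c) (Suc (k d)) - monom (orient d b c) (Suc (k a))
     - monom (orient a d c) (Suc (k b)) - monom (orient a b d) (Suc (k c)))"
  have polE: "poly (pol t) s = E s t" for t s
    by (cases t) (simp add: pol_def E_def g_def poly_monom algebra_simps)
  define Q where "Q = {(a, b, c, d). a \<in> P \<and> b \<in> P \<and> c \<in> P \<and> d \<in> P \<and> d \<notin> {a, b, c} \<and> orient a b c \<noteq> 0}"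
  have "Q \<subseteq> P \<times> P \<times> P \<times> P" by (auto simp: Q_def)
  then have finQ: "finite Q" by (rule finite_subset) (use fin in auto)
  have nz: "pol t \<noteq> 0" if tQ: "t \<in> Q" for t
  proof -
    obtain a b c d where t: "t = (a, b, c, d)" by (cases t)
    have "k a \<noteq> k d" "k b \<noteq> k d" "k c \<noteq> k d"
      using tQ k by (auto simp: Q_def t inj_on_def)
    then have "coeff (pol t) (Suc (k d)) = orient a b c"
      by (simp add: pol_def t)
    then show ?thesis using tQ by (auto simp: Q_def t)
  qed
  have "finite (\<Union>t\<in>Q. {s. poly (pol t) s = 0})"
    using finQ nz by (intro finite_UN_I poly_roots_finite) auto
  moreover have "infinite {0<..<min 1 \<epsilon>}" using eps by (intro infinite_Ioo) auto
  ultimately obtain s where s: "s \<in> {0<..<min 1 \<epsilon>}" "s \<notin> (\<Union>t\<in>Q. {s. poly (pol t) s = 0})"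
    by (meson finite_subset subsetI)
  show ?thesis
  proof (rule that[of "g s"])
    show "(norm p)\<^sup>2 \<le> g s p \<and> g s p \<le> (norm p)\<^sup>2 + \<epsilon>" for p
    proof -
      have "s ^ Suc (k p) \<le> s * 1" unfolding power_Suc
        using s(1) by (intro mult_left_mono power_le_one) auto
      moreover have "0 \<le> s ^ Suc (k p)" using s(1) by simp
      moreover have "s \<le> \<epsilon>" using s(1) by auto
      ultimately show ?thesis unfolding g_def by linarith
    qed
    fix a b c d assume "a \<in> P" "b \<in> P" "c \<in> P" "d \<in> P" "d \<notin> {a, b, c}" "orient a b c \<noteq> 0"
    then have "(a, b, c, d) \<in> Q" by (simp add: Q_def)
    then have "poly (pol (a, b, c, d)) s \<noteq> 0" using s(2) by (simp only: UN_iff mem_Collect_eq) metis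
    then have "E s (a, b, c, d) \<noteq> 0" by (simp only: polE not_False_eq_True)
    then show "g s d * orient a b c \<noteq> g s a * orient d b c + g s b * orient a d c + g s c * orient a b d"
      by (simp add: E_def)
  qed
qed

text \<open>Cramer's rule for the affine function through three lifted points. The factor 2 makes
  \<open>v\<close> the circumcenter when \<open>h p\<close> is \<open>(norm p)\<^sup>2\<close>,
  since then the equation says that \<open>(dist v p)\<^sup>2\<close> equals
  \<open>\<kappa> + (norm v)\<^sup>2\<close>.\<close>

lemma affine_interpolation:
  assumes "orient a b c \<noteq> 0"
  obtains v \<kappa> where "\<And>p. p \<in> {a, b, c} \<Longrightarrow> h p - 2 * (v \<bullet> p) = \<kappa>"
proof -
  define D where "D = orient a b c"
  define \<beta> \<gamma> where "\<beta> = h b - h a" and "\<gamma> = h c - h a"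
  define w :: plane where "w = ((\<beta> * snd (c - a) - \<gamma> * snd (b - a)) / D, (\<gamma> * fst (b - a) - \<beta> * fst (c - a)) / D)"
  have D: "D \<noteq> 0" "D = fst (b - a) * snd (c - a) - snd (b - a) * fst (c - a)"
    using assms by (simp_all add: D_def orient_def cross_def)
  have lin: "D * (w \<bullet> z) = (\<beta> * snd (c - a) - \<gamma> * snd (b - a)) * fst z + (\<gamma> * fst (b - a) - \<beta> * fst (c - a)) * snd z" for z
    using D(1) by (cases z) (simp add: w_def field_simps)
  have "D * (w \<bullet> (b - a)) = D * \<beta>" unfolding lin by (subst D(2), algebra)
  then have b: "w \<bullet> (b - a) = h b - h a" using D(1) by (simp add: \<beta>_def)
  have "D * (w \<bullet> (c - a)) = D * \<gamma>" unfolding lin by (subst D(2), algebra)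
  then have c: "w \<bullet> (c - a) = h c - h a" using D(1) by (simp add: \<gamma>_def)
  show ?thesis
  proof (rule that[of "w /\<^sub>R 2" "h a - w \<bullet> a"])
    show "h p - 2 * ((w /\<^sub>R 2) \<bullet> p) = h a - w \<bullet> a" if "p \<in> {a, b, c}" for p
      using that b c by (auto simp: inner_diff_right)
  qed
qed

text \<open>The affine function \<open>2 * (v \<bullet> p) + \<kappa>\<close> supports the lifted points from below; for unperturbed heights
  this says that the circle with center \<open>v\<close> through the points of \<open>t\<close> has no point of \<open>P\<close> inside.\<close>
definition delaunay :: "plane set \<Rightarrow> (plane \<Rightarrow> real) \<Rightarrow> plane \<Rightarrow> real \<Rightarrow> plane set \<Rightarrow> bool" where
  "delaunay P h v \<kappa> t \<longleftrightarrow> t \<subseteq> P \<and> (\<exists>a b c. t = {a, b, c} \<and> orient a b c \<noteq> 0) \<and>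
     (\<forall>p\<in>P. \<kappa> \<le> h p - 2 * (v \<bullet> p)) \<and> (\<forall>p\<in>t. h p - 2 * (v \<bullet> p) = \<kappa>)"

lemma positive_barycentric:
  assumes x: "x \<in> convex hull {a, b, c}" and nz: "orient a b x \<noteq> 0" "orient b c x \<noteq> 0" "orient a c x \<noteq> 0"
  obtains u v w where "u > 0" "v > 0" "w > 0" "u + v + w = 1" "x = u *\<^sub>R a + v *\<^sub>R b + w *\<^sub>R c" "orient a b c \<noteq> 0"
proof -
  obtain u v w where uvw: "0 \<le> u" "0 \<le> v" "0 \<le> w" "u + v + w = 1" "x = u *\<^sub>R a + v *\<^sub>R b + w *\<^sub>R c"
    using x by (auto simp: convex_hull_3)
  note oc = orient_convex_combination[OF uvw(4,5)]
  have "orient a x c = - orient a c x" by (rule orient_swap)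
  moreover have "orient x b c = orient b c x" by (rule orient_rotate[symmetric])
  ultimately have "u \<noteq> 0" "v \<noteq> 0" "w \<noteq> 0" and o: "orient a b c \<noteq> 0" using oc nz by auto
  then have "u > 0" "v > 0" "w > 0" using uvw(1-3) by simp_all
  then show ?thesis using uvw(4,5) o by (rule that)
qed

text \<open>Among the triangles around \<open>x\<close> the one whose lift is lowest above \<open>x\<close> is supporting: a lifted point
  below its plane could be exchanged for one of its vertices, as in the simplex method.\<close>
lemma delaunay_cover:
  fixes P :: "plane set"
  assumes fin: "finite P" and x: "x \<in> convex hull P" "x \<notin> P"
    and gen: "\<And>p q. p \<in> P \<Longrightarrow> q \<in> P \<Longrightarrow> p \<noteq> q \<Longrightarrow> orient p q x \<noteq> 0"
  obtains t v \<kappa> where "delaunay P h v \<kappa> t" "x \<in> convex hull t"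
proof -
  define Cand where "Cand = {(a, b, c). a \<in> P \<and> b \<in> P \<and> c \<in> P \<and> orient a b c > 0 \<and>
     orient x b c > 0 \<and> orient a x c > 0 \<and> orient a b x > 0}"
  define H where "H = (\<lambda>(a, b, c). (h a * orient x b c + h b * orient a x c + h c * orient a b x) / orient a b c)"
  have CandI: "(a, b, c) \<in> Cand"
    if "a \<in> P" "b \<in> P" "c \<in> P" "orient a b c > 0" "orient x b c > 0" "orient a x c > 0" "orient a b x > 0" for a b c
    using that by (simp add: Cand_def)
  have "Cand \<subseteq> P \<times> P \<times> P" by (auto simp: Cand_def)
  then have finC: "finite Cand" by (rule finite_subset) (use fin in auto)
  have "Cand \<noteq> {}"
  proof -
    \<comment> \<open>Caratheodory gives at most three points with \<open>x\<close> in their hull;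
      general position of \<open>x\<close> excludes fewer than three.\<close>
    obtain s where s: "finite s" "s \<subseteq> P" "card s \<le> 3" "x \<in> convex hull s"
      using x(1) unfolding caratheodory[of P] by auto
    have "card s = 3"
    proof (rule ccontr)
      assume "card s \<noteq> 3"
      then consider "card s = 0" | "card s = 1" | "card s = 2" using s(3) by linarith
      then show False
      proof cases
        case 1 then show False using s by simp
      next
        case 2 then obtain p where "s = {p}" by (auto simp: card_1_singleton_iff)
        then show False using s x(2) by simp
      next
        case 3 then obtain p q where pq: "s = {p, q}" "p \<noteq> q" by (auto simp: card_2_iff)
        then obtain u v where "u + v = 1" "x = u *\<^sub>R p + v *\<^sub>R q" using s(4) by (auto simp: convex_hull_2)
        then have "u + v + 0 = 1" "x = u *\<^sub>R p + v *\<^sub>R q + 0 *\<^sub>R p" by simp_all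
        from orient_convex_combination(3)[OF this] have "orient p q x = 0" by simp
        then show False using gen[of p q] pq s(2) by auto
      qed
    qed
    then obtain a b c where abc: "s = {a, b, c}" "a \<noteq> b" "b \<noteq> c" "a \<noteq> c" by (auto simp: card_3_iff)
    have P: "a \<in> P" "b \<in> P" "c \<in> P" using abc s(2) by auto
    obtain u v w where uvw: "u > 0" "v > 0" "w > 0" "u + v + w = 1" "x = u *\<^sub>R a + v *\<^sub>R b + w *\<^sub>R c" "orient a b c \<noteq> 0"
      using positive_barycentric[of x a b c] s(4) abc gen P by metis
    note oc = orient_convex_combination[OF uvw(4,5)]
    show ?thesis
    proof (cases "orient a b c > 0")
      case True
      then have "(a, b, c) \<in> Cand" using uvw P oc by (intro CandI) simp_all
      then show ?thesis by blast
    next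
      case False
      then have "orient a b c < 0" using uvw(6) by simp
      moreover have "orient a c b = - orient a b c" "orient x c b = - orient x b c"
        "orient a x b = - orient a b x" "orient a c x = - orient a x c"
        by (rule orient_swap)+
      ultimately have "(a, c, b) \<in> Cand" using uvw P oc
        by (intro CandI) (simp_all add: mult_pos_neg)
      then show ?thesis by blast
    qed
  qed
  then obtain m where m: "m \<in> Cand" "\<And>y. y \<in> Cand \<Longrightarrow> H m \<le> H y"
    using finC by (metis arg_min_if_finite(1) arg_min_least)
  obtain a b c where mabc: "m = (a, b, c)" by (cases m)
  have abc: "a \<in> P" "b \<in> P" "c \<in> P" "orient a b c > 0" "orient x b c > 0" "orient a x c > 0" "orient a b x > 0"
    using m(1) by (simp_all add: mabc Cand_def)
  obtain v \<kappa> where vk: "\<And>p. p \<in> {a, b, c} \<Longrightarrow> h p - 2 * (v \<bullet> p) = \<kappa>"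
    using affine_interpolation[of a b c h] abc(4) by auto
  \<comment> \<open>The lift of any triangle above \<open>x\<close> is the height of the plane
    through the lifted \<open>a\<close>, \<open>b\<close>, \<open>c\<close> plus the barycentric
    mean of the heights of its vertices above that plane.\<close>
  have Hl: "H (a', b', c') = 2 * (v \<bullet> x) + \<kappa> + ((h a' - 2 * (v \<bullet> a') - \<kappa>) * orient x b' c' +
     (h b' - 2 * (v \<bullet> b') - \<kappa>) * orient a' x c' + (h c' - 2 * (v \<bullet> c') - \<kappa>) * orient a' b' x) / orient a' b' c'"
    if "orient a' b' c' \<noteq> 0" for a' b' c'
  proof -
    have 1: "orient a' b' c' * (v \<bullet> x) = orient x b' c' * (v \<bullet> a') + orient a' x c' * (v \<bullet> b') + orient a' b' x * (v \<bullet> c')"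
      using arg_cong[OF orient_barycentric[of a' b' c' x], of "\<lambda>z. v \<bullet> z"] by (simp add: inner_add_right)
    have "(2 * (v \<bullet> x) + \<kappa>) * orient a' b' c' + ((h a' - 2 * (v \<bullet> a') - \<kappa>) * orient x b' c' +
     (h b' - 2 * (v \<bullet> b') - \<kappa>) * orient a' x c' + (h c' - 2 * (v \<bullet> c') - \<kappa>) * orient a' b' x)
      = h a' * orient x b' c' + h b' * orient a' x c' + h c' * orient a' b' x"
      using 1 orient_sum[of x b' c' a'] by algebra
    then show ?thesis using that by (simp add: H_def add_divide_distrib[symmetric] field_simps)
  qed
  have Hm: "H m = 2 * (v \<bullet> x) + \<kappa>"
    unfolding mabc using Hl[of a b c] abc(4) vk by simp
  \<comment> \<open>The last two conditions are the ratio test: among the vertices,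
    \<open>a'\<close> has the largest quotient of the coordinate of \<open>p\<close> by that of
    \<open>x\<close>. Replacing it by \<open>p\<close> therefore keeps \<open>x\<close> inside,
    strictly by general position, and lowers the lift above \<open>x\<close> because
    \<open>p\<close> is below the plane.\<close>
  have exch: False
    if rot: "{a', b', c'} = {a, b, c}" "orient a' b' c' > 0" "orient x b' c' > 0" "orient a' x c' > 0" "orient a' b' x > 0"
    and p: "p \<in> P" "h p - 2 * (v \<bullet> p) < \<kappa>"
    and pos: "orient p b' c' > 0" "orient a' p c' * orient x b' c' \<le> orient p b' c' * orient a' x c'"
      "orient a' b' p * orient x b' c' \<le> orient p b' c' * orient a' b' x" for a' b' c' p
  proof -
    have P: "a' \<in> P" "b' \<in> P" "c' \<in> P" using rot(1) abc by auto
    have mem: "b' \<in> {a, b, c}" "c' \<in> {a, b, c}" using rot(1) by blast+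
    have ne: "p \<noteq> b'" "p \<noteq> c'" using pos(1) by auto
    have "0 \<le> orient p x c' * orient a' b' c'" using pos(2) orient_exchange[of p x c' a' b'] by linarith
    then have "0 \<le> orient p x c'" using rot(2) by (simp add: zero_le_mult_iff)
    moreover have "orient p x c' \<noteq> 0"
    proof -
      have "orient p x c' = - orient p c' x" by (rule orient_swap)
      then show ?thesis using gen[OF p(1) P(3) ne(2)] by simp
    qed
    ultimately have 1: "orient p x c' > 0" by simp
    have "0 \<le> orient p b' x * orient a' b' c'"
      using pos(3) by (cases p; cases a'; cases b'; cases c'; cases x) (simp add: orient_coords algebra_simps)
    then have "0 \<le> orient p b' x" using rot(2) by (simp add: zero_le_mult_iff)
    moreover have "orient p b' x \<noteq> 0" using gen[OF p(1) P(2) ne(1)] by simp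
    ultimately have 2: "orient p b' x > 0" by simp
    have "(p, b', c') \<in> Cand" by (rule CandI[OF p(1) P(2,3) pos(1) rot(3) 1 2])
    then have "H m \<le> H (p, b', c')" by (rule m(2))
    then have "2 * (v \<bullet> x) + \<kappa> \<le> H (p, b', c')" by (simp only: Hm)
    also have "\<dots> = 2 * (v \<bullet> x) + \<kappa> + ((h p - 2 * (v \<bullet> p) - \<kappa>) * orient x b' c') / orient p b' c'"
      using Hl[of p b' c'] pos(1) vk[OF mem(1)] vk[OF mem(2)] by simp
    finally have "0 \<le> ((h p - 2 * (v \<bullet> p) - \<kappa>) * orient x b' c') / orient p b' c'" by simp
    then show False using p(2) rot(3) pos(1) by (simp add: zero_le_divide_iff zero_le_mult_iff)
  qed
  have low: "\<kappa> \<le> h p - 2 * (v \<bullet> p)" if p: "p \<in> P" for p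
  proof (rule ccontr)
    assume "\<not> \<kappa> \<le> h p - 2 * (v \<bullet> p)"
    then have lt: "h p - 2 * (v \<bullet> p) < \<kappa>" by simp
    define A B C A' B' C' where "A = orient x b c" and "B = orient a x c" and "C = orient a b x"
      and "A' = orient p b c" and "B' = orient a p c" and "C' = orient a b p"
    have pos: "A > 0" "B > 0" "C > 0" "A' + B' + C' > 0"
      using abc orient_sum[of p b c a] by (simp_all add: A_def B_def C_def A'_def B'_def C'_def)
    have r: "orient b c a = orient a b c" "orient c a b = orient a b c"
       "orient x c a = B" "orient b x a = C" "orient b c x = A" "orient p c a = B'" "orient b p a = C'" "orient b c p = A'"
       "orient x a b = C" "orient c x b = A" "orient c a x = B" "orient p a b = C'" "orient c p b = A'" "orient c a p = B'"
      unfolding A_def B_def C_def A'_def B'_def C'_def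
      by (cases a; cases b; cases c; cases x; cases p; simp add: orient_coords algebra_simps)+
    have e1: "\<not> (A' > 0 \<and> B' * A \<le> A' * B \<and> C' * A \<le> A' * C)"
      using exch[of a b c p] abc p lt by (auto simp: A_def B_def C_def A'_def B'_def C'_def)
    have e2: "\<not> (B' > 0 \<and> C' * B \<le> B' * C \<and> A' * B \<le> B' * A)"
      using exch[of b c a p] abc p lt pos unfolding r by (auto simp: insert_commute)
    have e3: "\<not> (C' > 0 \<and> A' * C \<le> C' * A \<and> B' * C \<le> C' * B)"
      using exch[of c a b p] abc p lt pos unfolding r by (auto simp: insert_commute)
    \<comment> \<open>A vertex with the largest quotient could be exchanged if that quotient were
      positive. So all three are nonpositive, although the coordinates of \<open>p\<close> have a
      positive sum.\<close>
    define r1 where "r1 = A' / A" define r2 where "r2 = B' / B" define r3 where "r3 = C' / C"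
    have AA: "A' = r1 * A" "B' = r2 * B" "C' = r3 * C" using pos by (simp_all add: r1_def r2_def r3_def)
    have "\<not> (r1 > 0 \<and> r2 \<le> r1 \<and> r3 \<le> r1)" "\<not> (r2 > 0 \<and> r3 \<le> r2 \<and> r1 \<le> r2)" "\<not> (r3 > 0 \<and> r1 \<le> r3 \<and> r2 \<le> r3)"
      using e1 e2 e3 pos unfolding AA by (auto simp: mult_ac)
    then have "r1 \<le> 0" "r2 \<le> 0" "r3 \<le> 0" by argo+
    then have "A' \<le> 0" "B' \<le> 0" "C' \<le> 0" using pos unfolding AA by (simp_all add: mult_nonpos_nonneg)
    then show False using pos(4) by linarith
  qed
  have "x = (orient x b c / orient a b c) *\<^sub>R a + (orient a x c / orient a b c) *\<^sub>R b + (orient a b x / orient a b c) *\<^sub>R c"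
    using arg_cong[OF orient_barycentric[of a b c x], of "\<lambda>z. z /\<^sub>R orient a b c"] abc(4)
    by (simp add: scaleR_add_right divide_inverse mult.commute)
  moreover have "orient x b c / orient a b c + orient a x c / orient a b c + orient a b x / orient a b c = 1"
    using orient_sum[of x b c a] abc(4) by (simp add: add_divide_distrib[symmetric])
  ultimately have "x \<in> convex hull {a, b, c}"
    unfolding convex_hull_3 using abc by (auto intro!: exI divide_nonneg_nonneg less_imp_le)
  moreover have "delaunay P h v \<kappa> {a, b, c}"
    unfolding delaunay_def
  proof (intro conjI)
    show "\<exists>a' b' c'. {a, b, c} = {a', b', c'} \<and> orient a' b' c' \<noteq> 0"
      using abc(4) by (intro exI[of _ a] exI[of _ b] exI[of _ c]) simp
  qed (use abc low vk in blast)+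
  ultimately show ?thesis using that by blast
qed


text \<open>Two supporting affine functions \<open>l\<close> and \<open>l'\<close> are compared at
  \<open>x\<close>. On the vertices of \<open>t\<close> one has \<open>l' \<le> h = l\<close>, hence
  \<open>l' x \<le> l x\<close>; but \<open>l' x\<close> is a mean, with positive weights, of values
  \<open>h \<ge> l\<close> on \<open>t'\<close>. So \<open>h = l\<close> on \<open>t'\<close>, and
  generic heights put no fourth lifted point on the plane of \<open>t\<close>.\<close>

lemma delaunay_unique:
  fixes P :: "plane set"
  assumes d: "delaunay P h v \<kappa> t" "delaunay P h v' \<kappa>' t'"
    and x: "x \<in> convex hull t" "x \<in> convex hull t'"
    and gen: "\<And>p q. p \<in> P \<Longrightarrow> q \<in> P \<Longrightarrow> p \<noteq> q \<Longrightarrow> orient p q x \<noteq> 0"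
    and h: "\<And>a b c d. a \<in> P \<Longrightarrow> b \<in> P \<Longrightarrow> c \<in> P \<Longrightarrow> d \<in> P \<Longrightarrow> d \<notin> {a, b, c} \<Longrightarrow> orient a b c \<noteq> 0 \<Longrightarrow>
       h d * orient a b c \<noteq> h a * orient d b c + h b * orient a d c + h c * orient a b d"
  shows "t' \<subseteq> t"
proof -
  obtain a b c where t: "t = {a, b, c}" "orient a b c \<noteq> 0" using d(1) by (auto simp: delaunay_def)
  obtain a' b' c' where t': "t' = {a', b', c'}" "orient a' b' c' \<noteq> 0" using d(2) by (auto simp: delaunay_def)
  have P: "a \<in> P" "b \<in> P" "c \<in> P" "a' \<in> P" "b' \<in> P" "c' \<in> P" using d t t' by (auto simp: delaunay_def)
  have ne: "a \<noteq> b" "b \<noteq> c" "a \<noteq> c" "a' \<noteq> b'" "b' \<noteq> c'" "a' \<noteq> c'" using t t' by auto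
  obtain u1 u2 u3 where u: "u1 > 0" "u2 > 0" "u3 > 0" "u1 + u2 + u3 = 1" "x = u1 *\<^sub>R a + u2 *\<^sub>R b + u3 *\<^sub>R c"
    using positive_barycentric[of x a b c] x(1) t gen P ne by metis
  obtain w1 w2 w3 where w: "w1 > 0" "w2 > 0" "w3 > 0" "w1 + w2 + w3 = 1" "x = w1 *\<^sub>R a' + w2 *\<^sub>R b' + w3 *\<^sub>R c'"
    using positive_barycentric[of x a' b' c'] x(2) t' gen P ne by metis
  define l l' where "l z = 2 * (v \<bullet> z) + \<kappa>" and "l' z = 2 * (v' \<bullet> z) + \<kappa>'" for z
  have low: "l p \<le> h p" "l' p \<le> h p" if "p \<in> P" for p
  proof -
    have "\<kappa> \<le> h p - 2 * (v \<bullet> p)" "\<kappa>' \<le> h p - 2 * (v' \<bullet> p)" using d that unfolding delaunay_def by blast+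
    then show "l p \<le> h p" "l' p \<le> h p" unfolding l_def l'_def by linarith+
  qed
  have eq_on: "h p = l p" if "p \<in> t" for p
  proof -
    have "h p - 2 * (v \<bullet> p) = \<kappa>" using d that unfolding delaunay_def by blast
    then show ?thesis unfolding l_def by linarith
  qed
  have eq_on': "h p = l' p" if "p \<in> t'" for p
  proof -
    have "h p - 2 * (v' \<bullet> p) = \<kappa>'" using d that unfolding delaunay_def by blast
    then show ?thesis unfolding l'_def by linarith
  qed
  have eqt: "h a = l a" "h b = l b" "h c = l c" and eqt': "h a' = l' a'" "h b' = l' b'" "h c' = l' c'"
    using eq_on eq_on' unfolding t(1) t'(1) by blast+
  have aff: "l (r *\<^sub>R y1 + s *\<^sub>R y2 + q *\<^sub>R y3) = r * l y1 + s * l y2 + q * l y3"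
    "l' (r *\<^sub>R y1 + s *\<^sub>R y2 + q *\<^sub>R y3) = r * l' y1 + s * l' y2 + q * l' y3"
    if "r + s + q = 1" for r s q y1 y2 y3
  proof -
    have q: "q = 1 - r - s" using that by simp
    show "l (r *\<^sub>R y1 + s *\<^sub>R y2 + q *\<^sub>R y3) = r * l y1 + s * l y2 + q * l y3"
      "l' (r *\<^sub>R y1 + s *\<^sub>R y2 + q *\<^sub>R y3) = r * l' y1 + s * l' y2 + q * l' y3"
      unfolding l_def l'_def q by (simp_all add: inner_add_right algebra_simps)
  qed
  have x1: "l x = u1 * h a + u2 * h b + u3 * h c" "l' x = u1 * l' a + u2 * l' b + u3 * l' c"
    using aff[OF u(4), of a b c] u(5) eqt by simp_all
  have x2: "l' x = w1 * h a' + w2 * h b' + w3 * h c'" "l x = w1 * l a' + w2 * l b' + w3 * l c'"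
    using aff[OF w(4), of a' b' c'] w(5) eqt' by simp_all
  have "l' x \<le> l x" unfolding x1 using low(2) P u by (intro add_mono mult_left_mono) auto
  then have "w1 * (h a' - l a') + w2 * (h b' - l b') + w3 * (h c' - l c') \<le> 0"
    unfolding x2 by (simp add: algebra_simps)
  moreover have "0 \<le> w1 * (h a' - l a')" "0 \<le> w2 * (h b' - l b')" "0 \<le> w3 * (h c' - l c')"
    using low(1) P w by simp_all
  ultimately have "w1 * (h a' - l a') = 0" "w2 * (h b' - l b') = 0" "w3 * (h c' - l c') = 0" by linarith+
  then have eq: "h a' = l a'" "h b' = l b'" "h c' = l c'" using w by simp_all
  have "p \<in> {a, b, c}" if p: "p \<in> P" "h p = l p" for p
  proof (rule ccontr)
    assume "p \<notin> {a, b, c}"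
    from h[OF P(1-3) p(1) this t(2)] have "l p * orient a b c \<noteq> l a * orient p b c + l b * orient a p c + l c * orient a b p"
      using eqt p(2) by simp
    moreover have "orient a b c * (v \<bullet> p) = orient p b c * (v \<bullet> a) + orient a p c * (v \<bullet> b) + orient a b p * (v \<bullet> c)"
      using arg_cong[OF orient_barycentric[of a b c p], of "\<lambda>z. v \<bullet> z"] by (simp add: inner_add_right)
    ultimately show False using orient_sum[of p b c a] unfolding l_def by algebra
  qed
  then show ?thesis unfolding t(1) t'(1) using P eq by blast
qed

lemma negligible_line:
  assumes "p \<noteq> q"
  shows "negligible {x. orient p q x = 0}"
proof -
  have "{x. orient p q x = 0} = {x. perp (q - p) \<bullet> x = perp (q - p) \<bullet> p}"
    by (cases p; cases q) (auto simp: orient_coords perp_def algebra_simps)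
  moreover have "perp (q - p) \<noteq> 0" using assms by (cases p; cases q) (auto simp: perp_def zero_prod_def)
  ultimately show ?thesis using negligible_hyperplane[of "perp (q - p)"] by simp
qed

text \<open>The angle sum of a triangle expressed by areas: its three corners of radius
  \<open>\<delta>\<close> fill at least half a disk. In this form it can be summed over a
  triangulation and compared with whole disks around the vertices.\<close>

lemma triangle_angle_sum:
  assumes o: "orient a b c \<noteq> 0"
  obtains \<delta>0 where "\<delta>0 > 0" "\<And>\<delta>. 0 < \<delta> \<Longrightarrow> \<delta> \<le> \<delta>0 \<Longrightarrow>
     pi * \<delta>\<^sup>2 / 2 \<le> (\<Sum>p\<in>{a, b, c}. measure lebesgue (convex hull {a, b, c} \<inter> cball p \<delta>))"
proof -
  define e f where "e = b - a" and "f = c - a"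
  define D where "D = cross e f"
  have D: "D \<noteq> 0" using o by (simp add: D_def e_def f_def orient_def)
  define M where "M = norm e + norm f + 1"
  have M: "M > 0" using norm_ge_zero[of e] norm_ge_zero[of f] unfolding M_def by linarith
  \<comment> \<open>Small enough for a vector of length at most \<open>\<delta>0\<close> to have
    coordinates at most 1/2 in the basis \<open>e\<close>, \<open>f\<close>, by Cramer's rule and
    \<open>cross_le\<close>.\<close>
  define \<delta>0 where "\<delta>0 = \<bar>D\<bar> / (4 * M)"
  have d0: "\<delta>0 > 0" using D M by (simp add: \<delta>0_def)
  have cross_le: "\<bar>cross x y\<bar> \<le> 2 * (norm x * norm y)" for x y
  proof -
    have "\<bar>cross x y\<bar> \<le> \<bar>fst x\<bar> * \<bar>snd y\<bar> + \<bar>snd x\<bar> * \<bar>fst y\<bar>"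
      unfolding cross_def by (simp add: abs_mult[symmetric])
    also have "\<dots> \<le> norm x * norm y + norm x * norm y"
    proof -
      have "\<bar>fst z\<bar> \<le> norm z" "\<bar>snd z\<bar> \<le> norm z" for z :: plane
        using norm_fst_le[of "fst z" "snd z"] norm_snd_le[of "snd z" "fst z"] by simp_all
      then show ?thesis by (intro add_mono mult_mono) simp_all
    qed
    finally show ?thesis by simp
  qed
  let ?T = "convex hull {a, b, c}"
  have cT: "compact ?T" by (simp add: finite_imp_compact_convex_hull)
  show ?thesis
  proof (rule that[OF d0])
    fix \<delta> :: real assume del: "0 < \<delta>" "\<delta> \<le> \<delta>0"
    define C where "C p = (\<lambda>z. z - p) ` (?T \<inter> cball p \<delta>)" for p
    define C' where "C' p = uminus ` C p" for p
    have cc: "compact (?T \<inter> cball p \<delta>)" for p using cT by (simp add: compact_Int_closed)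
    have mC: "measure lebesgue (C p) = measure lebesgue (?T \<inter> cball p \<delta>)" "compact (C p)" for p
    proof -
      have i: "\<forall>x y. dist (x - p) (y - p) = dist x y" by (simp add: dist_norm)
      show "measure lebesgue (C p) = measure lebesgue (?T \<inter> cball p \<delta>)" "compact (C p)"
        unfolding C_def by (rule measure_isometry_image[OF i cc])+
    qed
    have mC': "measure lebesgue (C' p) = measure lebesgue (C p)" "compact (C' p)" for p
    proof -
      have i: "\<forall>x y. dist (- x) (- y) = dist x (y :: plane)" by (simp add: dist_minus)
      show "measure lebesgue (C' p) = measure lebesgue (C p)" "compact (C' p)"
        unfolding C'_def by (rule measure_isometry_image[OF i mC(2)])+
    qed
    have CI: "w \<in> C p" if "p + w \<in> ?T" "norm w \<le> \<delta>" for p w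
      unfolding C_def by (rule image_eqI[of _ _ "p + w"]) (use that in \<open>auto simp: dist_norm\<close>)
    have C'I: "w \<in> C' p" if "p - w \<in> ?T" "norm w \<le> \<delta>" for p w
      unfolding C'_def using CI[of p "- w"] that by (intro image_eqI[of _ _ "- w"]) auto
    have TI: "z \<in> ?T" if "z = l1 *\<^sub>R a + l2 *\<^sub>R b + l3 *\<^sub>R c" "0 \<le> l1" "0 \<le> l2" "0 \<le> l3" "l1 + l2 + l3 = 1" for z l1 l2 l3
      unfolding convex_hull_3 using that by blast
    \<comment> \<open>The three angles, moved to the origin, and their reflections cover all directions.\<close>
    have cov: "cball 0 \<delta> \<subseteq> (\<Union>p\<in>{a,b,c}. C p \<union> C' p)"
    proof
      fix w :: plane assume "w \<in> cball 0 \<delta>"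
      then have w: "norm w \<le> \<delta>" by simp
      define l m where "l = cross w f / D" and "m = - cross w e / D"
      have "D *\<^sub>R w = (cross w f) *\<^sub>R e + (- cross w e) *\<^sub>R f"
        unfolding D_def cross_def by (cases w; cases e; cases f) (simp add: algebra_simps)
      then have "(1 / D) *\<^sub>R D *\<^sub>R w = (1 / D) *\<^sub>R ((cross w f) *\<^sub>R e + (- cross w e) *\<^sub>R f)" by simp
      then have wlm: "w = l *\<^sub>R e + m *\<^sub>R f" using D by (simp add: l_def m_def scaleR_add_right scaleR_diff_right)
      have small: "\<bar>cross w z\<bar> / \<bar>D\<bar> \<le> 1 / 2" if "norm z \<le> M" for z
      proof -
        have "\<bar>cross w z\<bar> \<le> 2 * (norm w * norm z)" by (rule cross_le)
        also have "\<dots> \<le> 2 * (\<delta>0 * M)" using w del that d0 by (intro mult_left_mono mult_mono) auto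
        also have "\<dots> = \<bar>D\<bar> / 2" using M by (simp add: \<delta>0_def)
        finally show ?thesis using D by (simp add: field_simps)
      qed
      have "norm e \<le> M" "norm f \<le> M" by (simp_all add: M_def)
      then have lm: "\<bar>l\<bar> \<le> 1/2" "\<bar>m\<bar> \<le> 1/2" using small by (simp_all add: l_def m_def abs_divide)
      have eqs: "a + w = (1 - l - m) *\<^sub>R a + l *\<^sub>R b + m *\<^sub>R c" "a - w = (1 + l + m) *\<^sub>R a + (- l) *\<^sub>R b + (- m) *\<^sub>R c"
        "b + w = (- l - m) *\<^sub>R a + (1 + l) *\<^sub>R b + m *\<^sub>R c" "b - w = (l + m) *\<^sub>R a + (1 - l) *\<^sub>R b + (- m) *\<^sub>R c"
        "c + w = (- l - m) *\<^sub>R a + l *\<^sub>R b + (1 + m) *\<^sub>R c" "c - w = (l + m) *\<^sub>R a + (- l) *\<^sub>R b + (1 - m) *\<^sub>R c"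
        unfolding wlm e_def f_def by (simp_all add: algebra_simps)
      \<comment> \<open>The parallels to the three sides through the origin cut the plane into six
        angles, the three corners and their reflections; the signs of \<open>l\<close>,
        \<open>m\<close> and \<open>l + m\<close> tell them apart.\<close>
      consider "l \<ge> 0" "m \<ge> 0" | "l \<le> 0" "m \<le> 0" | "l \<le> 0" "m \<ge> 0" "l + m \<le> 0" | "l \<ge> 0" "m \<le> 0" "l + m \<ge> 0"
        | "l \<ge> 0" "m \<le> 0" "l + m \<le> 0" | "l \<le> 0" "m \<ge> 0" "l + m \<ge> 0" by linarith
      then show "w \<in> (\<Union>p\<in>{a,b,c}. C p \<union> C' p)"
      proof cases
        case 1 then have "w \<in> C a" using lm by (intro CI[OF TI[OF eqs(1)] w]) auto then show ?thesis by blast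
      next
        case 2 then have "w \<in> C' a" using lm by (intro C'I[OF TI[OF eqs(2)] w]) auto then show ?thesis by blast
      next
        case 3 then have "w \<in> C b" using lm by (intro CI[OF TI[OF eqs(3)] w]) auto then show ?thesis by blast
      next
        case 4 then have "w \<in> C' b" using lm by (intro C'I[OF TI[OF eqs(4)] w]) auto then show ?thesis by blast
      next
        case 5 then have "w \<in> C c" using lm by (intro CI[OF TI[OF eqs(5)] w]) auto then show ?thesis by blast
      next
        case 6 then have "w \<in> C' c" using lm by (intro C'I[OF TI[OF eqs(6)] w]) auto then show ?thesis by blast
      qed
    qed
    have m: "C p \<union> C' p \<in> lmeasurable" for p using mC(2) mC'(2) by (intro lmeasurable_compact compact_Un)
    have "pi * \<delta>\<^sup>2 = measure lebesgue (cball (0::plane) \<delta>)" using del measure_cball_plane[of \<delta> 0] by simp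
    also have "\<dots> \<le> measure lebesgue (\<Union>p\<in>{a,b,c}. C p \<union> C' p)"
      using cov m by (intro measure_mono_fmeasurable fmeasurable.finite_UN) auto
    also have "\<dots> \<le> (\<Sum>p\<in>{a,b,c}. measure lebesgue (C p \<union> C' p))"
      using m by (intro measure_UNION_le) (auto simp: fmeasurableD)
    also have "\<dots> \<le> (\<Sum>p\<in>{a,b,c}. 2 * measure lebesgue (?T \<inter> cball p \<delta>))"
    proof (rule sum_mono)
      fix p
      have "measure lebesgue (C p \<union> C' p) \<le> measure lebesgue (C p) + measure lebesgue (C' p)"
        using mC(2) mC'(2) by (intro measure_Un_le) (auto simp: lmeasurable_compact fmeasurableD)
      then show "measure lebesgue (C p \<union> C' p) \<le> 2 * measure lebesgue (?T \<inter> cball p \<delta>)"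
        unfolding mC'(1) mC(1) by simp
    qed
    also have "\<dots> = 2 * (\<Sum>p\<in>{a,b,c}. measure lebesgue (?T \<inter> cball p \<delta>))" by (simp only: sum_distrib_left)
    finally show "pi * \<delta>\<^sup>2 / 2 \<le> (\<Sum>p\<in>{a, b, c}. measure lebesgue (?T \<inter> cball p \<delta>))" by linarith
  qed
qed


text \<open>The circle about \<open>v\<close> with squared radius \<open>\<sigma>\<close> contains
  \<open>t\<close>, and no center is deeper inside it than \<open>\<epsilon>\<close> allows. If
  \<open>v\<close> is near \<open>x\<close>, a center within \<open>R\<close> of \<open>v\<close>
  bounds \<open>\<sigma>\<close>. If \<open>v\<close> is far away, the point \<open>w\<close> on the
  way from \<open>x\<close> to \<open>v\<close> is still in the covered disk, and a center within
  \<open>R\<close> of \<open>w\<close> lies too deep inside the circle.\<close>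

lemma delaunay_radius:
  fixes P :: "plane set"
  assumes del: "delaunay P h v \<kappa> t"
    and h: "\<And>p. p \<in> P \<Longrightarrow> (norm p)\<^sup>2 \<le> h p \<and> h p \<le> (norm p)\<^sup>2 + \<epsilon>"
    and eps: "0 < \<epsilon>" "\<epsilon> < R\<^sup>2" and R: "R > 0"
    and cov: "cball 0 s \<subseteq> (\<Union>p\<in>P. cball p R)"
    and x: "x \<in> convex hull t" "norm x \<le> s - 3 * R"
  shows "t \<subseteq> cball v (sqrt (R\<^sup>2 + \<epsilon>))"
proof -
  define \<sigma> where "\<sigma> = \<kappa> + (norm v)\<^sup>2"
  have sq: "(dist v p)\<^sup>2 = (norm p)\<^sup>2 - 2 * (v \<bullet> p) + (norm v)\<^sup>2" for p
    by (simp add: dist_norm power2_norm_eq_inner inner_commute algebra_simps)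
  have le: "(dist v p)\<^sup>2 \<le> \<sigma>" if "p \<in> t" for p
  proof -
    have "p \<in> P" "h p - 2 * (v \<bullet> p) = \<kappa>" using del that unfolding delaunay_def by blast+
    with h[of p] show ?thesis unfolding sq \<sigma>_def by linarith
  qed
  have ge: "\<sigma> - \<epsilon> \<le> (dist v p)\<^sup>2" if "p \<in> P" for p
  proof -
    have "\<kappa> \<le> h p - 2 * (v \<bullet> p)" using del that unfolding delaunay_def by blast
    with h[OF that] show ?thesis unfolding sq \<sigma>_def by linarith
  qed
  have "t \<noteq> {}" using x(1) by auto
  then obtain p0 where "p0 \<in> t" by blast
  have s0: "\<sigma> \<ge> 0" using le[OF \<open>p0 \<in> t\<close>] zero_le_power2[of "dist v p0"] by linarith
  define \<rho> where "\<rho> = sqrt \<sigma>"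
  have rho: "\<rho> \<ge> 0" "\<rho>\<^sup>2 = \<sigma>" using s0 by (simp_all add: \<rho>_def)
  have t_sub: "t \<subseteq> cball v \<rho>"
    using le rho by (auto simp: \<rho>_def real_le_rsqrt)
  then have "convex hull t \<subseteq> cball v \<rho>" by (rule hull_minimal) simp
  then have xv: "dist v x \<le> \<rho>" using x(1) by auto
  have "\<sigma> \<le> R\<^sup>2 + \<epsilon>"
  proof (cases "dist v x \<le> 2 * R")
    case True
    have "norm v \<le> norm x + dist v x" using norm_triangle_sub[of v x] by (simp add: dist_norm)
    then have "v \<in> cball 0 s" using True x(2) R by simp
    then obtain p where p: "p \<in> P" "dist v p \<le> R" using cov by (fastforce simp: dist_commute)
    have "(dist v p)\<^sup>2 \<le> R\<^sup>2" using p(2) by (intro power_mono) auto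
    with ge[OF p(1)] show ?thesis by linarith
  next
    case False
    define d where "d = dist v x"
    have d: "d > 2 * R" using False by (simp add: d_def)
    define w where "w = x + (2 * R / d) *\<^sub>R (v - x)"
    have dn: "norm (v - x) = d" by (simp add: d_def dist_norm)
    have "dist w x = 2 * R" using d R by (simp add: w_def dist_norm dn)
    then have "norm w \<le> s" using norm_triangle_sub[of w x] x(2) R by (simp add: dist_norm)
    then obtain p where p: "p \<in> P" "dist w p \<le> R" using cov by (fastforce simp: dist_commute)
    have "v - w = (1 - 2 * R / d) *\<^sub>R (v - x)" by (simp add: w_def algebra_simps)
    then have "dist v w = (1 - 2 * R / d) * d" using d R by (simp add: dist_norm dn)
    also have "\<dots> = d - 2 * R" using d R by (simp add: field_simps)
    finally have "dist v p \<le> d - R" using p(2) dist_triangle[of v p w] by linarith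
    also have "\<dots> \<le> \<rho> - R" using xv by (simp add: d_def)
    finally have "(dist v p)\<^sup>2 \<le> (\<rho> - R)\<^sup>2" by (intro power_mono) auto
    then have "\<sigma> - \<epsilon> \<le> (\<rho> - R)\<^sup>2" using ge[OF p(1)] by linarith
    then have "2 * \<rho> * R \<le> R\<^sup>2 + \<epsilon>" by (simp add: power2_diff rho(2))
    also have "\<dots> < 2 * R * R" using eps by (simp add: power2_eq_square)
    finally have "\<rho> < R" using R by simp
    then show ?thesis using xv d R by (simp add: d_def)
  qed
  then have "\<rho> \<le> sqrt (R\<^sup>2 + \<epsilon>)" by (simp add: \<rho>_def)
  then show ?thesis using t_sub by auto
qed

text \<open>Walking from \<open>x\<close> a distance \<open>2 * R\<close> away from the hull, along
  the normal of a separating line, stays in the covered disk but ends at a point that no center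
  reaches within \<open>R\<close>.\<close>

lemma covering_hull:
  fixes P :: "'a::euclidean_space set"
  assumes fin: "finite P" and cov: "cball 0 s \<subseteq> (\<Union>p\<in>P. cball p R)" and R: "R > 0"
    and x: "norm x \<le> s - 3 * R"
  shows "x \<in> convex hull P"
proof (rule ccontr)
  assume "x \<notin> convex hull P"
  moreover have "closed (convex hull P)" using fin by (simp add: compact_imp_closed finite_imp_compact_convex_hull)
  ultimately obtain n b where n: "n \<bullet> x < b" "\<And>p. p \<in> convex hull P \<Longrightarrow> n \<bullet> p > b"
    using separating_hyperplane_closed_point[of "convex hull P" x] by auto
  have sP: "p \<in> P \<Longrightarrow> n \<bullet> p > b" for p using n(2) hull_inc by metis
  have n0: "n \<noteq> 0"
  proof
    assume "n = 0"
    have "0 \<le> s" using x R norm_ge_zero[of x] by linarith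
    then have "0 \<in> cball (0::'a) s" by simp
    then obtain p where "p \<in> P" using cov by blast
    then show False using n(1) sP[of p] \<open>n = 0\<close> by simp
  qed
  define w where "w = x - (2 * R / norm n) *\<^sub>R n"
  have "norm (w - x) = 2 * R" using n0 R by (simp add: w_def)
  then have "norm w \<le> s" using norm_triangle_sub[of w x] x R by simp
  then obtain p where p: "p \<in> P" "dist p w \<le> R" using cov by fastforce
  have "n \<bullet> w = n \<bullet> x - 2 * R * norm n"
    using n0 by (simp add: w_def inner_diff_right power2_norm_eq_inner[symmetric] power2_eq_square)
  moreover have "n \<bullet> (p - w) \<le> norm n * R"
  proof -
    have "n \<bullet> (p - w) \<le> norm n * norm (p - w)" by (rule norm_cauchy_schwarz)
    also have "\<dots> \<le> norm n * R" using p(2) by (intro mult_left_mono) (auto simp: dist_norm)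
    finally show ?thesis .
  qed
  ultimately have "n \<bullet> p \<le> n \<bullet> x - norm n * R" by (simp add: inner_diff_right algebra_simps)
  moreover have "0 \<le> norm n * R" using R by simp
  ultimately show False using n(1) sP[OF p(1)] by linarith
qed

text \<open>Off the null set \<open>Lin\<close> of points collinear with two centers,
  \<open>delaunay_cover\<close> and \<open>delaunay_unique\<close> apply, so the triangles of
  \<open>T\<close> overlap only in null sets and cover the inner disk up to a null set. The constant
  is twice the extremal triangle area, for two triangles per center.\<close>

lemma disk_covering_card_eps:
  fixes P :: "plane set"
  assumes fin: "finite P" and R: "R > 0" and cov: "cball 0 s \<subseteq> (\<Union>p\<in>P. cball p R)" and s: "s \<ge> 3 * R"
    and eps: "0 < \<epsilon>" "\<epsilon> < R\<^sup>2"
  shows "pi * (s - 3 * R)\<^sup>2 \<le> card P * (3 * sqrt 3 / 2 * (R\<^sup>2 + \<epsilon>))"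
proof -
  obtain h where h: "\<And>p. p \<in> P \<Longrightarrow> (norm p)\<^sup>2 \<le> h p \<and> h p \<le> (norm p)\<^sup>2 + \<epsilon>"
    and hgen: "\<And>a b c d. a \<in> P \<Longrightarrow> b \<in> P \<Longrightarrow> c \<in> P \<Longrightarrow> d \<in> P \<Longrightarrow> d \<notin> {a, b, c} \<Longrightarrow> orient a b c \<noteq> 0 \<Longrightarrow>
       h d * orient a b c \<noteq> h a * orient d b c + h b * orient a d c + h c * orient a b d"
    using generic_heights[OF fin eps(1)] by metis
  define T where "T = {t. \<exists>v \<kappa>. delaunay P h v \<kappa> t}"
  have "T \<subseteq> Pow P" by (auto simp: T_def delaunay_def)
  then have finT: "finite T" by (rule finite_subset) (use fin in auto)
  have triT: "\<exists>a b c. t = {a, b, c} \<and> orient a b c \<noteq> 0" and TP: "t \<subseteq> P" if "t \<in> T" for t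
    using that by (auto simp: T_def delaunay_def)
  have cH: "compact (convex hull t)" if "t \<in> T" for t
    using finite_subset[OF TP[OF that] fin] by (rule finite_imp_compact_convex_hull)
  define Lin where "Lin = P \<union> (\<Union>p\<in>P. \<Union>q\<in>P - {p}. {x. orient p q x = 0})"
  have nL: "negligible Lin" unfolding Lin_def
  proof (intro negligible_Un negligible_Union)
    show "negligible P" using fin by (rule negligible_finite)
    show "negligible t" if "t \<in> (\<lambda>p. \<Union>q\<in>P - {p}. {x. orient p q x = 0}) ` P" for t
    proof -
      from that obtain p where t: "t = (\<Union>q\<in>P - {p}. {x. orient p q x = 0})" by (rule imageE)
      show ?thesis unfolding t
      proof (rule negligible_Union)
        fix l assume "l \<in> (\<lambda>q. {x. orient p q x = 0}) ` (P - {p})"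
        then obtain q where "q \<in> P - {p}" "l = {x. orient p q x = 0}" by (elim imageE)
        then have "p \<noteq> q" "l = {x. orient p q x = 0}" by auto
        then show "negligible l" using negligible_line by simp
      qed (use fin in simp)
    qed
  qed (use fin in simp)
  have genL: "orient p q x \<noteq> 0" if "x \<notin> Lin" "p \<in> P" "q \<in> P" "p \<noteq> q" for p q x
    using that unfolding Lin_def by blast
  have neg: "negligible (convex hull t \<inter> convex hull t')" if tt: "t \<in> T" "t' \<in> T" "t \<noteq> t'" for t t'
  proof -
    have "x \<in> Lin" if x: "x \<in> convex hull t" "x \<in> convex hull t'" for x
    proof (rule ccontr)
      assume "x \<notin> Lin"
      obtain v \<kappa> v' \<kappa>' where d: "delaunay P h v \<kappa> t" "delaunay P h v' \<kappa>' t'"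
        using tt(1,2) unfolding T_def by blast
      have "t' \<subseteq> t" by (rule delaunay_unique[OF d x genL[OF \<open>x \<notin> Lin\<close>] hgen])
      moreover have "t \<subseteq> t'" by (rule delaunay_unique[OF d(2,1) x(2,1) genL[OF \<open>x \<notin> Lin\<close>] hgen])
      ultimately show False using tt(3) by simp
    qed
    then show ?thesis by (intro negligible_subset[OF nL]) blast
  qed
  \<comment> \<open>Triangles near the border of the covered region may have arbitrarily large
    circumscribed circles. Those meeting the inner disk off \<open>Lin\<close> are in this set,
    which suffices for the area estimate.\<close>
  define T' where "T' = {t \<in> T. \<exists>v. t \<subseteq> cball v (sqrt (R\<^sup>2 + \<epsilon>))}"
  have finT': "finite T'" using finT by (simp add: T'_def)
  have "cball 0 (s - 3 * R) \<subseteq> (\<Union>t\<in>T'. convex hull t) \<union> Lin"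
  proof
    fix x :: plane assume "x \<in> cball 0 (s - 3 * R)"
    then have x: "norm x \<le> s - 3 * R" by simp
    show "x \<in> (\<Union>t\<in>T'. convex hull t) \<union> Lin"
    proof (cases "x \<in> Lin")
      case False
      then have "x \<notin> P" by (simp add: Lin_def)
      obtain t v \<kappa> where t: "delaunay P h v \<kappa> t" "x \<in> convex hull t"
        by (rule delaunay_cover[OF fin covering_hull[OF fin cov R x] \<open>x \<notin> P\<close> genL[OF False]])
      have "t \<subseteq> cball v (sqrt (R\<^sup>2 + \<epsilon>))" by (rule delaunay_radius[OF t(1) h eps R cov t(2) x])
      moreover have "t \<in> T" unfolding T_def using t(1) by blast
      ultimately have "t \<in> T'" unfolding T'_def by blast
      then show ?thesis using t(2) by blast
    qed simp
  qed
  moreover have mU: "(\<Union>t\<in>T'. convex hull t) \<in> lmeasurable"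
    using finT' cH by (intro fmeasurable.finite_UN lmeasurable_compact) (auto simp: T'_def)
  ultimately have "measure lebesgue (cball (0::plane) (s - 3 * R)) \<le> measure lebesgue ((\<Union>t\<in>T'. convex hull t) \<union> Lin)"
    using nL by (intro measure_mono_fmeasurable) (auto simp: fmeasurable.Un negligible_imp_measurable)
  also have "\<dots> = measure lebesgue (\<Union>t\<in>T'. convex hull t)"
    using mU nL by (simp add: measure_Un_null_set negligible_iff_null_sets fmeasurableD)
  also have "\<dots> \<le> (\<Sum>t\<in>T'. measure lebesgue (convex hull t))"
    using finT' cH by (intro measure_UNION_le) (auto simp: T'_def lmeasurable_compact fmeasurableD)
  also have "\<dots> \<le> (\<Sum>t\<in>T'. 3 * sqrt 3 / 4 * (R\<^sup>2 + \<epsilon>))"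
  proof (rule sum_mono)
    fix t assume t: "t \<in> T'"
    then obtain v where v: "t \<subseteq> cball v (sqrt (R\<^sup>2 + \<epsilon>))" "t \<in> T" by (auto simp: T'_def)
    obtain a b c where abc: "t = {a, b, c}" using triT[OF v(2)] by blast
    have "\<bar>orient a b c\<bar> / 2 \<le> 3 * sqrt 3 / 4 * (sqrt (R\<^sup>2 + \<epsilon>))\<^sup>2"
      using v(1) by (intro triangle_in_disk_area[of _ v]) (auto simp: abc)
    moreover have "(sqrt (R\<^sup>2 + \<epsilon>))\<^sup>2 = R\<^sup>2 + \<epsilon>" using eps by (intro real_sqrt_pow2) simp
    ultimately show "measure lebesgue (convex hull t) \<le> 3 * sqrt 3 / 4 * (R\<^sup>2 + \<epsilon>)"
      unfolding abc measure_triangle by simp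
  qed
  also have "\<dots> = card T' * (3 * sqrt 3 / 4 * (R\<^sup>2 + \<epsilon>))" by simp
  also have "\<dots> \<le> card T * (3 * sqrt 3 / 4 * (R\<^sup>2 + \<epsilon>))"
    using finT eps by (intro mult_right_mono of_nat_mono card_mono) (auto simp: T'_def)
  finally have area: "pi * (s - 3 * R)\<^sup>2 \<le> card T * (3 * sqrt 3 / 4 * (R\<^sup>2 + \<epsilon>))"
    using measure_cball_plane[of "s - 3 * R" 0] s by simp
  have "card T \<le> 2 * card P"
  proof (cases "T = {}")
    case False
    have "\<exists>\<delta>0>0. \<forall>\<delta>. 0 < \<delta> \<and> \<delta> \<le> \<delta>0 \<longrightarrow> pi * \<delta>\<^sup>2 / 2 \<le> (\<Sum>p\<in>t. measure lebesgue (convex hull t \<inter> cball p \<delta>))"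
      if "t \<in> T" for t
    proof -
      obtain a b c where abc: "t = {a, b, c}" "orient a b c \<noteq> 0" using triT[OF \<open>t \<in> T\<close>] by blast
      show ?thesis unfolding abc(1) by (rule triangle_angle_sum[OF abc(2)]) blast
    qed
    then obtain D where D: "\<And>t. t \<in> T \<Longrightarrow> D t > 0"
      "\<And>t \<delta>. t \<in> T \<Longrightarrow> 0 < \<delta> \<Longrightarrow> \<delta> \<le> D t \<Longrightarrow> pi * \<delta>\<^sup>2 / 2 \<le> (\<Sum>p\<in>t. measure lebesgue (convex hull t \<inter> cball p \<delta>))"
      by metis
    define \<delta> where "\<delta> = Min (D ` T)"
    have del: "\<delta> > 0" "\<And>t. t \<in> T \<Longrightarrow> \<delta> \<le> D t"
      using D(1) finT False by (auto simp: \<delta>_def)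
    have cc: "convex hull t \<inter> cball p \<delta> \<in> lmeasurable" if "t \<in> T" for t p
      using cH[OF that] by (intro lmeasurable_compact compact_Int_closed) auto
    \<comment> \<open>Double counting of corner areas: each triangle contributes at least half of
      \<open>pi * \<delta>\<^sup>2\<close>, and the corners at one center, being almost disjoint, at
      most all of it.\<close>
    have "card T * (pi * \<delta>\<^sup>2 / 2) = (\<Sum>t\<in>T. pi * \<delta>\<^sup>2 / 2)" by simp
    also have "\<dots> \<le> (\<Sum>t\<in>T. \<Sum>p\<in>P. measure lebesgue (convex hull t \<inter> cball p \<delta>))"
    proof (rule sum_mono)
      fix t assume t: "t \<in> T"
      have "pi * \<delta>\<^sup>2 / 2 \<le> (\<Sum>p\<in>t. measure lebesgue (convex hull t \<inter> cball p \<delta>))" using D(2) del t by blast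
      also have "\<dots> \<le> (\<Sum>p\<in>P. measure lebesgue (convex hull t \<inter> cball p \<delta>))"
        using fin TP[OF t] by (intro sum_mono2) auto
      finally show "pi * \<delta>\<^sup>2 / 2 \<le> \<dots>" .
    qed
    also have "\<dots> = (\<Sum>p\<in>P. \<Sum>t\<in>T. measure lebesgue (convex hull t \<inter> cball p \<delta>))" by (rule sum.swap)
    also have "\<dots> \<le> (\<Sum>p\<in>P. pi * \<delta>\<^sup>2)"
    proof (rule sum_mono)
      fix p
      have "(\<Sum>t\<in>T. measure lebesgue (convex hull t \<inter> cball p \<delta>)) = measure lebesgue (\<Union>t\<in>T. convex hull t \<inter> cball p \<delta>)"
      proof (rule measure_negligible_finite_Union_image[symmetric, OF finT cc])
        show "pairwise (\<lambda>x y. negligible (convex hull x \<inter> cball p \<delta> \<inter> (convex hull y \<inter> cball p \<delta>))) T"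
        proof (rule pairwiseI)
          fix x y assume "x \<in> T" "y \<in> T" "x \<noteq> y"
          from neg[OF this] show "negligible (convex hull x \<inter> cball p \<delta> \<inter> (convex hull y \<inter> cball p \<delta>))"
            by (rule negligible_subset) blast
        qed
      qed
      also have "\<dots> \<le> measure lebesgue (cball p \<delta>)"
        using cc finT by (intro measure_mono_fmeasurable fmeasurableD fmeasurable.finite_UN) auto
      also have "\<dots> = pi * \<delta>\<^sup>2" using del by (intro measure_cball_plane) simp
      finally show "(\<Sum>t\<in>T. measure lebesgue (convex hull t \<inter> cball p \<delta>)) \<le> pi * \<delta>\<^sup>2" .
    qed
    also have "\<dots> = card P * (pi * \<delta>\<^sup>2)" by simp
    finally have "real (card T) * (pi * \<delta>\<^sup>2) \<le> real (2 * card P) * (pi * \<delta>\<^sup>2)" by simp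
    moreover have "pi * \<delta>\<^sup>2 > 0" using del(1) by simp
    ultimately have "real (card T) \<le> real (2 * card P)" by (rule mult_right_le_imp_le)
    then show ?thesis by linarith
  qed simp
  then have "card T * (3 * sqrt 3 / 4 * (R\<^sup>2 + \<epsilon>)) \<le> real (2 * card P) * (3 * sqrt 3 / 4 * (R\<^sup>2 + \<epsilon>))"
    using eps by (intro mult_right_mono of_nat_mono) auto
  also have "\<dots> = card P * (3 * sqrt 3 / 2 * (R\<^sup>2 + \<epsilon>))" by simp
  finally show ?thesis using area by (rule order_trans[rotated])
qed

theorem disk_covering_card:
  fixes P :: "plane set"
  assumes fin: "finite P" and R: "R > 0" and cov: "cball 0 s \<subseteq> (\<Union>p\<in>P. cball p R)" and s: "s \<ge> 3 * R"
  shows "pi * (s - 3 * R)\<^sup>2 \<le> card P * (3 * sqrt 3 / 2 * R\<^sup>2)"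
proof (rule tendsto_lowerbound)
  show "((\<lambda>\<epsilon>. card P * (3 * sqrt 3 / 2 * (R\<^sup>2 + \<epsilon>))) \<longlongrightarrow> card P * (3 * sqrt 3 / 2 * R\<^sup>2)) (at_right 0)"
    by (auto intro!: tendsto_eq_intros)
  show "\<forall>\<^sub>F \<epsilon> in at_right 0. pi * (s - 3 * R)\<^sup>2 \<le> card P * (3 * sqrt 3 / 2 * (R\<^sup>2 + \<epsilon>))"
    unfolding eventually_at_right_field
  proof (intro exI[of _ "R\<^sup>2"] conjI allI impI)
    fix \<epsilon> :: real assume "0 < \<epsilon>" "\<epsilon> < R\<^sup>2"
    then show "pi * (s - 3 * R)\<^sup>2 \<le> card P * (3 * sqrt 3 / 2 * (R\<^sup>2 + \<epsilon>))"
      by (rule disk_covering_card_eps[OF assms])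
  qed (use R in simp)
qed simp

section \<open>Densities\<close>

text \<open>In \<open>ennreal\<close> every sum converges, to the supremum of its finite partial
  sums. This reduces families of any cardinality to finite subfamilies.\<close>

lemma infsum_ennreal_le:
  fixes f :: "'a \<Rightarrow> ennreal"
  assumes "\<And>F. finite F \<Longrightarrow> F \<subseteq> A \<Longrightarrow> sum f F \<le> b"
  shows "infsum f A \<le> b"
  unfolding nonneg_infsum_complete[OF zero_le] using assms by (intro SUP_least) auto

lemma infsum_ennreal_ge:
  fixes f :: "'a \<Rightarrow> ennreal"
  assumes "finite F" "F \<subseteq> A"
  shows "sum f F \<le> infsum f A"
  unfolding nonneg_infsum_complete[OF zero_le] using assms by (intro SUP_upper) auto

lemma emeasure_lborel_compact:
  fixes S :: "plane set"
  assumes "compact S"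
  shows "emeasure lborel S = ennreal (measure lebesgue S)"
proof -
  have "S \<in> lmeasurable" using assms by (rule lmeasurable_compact)
  then have "emeasure lebesgue S = ennreal (measure lebesgue S)"
    by (simp add: emeasure_eq_measure2 fmeasurableD2 emeasure_eq_ennreal_measure)
  moreover have "emeasure lebesgue S = emeasure lborel S"
    using assms by (simp add: borel_compact)
  ultimately show ?thesis by simp
qed

lemma density_le:
  assumes "\<And>F'. finite F' \<Longrightarrow> F' \<subseteq> F \<Longrightarrow> (\<Sum>C\<in>F'. emeasure lborel (C \<inter> cball 0 \<rho>)) \<le> ennreal B"
    and "\<rho> > 0"
  shows "density_in_disk F \<rho> \<le> ennreal (B / (pi * \<rho>\<^sup>2))"
proof (cases "B \<ge> 0")
  case True
  have "density_in_disk F \<rho> \<le> ennreal B / emeasure lborel (cball 0 \<rho> :: plane set)"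
    unfolding density_in_disk_def using assms(1) by (intro divide_right_mono_ennreal infsum_ennreal_le)
  also have "emeasure lborel (cball 0 \<rho> :: plane set) = ennreal (pi * \<rho>\<^sup>2)"
    using assms(2) measure_cball_plane[of \<rho> 0] by (subst emeasure_lborel_compact) auto
  also have "ennreal B / ennreal (pi * \<rho>\<^sup>2) = ennreal (B / (pi * \<rho>\<^sup>2))"
    using assms(2) True by (intro divide_ennreal) auto
  finally show ?thesis .
next
  case False
  then have "infsum (\<lambda>C. emeasure lborel (C \<inter> cball 0 \<rho>)) F \<le> 0"
    using infsum_ennreal_le[of F "\<lambda>C. emeasure lborel (C \<inter> cball 0 \<rho>)" "ennreal B"] assms(1) by (simp add: ennreal_neg)
  then show ?thesis by (simp add: density_in_disk_def)
qed

lemma density_ge: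
  fixes A B :: real
  assumes F': "finite F'" "F' \<subseteq> F" "\<And>C. C \<in> F' \<Longrightarrow> C \<subseteq> cball 0 \<rho> \<and> emeasure lborel C = ennreal A"
    and A: "A \<ge> 0" and B: "B \<le> card F' * A" and rho: "\<rho> > 0"
  shows "ennreal (B / (pi * \<rho>\<^sup>2)) \<le> density_in_disk F \<rho>"
proof -
  have "ennreal B \<le> (\<Sum>C\<in>F'. ennreal A)" using A B by (simp add: ennreal_of_nat_eq_real_of_nat ennreal_mult[symmetric] ennreal_leI)
  also have "\<dots> = (\<Sum>C\<in>F'. emeasure lborel (C \<inter> cball 0 \<rho>))"
    using F'(3) by (intro sum.cong) (auto simp: Int_absorb2)
  also have "\<dots> \<le> (\<Sum>\<^sub>\<infinity>C\<in>F. emeasure lborel (C \<inter> cball 0 \<rho>))"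
    using F' by (intro infsum_ennreal_ge) auto
  finally have le: "ennreal B \<le> (\<Sum>\<^sub>\<infinity>C\<in>F. emeasure lborel (C \<inter> cball 0 \<rho>))" .
  show ?thesis
  proof (cases "B \<ge> 0")
    case True
    have "ennreal (B / (pi * \<rho>\<^sup>2)) = ennreal B / ennreal (pi * \<rho>\<^sup>2)"
      using rho True by (intro divide_ennreal[symmetric]) auto
    also have "ennreal (pi * \<rho>\<^sup>2) = emeasure lborel (cball 0 \<rho> :: plane set)"
      using rho measure_cball_plane[of \<rho> 0] by (subst emeasure_lborel_compact) auto
    also have "ennreal B / \<dots> \<le> density_in_disk F \<rho>"
      unfolding density_in_disk_def using le by (rule divide_right_mono_ennreal)
    finally show ?thesis .
  next
    case False
    then have "B / (pi * \<rho>\<^sup>2) \<le> 0" using rho by (simp add: divide_nonpos_pos)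
    then show ?thesis by (simp add: ennreal_neg)
  qed
qed

text \<open>The common shape of all counting bounds: members of area \<open>A\<close>, one per area
  \<open>m\<close>, in a disk whose radius is altered by a fixed width \<open>k\<close>. The
  relative size of the boundary layer tends to 0.\<close>

lemma tendsto_annulus:
  fixes A k m :: real
  shows "((\<lambda>\<rho>. A * (pi * (\<rho> + k)\<^sup>2 / m) / (pi * \<rho>\<^sup>2)) \<longlongrightarrow> A / m) at_top"
proof -
  have "((\<lambda>\<rho>. A / m * (1 + k / \<rho>)\<^sup>2) \<longlongrightarrow> A / m * (1 + 0)\<^sup>2) at_top"
    by (intro tendsto_intros tendsto_divide_0[OF tendsto_const] filterlim_at_top_imp_at_infinity filterlim_ident)
  moreover have "\<forall>\<^sub>F \<rho> in at_top. A / m * (1 + k / \<rho>)\<^sup>2 = A * (pi * (\<rho> + k)\<^sup>2 / m) / (pi * \<rho>\<^sup>2)"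
    using eventually_gt_at_top[of 0]
  proof eventually_elim
    case (elim \<rho>)
    have "1 + k / \<rho> = (\<rho> + k) / \<rho>" using elim by (simp add: field_simps)
    then show ?case using elim by (simp add: power_divide)
  qed
  ultimately show ?thesis by (simp add: filterlim_cong[OF refl refl])
qed

lemma upper_density_le:
  assumes "\<forall>\<^sub>F \<rho> in at_top. density_in_disk F \<rho> \<le> ennreal (A * (pi * (\<rho> + k)\<^sup>2 / m) / (pi * \<rho>\<^sup>2))"
  shows "upper_density F \<le> ennreal (A / m)"
proof -
  have "upper_density F \<le> Limsup at_top (\<lambda>\<rho>. ennreal (A * (pi * (\<rho> + k)\<^sup>2 / m) / (pi * \<rho>\<^sup>2)))"
    unfolding upper_density_def by (rule Limsup_mono[OF assms])
  also have "\<dots> = ennreal (A / m)"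
    by (intro lim_imp_Limsup tendsto_ennrealI tendsto_annulus) simp
  finally show ?thesis .
qed

lemma lower_density_ge:
  assumes "\<forall>\<^sub>F \<rho> in at_top. ennreal (A * (pi * (\<rho> + k)\<^sup>2 / m) / (pi * \<rho>\<^sup>2)) \<le> density_in_disk F \<rho>"
  shows "ennreal (A / m) \<le> lower_density F"
proof -
  have "ennreal (A / m) = Liminf at_top (\<lambda>\<rho>. ennreal (A * (pi * (\<rho> + k)\<^sup>2 / m) / (pi * \<rho>\<^sup>2)))"
    by (intro lim_imp_Liminf[symmetric] tendsto_ennrealI tendsto_annulus) simp
  also have "\<dots> \<le> lower_density F"
    unfolding lower_density_def by (rule Liminf_mono[OF assms])
  finally show ?thesis .
qed

lemma lower_le_upper_density: "lower_density F \<le> upper_density F"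
  unfolding lower_density_def upper_density_def by (intro Liminf_le_Limsup) simp

section \<open>Density bounds for families of congruent copies\<close>

lemma congruent_copy:
  assumes "congruent_to K C" "compact K"
  obtains f where "\<forall>x y. dist (f x) (f y) = dist x y" "C = f ` K" "compact C" "measure lebesgue C = measure lebesgue K"
proof -
  obtain f where f: "\<forall>x y. dist (f x) (f y) = dist x y" "C = f ` K"
    using assms(1) by (auto simp: congruent_to_def)
  show ?thesis
    by (rule that[OF f]) (use measure_isometry_image[OF f(1) assms(2)] f(2) in simp_all)
qed

text \<open>A center of \<open>C\<close> is the image of \<open>c\<close> under some isometry
  carrying \<open>K\<close> to \<open>C\<close>. The inner ball is open, so that
  \<open>r = 0\<close> makes the condition on it vacuous; the covering bound uses this case.\<close>

lemma congruent_centers: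
  assumes F: "F \<in> congruent_families K" and K: "compact K" "ball c r \<subseteq> K" "K \<subseteq> cball c R"
  obtains g where "\<And>C. C \<in> F \<Longrightarrow> ball (g C) r \<subseteq> C \<and> C \<subseteq> cball (g C) R \<and> compact C \<and> measure lebesgue C = measure lebesgue K"
proof -
  have "\<exists>p. ball p r \<subseteq> C \<and> C \<subseteq> cball p R \<and> compact C \<and> measure lebesgue C = measure lebesgue K"
    if "C \<in> F" for C
  proof -
    have "congruent_to K C" using F that by (auto simp: congruent_families_def)
    then obtain f where f: "\<forall>x y. dist (f x) (f y) = dist x y" "C = f ` K" "compact C" "measure lebesgue C = measure lebesgue K"
      by (rule congruent_copy[OF _ K(1)])
    have "f ` ball c r \<subseteq> f ` K" "f ` K \<subseteq> f ` cball c R" using K by (auto intro: image_mono)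
    then show ?thesis using f isometry_cball_image[OF f(1)] by (intro exI[of _ "f c"]) auto
  qed
  then show ?thesis using that by metis
qed

lemma sum_measure_in_disk_le:
  fixes F' :: "plane set set" and A B :: real
  assumes "finite F'" and C: "\<And>C. C \<in> F' \<Longrightarrow> compact C \<and> measure lebesgue C = A"
    and N: "card {C \<in> F'. C \<inter> cball 0 \<rho> \<noteq> {}} * A \<le> B" and A: "A \<ge> 0"
  shows "(\<Sum>C\<in>F'. emeasure lborel (C \<inter> cball 0 \<rho>)) \<le> ennreal B"
proof -
  let ?G = "{C \<in> F'. C \<inter> cball 0 \<rho> \<noteq> {}}"
  have "(\<Sum>C\<in>F'. emeasure lborel (C \<inter> cball 0 \<rho>)) = (\<Sum>C\<in>?G. emeasure lborel (C \<inter> cball 0 \<rho>))"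
    using assms(1) by (intro sum.mono_neutral_right) auto
  also have "\<dots> \<le> (\<Sum>C\<in>?G. ennreal A)"
  proof (rule sum_mono)
    fix C assume "C \<in> ?G"
    then have c: "compact C" "measure lebesgue C = A" using C by auto
    have "emeasure lborel (C \<inter> cball 0 \<rho>) \<le> emeasure lborel C"
      using c by (intro emeasure_mono) (auto simp: borel_compact)
    then show "emeasure lborel (C \<inter> cball 0 \<rho>) \<le> ennreal A"
      using c emeasure_lborel_compact by simp
  qed
  also have "\<dots> = ennreal (card ?G * A)" using A by (simp add: ennreal_of_nat_eq_real_of_nat ennreal_mult)
  also have "\<dots> \<le> ennreal B" using N by (rule ennreal_leI)
  finally show ?thesis .
qed

theorem packing_upper_density_le:
  assumes F: "F \<in> congruent_families K" "is_packing F" and K: "compact K" "cball c r \<subseteq> K" and r: "r > 0"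
  shows "upper_density F \<le> ennreal (measure lebesgue K / (2 * sqrt 3 * r\<^sup>2))"
proof -
  obtain R0 where R0: "K \<subseteq> cball c R0"
    using bounded_subset_ballD[OF compact_imp_bounded[OF K(1)]] ball_subset_cball by blast
  define R where "R = max R0 0"
  have R: "K \<subseteq> cball c R" "R \<ge> 0" using R0 by (auto simp: R_def)
  have b: "ball c r \<subseteq> K" using K(2) ball_subset_cball by blast
  obtain g where g: "\<And>C. C \<in> F \<Longrightarrow> ball (g C) r \<subseteq> C \<and> C \<subseteq> cball (g C) R \<and> compact C \<and> measure lebesgue C = measure lebesgue K"
    using congruent_centers[OF F(1) K(1) b R(1)] by blast
  have sep: "2 * r \<le> dist (g C) (g C')" if "C \<in> F" "C' \<in> F" "C \<noteq> C'" for C C'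
  proof (rule ccontr)
    assume "\<not> 2 * r \<le> dist (g C) (g C')"
    then have "dist (midpoint (g C) (g C')) (g C) < r" "dist (midpoint (g C) (g C')) (g C') < r"
      by (auto simp: dist_midpoint)
    then have "midpoint (g C) (g C') \<in> ball (g C) r \<inter> ball (g C') r" by (simp add: dist_commute)
    moreover have "ball (g C) r \<subseteq> interior C" "ball (g C') r \<subseteq> interior C'"
      using g that by (simp_all add: interior_maximal)
    moreover have "interior C \<inter> interior C' = {}"
      using F(2) that unfolding is_packing_def pairwise_def by blast
    ultimately show False by blast
  qed
  \<comment> \<open>A copy meeting the disk of radius \<open>\<rho>\<close> has its center within
    \<open>\<rho> + R\<close>, and \<open>disk_packing_card\<close> enlarges the disk by another
    \<open>2 * r\<close>.\<close>
  have "density_in_disk F \<rho> \<le> ennreal (measure lebesgue K * (pi * (\<rho> + (R + 2 * r))\<^sup>2 / (2 * sqrt 3 * r\<^sup>2)) / (pi * \<rho>\<^sup>2))"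
    if rho: "\<rho> > 0" for \<rho>
  proof (rule density_le[OF _ rho])
    fix F' assume F': "finite F'" "F' \<subseteq> F"
    let ?G = "{C \<in> F'. C \<inter> cball 0 \<rho> \<noteq> {}}"
    have "inj_on g ?G"
    proof (rule inj_onI, rule ccontr)
      fix C C' assume "C \<in> ?G" "C' \<in> ?G" "g C = g C'" "C \<noteq> C'"
      then show False using sep[of C C'] F' r by auto
    qed
    then have "card ?G = card (g ` ?G)" by (simp add: card_image)
    moreover have "card (g ` ?G) * (2 * sqrt 3 * r\<^sup>2) \<le> pi * (\<rho> + R + 2 * r)\<^sup>2"
    proof (rule disk_packing_card[OF _ r])
      show "finite (g ` ?G)" using F' by simp
      show "pairwise (\<lambda>p q. 2 * r \<le> dist p q) (g ` ?G)"
        using sep F' by (auto simp: pairwise_def)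
      show "g ` ?G \<subseteq> cball 0 (\<rho> + R)"
      proof
        fix p assume "p \<in> g ` ?G"
        then obtain C where C: "p = g C" "C \<in> F'" "C \<inter> cball 0 \<rho> \<noteq> {}" by (elim imageE) simp
        from C(3) obtain x where x: "x \<in> C" "x \<in> cball 0 \<rho>" by blast
        have "C \<in> F" using C F' by blast
        then have "C \<subseteq> cball (g C) R" using g by blast
        then have "dist (g C) x \<le> R" using x(1) by auto
        moreover have "norm (g C) \<le> norm x + dist (g C) x" using norm_triangle_sub[of "g C" x] by (simp add: dist_norm)
        ultimately show "p \<in> cball 0 (\<rho> + R)" using x by (simp add: C(1))
      qed
      show "0 \<le> \<rho> + R" using rho R by simp
    qed
    ultimately have "card ?G \<le> pi * (\<rho> + (R + 2 * r))\<^sup>2 / (2 * sqrt 3 * r\<^sup>2)"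
      using r by (simp add: field_simps)
    then have "card ?G * measure lebesgue K \<le> measure lebesgue K * (pi * (\<rho> + (R + 2 * r))\<^sup>2 / (2 * sqrt 3 * r\<^sup>2))"
      by (subst mult.commute) (intro mult_left_mono; simp)
    then show "(\<Sum>C\<in>F'. emeasure lborel (C \<inter> cball 0 \<rho>)) \<le> ennreal (measure lebesgue K * (pi * (\<rho> + (R + 2 * r))\<^sup>2 / (2 * sqrt 3 * r\<^sup>2)))"
      using F' g by (intro sum_measure_in_disk_le[where A = "measure lebesgue K"]) (auto dest: subsetD)
  qed
  then show ?thesis
    by (intro upper_density_le[where k = "R + 2 * r"] eventually_mono[OF eventually_gt_at_top[of 0]]) auto
qed

theorem covering_lower_density_ge:
  assumes F: "F \<in> congruent_families K" "is_covering F" and K: "compact K" "K \<subseteq> cball c R" and R: "R > 0"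
  shows "ennreal (measure lebesgue K / (3 * sqrt 3 / 2 * R\<^sup>2)) \<le> lower_density F"
proof -
  obtain g where g: "\<And>C. C \<in> F \<Longrightarrow> C \<subseteq> cball (g C) R \<and> compact C \<and> measure lebesgue C = measure lebesgue K"
    using congruent_centers[OF F(1) K(1) _ K(2), of 0] by auto
  \<comment> \<open>The loss of \<open>5 * R\<close> consists of \<open>2 * R\<close>, so that the
    copies considered lie wholly inside the disk of radius \<open>\<rho>\<close>, and of
    \<open>3 * R\<close> from \<open>disk_covering_card\<close>.\<close>
  have "ennreal (measure lebesgue K * (pi * (\<rho> + (- 5 * R))\<^sup>2 / (3 * sqrt 3 / 2 * R\<^sup>2)) / (pi * \<rho>\<^sup>2)) \<le> density_in_disk F \<rho>"
    if rho: "\<rho> \<ge> 5 * R" for \<rho>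
  proof -
    define \<C> where "\<C> = {C \<in> F. C \<inter> cball 0 (\<rho> - 2 * R) \<noteq> {}}"
    define B where "B = pi * (\<rho> + (- 5 * R))\<^sup>2 / (3 * sqrt 3 / 2 * R\<^sup>2)"
    have sub: "C \<subseteq> cball 0 \<rho>" if "C \<in> \<C>" for C
    proof
      fix y assume y: "y \<in> C"
      have "C \<inter> cball 0 (\<rho> - 2 * R) \<noteq> {}" using that by (simp add: \<C>_def)
      then obtain x where "x \<in> C" "x \<in> cball 0 (\<rho> - 2 * R)" by blast
      then have x: "x \<in> C" "norm x \<le> \<rho> - 2 * R" by simp_all
      have "C \<subseteq> cball (g C) R" using that g by (auto simp: \<C>_def)
      then have "dist (g C) x \<le> R" "dist (g C) y \<le> R" using x y by auto
      then have "dist y x \<le> 2 * R" using dist_triangle2[of y x "g C"] by (simp add: dist_commute)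
      then show "y \<in> cball 0 \<rho>" using norm_triangle_sub[of y x] x by (simp add: dist_norm)
    qed
    \<comment> \<open>A covering need not be locally finite. If infinitely many members meet the
      disk, any sufficiently large finite number of them does.\<close>
    have "\<exists>\<G>. finite \<G> \<and> \<G> \<subseteq> \<C> \<and> B \<le> card \<G>"
    proof (cases "finite \<C>")
      case True
      have "pi * (\<rho> - 2 * R - 3 * R)\<^sup>2 \<le> card (g ` \<C>) * (3 * sqrt 3 / 2 * R\<^sup>2)"
      proof (rule disk_covering_card[OF _ R])
        show "finite (g ` \<C>)" using True by simp
        show "cball 0 (\<rho> - 2 * R) \<subseteq> (\<Union>p\<in>g ` \<C>. cball p R)"
        proof
          fix x :: plane assume x: "x \<in> cball 0 (\<rho> - 2 * R)"
          obtain C where C: "C \<in> F" "x \<in> C" using F(2) unfolding is_covering_def by blast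
          then have "C \<in> \<C>" using x by (auto simp: \<C>_def)
          then show "x \<in> (\<Union>p\<in>g ` \<C>. cball p R)" using g C by blast
        qed
        show "3 * R \<le> \<rho> - 2 * R" using rho by simp
      qed
      then have "B \<le> card (g ` \<C>)" using R by (simp add: B_def field_simps)
      also have "\<dots> \<le> card \<C>" using True by (simp add: card_image_le)
      finally show ?thesis using True by blast
    next
      case False
      then obtain \<G> where "finite \<G>" "card \<G> = nat \<lceil>B\<rceil>" "\<G> \<subseteq> \<C>" using infinite_arbitrarily_large by blast
      then show ?thesis by (intro exI[of _ \<G>]) (auto simp: real_nat_ceiling_ge)
    qed
    then obtain \<G> where \<G>: "finite \<G>" "\<G> \<subseteq> \<C>" "B \<le> card \<G>" by blast
    have "ennreal (measure lebesgue K * B / (pi * \<rho>\<^sup>2)) \<le> density_in_disk F \<rho>"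
    proof (rule density_ge[OF \<G>(1), where A = "measure lebesgue K"])
      show "\<G> \<subseteq> F" using \<G>(2) by (auto simp: \<C>_def)
      show "C \<subseteq> cball 0 \<rho> \<and> emeasure lborel C = ennreal (measure lebesgue K)" if C: "C \<in> \<G>" for C
      proof -
        have "C \<in> \<C>" "C \<in> F" using C \<G>(2) by (auto simp: \<C>_def)
        then show ?thesis using sub g emeasure_lborel_compact by metis
      qed
      show "measure lebesgue K * B \<le> card \<G> * measure lebesgue K"
        using \<G>(3) by (subst mult.commute) (intro mult_right_mono; simp)
    qed (use rho R in auto)
    then show ?thesis by (simp add: B_def)
  qed
  then show ?thesis
    by (intro lower_density_ge[where k = "- 5 * R"] eventually_mono[OF eventually_ge_at_top[of "5 * R"]]) auto
qed

section \<open>Lattices, their cells, and the density of a lattice family\<close>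

definition lattice_of :: "plane \<Rightarrow> plane \<Rightarrow> plane set" where
  "lattice_of a b = {of_int m *\<^sub>R a + of_int n *\<^sub>R b | m n :: int. True}"

lemma is_lattice_of:
  assumes "cross a b \<noteq> 0"
  shows "is_lattice (lattice_of a b)"
proof -
  have b: "b \<noteq> 0" using assms by (auto simp: cross_def)
  have "a \<notin> span {b}"
    using assms by (auto simp: span_singleton cross_def)
  moreover from this have "a \<noteq> b" using span_base[of b "{b}"] by auto
  ultimately have "a \<noteq> b" "independent {a, b}" using b by (simp_all add: independent_insert)
  then show ?thesis unfolding is_lattice_def lattice_of_def by blast
qed

locale plane_lattice =
  fixes a b :: plane
  assumes cross_nz: "cross a b \<noteq> 0"
begin

text \<open>Coordinates with respect to the basis \<open>a\<close>, \<open>b\<close> by Cramer's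
  rule.\<close>

definition co1 :: "plane \<Rightarrow> real" where "co1 x = cross x b / cross a b"
definition co2 :: "plane \<Rightarrow> real" where "co2 x = cross a x / cross a b"
text \<open>The fundamental parallelogram is taken closed, hence compact; its translates then
  overlap in null sets instead of being disjoint.\<close>

definition cell :: "plane set" where "cell = {x. 0 \<le> co1 x \<and> co1 x \<le> 1 \<and> 0 \<le> co2 x \<and> co2 x \<le> 1}"

lemma co_decomp: "x = co1 x *\<^sub>R a + co2 x *\<^sub>R b"
proof -
  have "cross a b *\<^sub>R x = cross x b *\<^sub>R a + cross a x *\<^sub>R b"
    by (cases x; cases a; cases b) (simp add: cross_def algebra_simps)
  then have "(1 / cross a b) *\<^sub>R cross a b *\<^sub>R x = (1 / cross a b) *\<^sub>R (cross x b *\<^sub>R a + cross a x *\<^sub>R b)" by simp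
  then show ?thesis using cross_nz by (simp add: co1_def co2_def scaleR_add_right)
qed

lemma co_lin: "co1 (s *\<^sub>R a + t *\<^sub>R b) = s" "co2 (s *\<^sub>R a + t *\<^sub>R b) = t"
proof -
  have "cross (s *\<^sub>R a + t *\<^sub>R b) b = s * cross a b" "cross a (s *\<^sub>R a + t *\<^sub>R b) = t * cross a b"
    by (cases a; cases b; simp add: cross_def algebra_simps)+
  then show "co1 (s *\<^sub>R a + t *\<^sub>R b) = s" "co2 (s *\<^sub>R a + t *\<^sub>R b) = t"
    using cross_nz by (simp_all add: co1_def co2_def)
qed

lemma co_add: "co1 (x + y) = co1 x + co1 y" "co2 (x + y) = co2 x + co2 y"
  by (simp_all add: co1_def co2_def cross_def add_divide_distrib[symmetric] diff_divide_distrib[symmetric] algebra_simps)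

text \<open>The cell is the image of the unit square under the linear map with columns
  \<open>a\<close> and \<open>b\<close>, whose determinant is \<open>cross a b\<close>.\<close>

lemma cell_measure: "compact cell" "measure lebesgue cell = \<bar>cross a b\<bar>"
proof -
  define L :: "plane \<Rightarrow> plane" where "L z = fst z *\<^sub>R a + snd z *\<^sub>R b" for z
  define g where "g = of_plane \<circ> L \<circ> to_plane"
  let ?Q = "cbox (0,0) (1,1) :: plane set"
  have lin: "linear L" by (rule linearI) (simp_all add: L_def algebra_simps)
  then have ling: "linear g" unfolding g_def by (intro linear_compose linear_to_plane linear_of_plane)
  have cell_eq: "cell = L ` ?Q"
  proof (intro equalityI subsetI)
    fix x assume "x \<in> cell"
    then have "(co1 x, co2 x) \<in> ?Q" by (simp add: cell_def cbox_Pair_eq)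
    moreover have "x = L (co1 x, co2 x)" using co_decomp[of x] by (simp add: L_def)
    ultimately show "x \<in> L ` ?Q" by blast
  qed (auto simp: L_def cell_def co_lin cbox_Pair_eq)
  then show c: "compact cell" using lin by (simp add: compact_linear_image_plane)
  have "det (matrix g) = cross a b"
    by (simp add: det_2 matrix_def g_def L_def of_plane_def to_plane_def axis_def cross_def)
  then have "measure lebesgue (g ` of_plane ` ?Q) = \<bar>cross a b\<bar> * measure lebesgue (of_plane ` ?Q)"
    by (subst measure_linear_image[OF ling]) (auto intro!: lmeasurable_compact compact_linear_image_plane linear_of_plane)
  also have "measure lebesgue (of_plane ` ?Q) = 1"
    by (subst measure_of_plane_image) (auto simp: content_Pair)
  also have "g ` of_plane ` ?Q = of_plane ` cell" by (simp add: cell_eq g_def image_comp o_def)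
  finally show "measure lebesgue cell = \<bar>cross a b\<bar>" using measure_of_plane_image[OF c] by simp
qed

lemma cell_norm: "x \<in> cell \<Longrightarrow> norm x \<le> norm a + norm b"
proof -
  assume x: "x \<in> cell"
  have "norm x \<le> norm (co1 x *\<^sub>R a) + norm (co2 x *\<^sub>R b)" by (subst co_decomp[of x]) (rule norm_triangle_ineq)
  also have "\<dots> \<le> norm a + norm b" using x by (intro add_mono) (auto simp: cell_def mult_left_le_one_le)
  finally show ?thesis .
qed

lemma lattice_co: "v \<in> lattice_of a b \<longleftrightarrow> co1 v \<in> \<int> \<and> co2 v \<in> \<int>"
proof
  assume "v \<in> lattice_of a b"
  then show "co1 v \<in> \<int> \<and> co2 v \<in> \<int>" by (auto simp: lattice_of_def co_lin)
next
  assume "co1 v \<in> \<int> \<and> co2 v \<in> \<int>"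
  then obtain m n where "co1 v = of_int m" "co2 v = of_int n" by (auto elim!: Ints_cases)
  then show "v \<in> lattice_of a b" using co_decomp[of v] by (auto simp: lattice_of_def)
qed

lemma cell_cover: "\<exists>v\<in>lattice_of a b. x - v \<in> cell"
proof -
  define v where "v = of_int \<lfloor>co1 x\<rfloor> *\<^sub>R a + of_int \<lfloor>co2 x\<rfloor> *\<^sub>R b"
  have "co1 (x - v) = co1 x - of_int \<lfloor>co1 x\<rfloor>" "co2 (x - v) = co2 x - of_int \<lfloor>co2 x\<rfloor>"
    using co_add[of "x - v" v] by (simp_all add: v_def co_lin)
  then have "x - v \<in> cell" unfolding cell_def mem_Collect_eq by linarith
  moreover have "v \<in> lattice_of a b" by (auto simp: v_def lattice_of_def)
  ultimately show ?thesis by blast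
qed

lemma negligible_co: "negligible {x. co1 x = k}" "negligible {x. co2 x = k}"
proof -
  have n: "a \<noteq> 0" "b \<noteq> 0" using cross_nz by (auto simp: cross_def)
  have c: "cross x b = (- perp b) \<bullet> x" "cross a x = perp a \<bullet> x" for x
    by (simp_all add: cross_def perp_def inner_prod_def)
  have "{x. co1 x = k} = {x. (- perp b) \<bullet> x = k * cross a b}"
    unfolding c(1)[symmetric] co1_def using cross_nz by (simp add: divide_eq_eq)
  moreover have "- perp b \<noteq> 0" using n(2) by (auto simp: perp_def prod_eq_iff)
  ultimately show "negligible {x. co1 x = k}" using negligible_hyperplane[of "- perp b"] by simp
  have "{x. co2 x = k} = {x. perp a \<bullet> x = k * cross a b}"
    unfolding c(2)[symmetric] co2_def using cross_nz by (simp add: divide_eq_eq)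
  moreover have "perp a \<noteq> 0" using n(1) by (auto simp: perp_def prod_eq_iff)
  ultimately show "negligible {x. co2 x = k}" using negligible_hyperplane[of "perp a"] by simp
qed

lemma cells_overlap:
  assumes "v \<in> lattice_of a b" "w \<in> lattice_of a b" "v \<noteq> w"
  shows "negligible ((+) v ` cell \<inter> (+) w ` cell)"
proof -
  obtain m n m' n' :: int where mn: "co1 v = m" "co2 v = n" "co1 w = m'" "co2 w = n'"
    using assms(1,2) unfolding lattice_co by (auto elim!: Ints_cases)
  have ne: "m \<noteq> m' \<or> n \<noteq> n'" using assms(3) co_decomp[of v] co_decomp[of w] mn by metis
  have "(+) v ` cell \<inter> (+) w ` cell \<subseteq> {x. co1 x = m} \<union> {x. co1 x = m'} \<union> {x. co2 x = n} \<union> {x. co2 x = n'}"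
  proof
    fix x assume "x \<in> (+) v ` cell \<inter> (+) w ` cell"
    then obtain y z where yz: "x = v + y" "x = w + z" "y \<in> cell" "z \<in> cell" by blast
    have e: "co1 x = m + co1 y" "co2 x = n + co2 y" "co1 x = m' + co1 z" "co2 x = n' + co2 z"
      using yz(1,2) mn by (simp_all add: co_add) (metis co_add mn)+
    \<comment> \<open>Two closed unit intervals with distinct integer left ends share at most one
      point, and it is the left end of one of them.\<close>
    have i: "real_of_int i = k \<or> real_of_int j = k" if "i \<noteq> j" "real_of_int i \<le> k" "k \<le> i + 1" "real_of_int j \<le> k" "k \<le> j + 1" for i j k
    proof -
      have "i < j \<or> j < i" using that(1) by arith
      then show ?thesis
      proof
        assume "i < j" then have "i + 1 \<le> j" by simp
        then have "real_of_int i + 1 \<le> real_of_int j" by linarith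
        then show ?thesis using that by linarith
      next
        assume "j < i" then have "j + 1 \<le> i" by simp
        then have "real_of_int j + 1 \<le> real_of_int i" by linarith
        then show ?thesis using that by linarith
      qed
    qed
    show "x \<in> {x. co1 x = m} \<union> {x. co1 x = m'} \<union> {x. co2 x = n} \<union> {x. co2 x = n'}"
      using ne
    proof
      assume "m \<noteq> m'"
      from i[OF this, of "co1 x"] show ?thesis using e yz(3,4) by (auto simp: cell_def)
    next
      assume "n \<noteq> n'"
      from i[OF this, of "co2 x"] show ?thesis using e yz(3,4) by (auto simp: cell_def)
    qed
  qed
  then show ?thesis by (rule negligible_subset[rotated]) (intro negligible_Un negligible_co)
qed

lemma tcell: "compact ((+) v ` cell)" "measure lebesgue ((+) v ` cell) = \<bar>cross a b\<bar>" "(+) v ` cell \<in> lmeasurable"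
proof -
  show "compact ((+) v ` cell)" using cell_measure(1) by (rule compact_translation)
  then show "(+) v ` cell \<in> lmeasurable" by (rule lmeasurable_compact)
  show "measure lebesgue ((+) v ` cell) = \<bar>cross a b\<bar>"
    using measure_isometry_image(1)[OF _ cell_measure(1), of "(+) v"] cell_measure(2) by simp
qed

text \<open>The almost disjoint cells at the points of \<open>S\<close> fit into a disk enlarged by
  the diameter bound of the cell. \<open>S\<close> is an arbitrary finite set because the finiteness
  of the lattice points in a disk is itself drawn from this count.\<close>

lemma lattice_points_upper:
  assumes S: "finite S" "S \<subseteq> lattice_of a b" "S \<subseteq> cball 0 \<rho>" and rho: "\<rho> \<ge> 0"
  shows "card S * \<bar>cross a b\<bar> \<le> pi * (\<rho> + (norm a + norm b))\<^sup>2"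
proof -
  have "card S * \<bar>cross a b\<bar> = (\<Sum>v\<in>S. measure lebesgue ((+) v ` cell))" by (simp only: tcell) simp
  also have "\<dots> = measure lebesgue (\<Union>v\<in>S. (+) v ` cell)"
  proof (rule measure_negligible_finite_Union_image[symmetric, OF S(1) tcell(3)])
    show "pairwise (\<lambda>v w. negligible ((+) v ` cell \<inter> (+) w ` cell)) S"
      by (rule pairwiseI) (rule cells_overlap; use S(2) in blast)
  qed
  also have "\<dots> \<le> measure lebesgue (cball (0::plane) (\<rho> + (norm a + norm b)))"
  proof (intro measure_mono_fmeasurable fmeasurableD fmeasurable.finite_UN)
    show "(\<Union>v\<in>S. (+) v ` cell) \<subseteq> cball 0 (\<rho> + (norm a + norm b))"
    proof
      fix y assume "y \<in> (\<Union>v\<in>S. (+) v ` cell)"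
      then obtain v x where v: "v \<in> S" and x: "x \<in> cell" and y: "y = v + x" by blast
      then have "norm v \<le> \<rho>" using S(3) by auto
      then show "y \<in> cball 0 (\<rho> + (norm a + norm b))"
        using norm_triangle_ineq[of v x] cell_norm[OF x] by (simp add: y)
    qed
  qed (use S tcell in auto)
  also have "\<dots> = pi * (\<rho> + (norm a + norm b))\<^sup>2"
    using rho by (intro measure_cball_plane) simp
  finally show ?thesis .
qed

lemma lattice_points_finite:
  assumes rho: "\<rho> \<ge> 0"
  shows "finite (lattice_of a b \<inter> cball 0 \<rho>)"
proof (rule ccontr)
  assume inf: "infinite (lattice_of a b \<inter> cball 0 \<rho>)"
  define N where "N = nat \<lceil>pi * (\<rho> + (norm a + norm b))\<^sup>2 / \<bar>cross a b\<bar>\<rceil> + 1"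
  obtain S where S: "finite S" "card S = N" "S \<subseteq> lattice_of a b \<inter> cball 0 \<rho>"
    using infinite_arbitrarily_large[OF inf] by blast
  then have "N * \<bar>cross a b\<bar> \<le> pi * (\<rho> + (norm a + norm b))\<^sup>2"
    using lattice_points_upper[of S \<rho>] rho by auto
  then have "N \<le> pi * (\<rho> + (norm a + norm b))\<^sup>2 / \<bar>cross a b\<bar>" using cross_nz by (simp add: field_simps)
  then show False unfolding N_def by linarith
qed

lemma lattice_points_lower:
  assumes rho: "\<rho> \<ge> norm a + norm b"
  shows "pi * (\<rho> - (norm a + norm b))\<^sup>2 \<le> card (lattice_of a b \<inter> cball 0 \<rho>) * \<bar>cross a b\<bar>"
proof -
  have "0 \<le> norm a + norm b" by simp
  then have "0 \<le> \<rho>" using rho by linarith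
  let ?S = "lattice_of a b \<inter> cball 0 \<rho>"
  have fin: "finite ?S" using \<open>0 \<le> \<rho>\<close> by (rule lattice_points_finite)
  have "pi * (\<rho> - (norm a + norm b))\<^sup>2 = measure lebesgue (cball (0::plane) (\<rho> - (norm a + norm b)))"
    using rho by (intro measure_cball_plane[symmetric]) simp
  also have "\<dots> \<le> measure lebesgue (\<Union>v\<in>?S. (+) v ` cell)"
  proof (intro measure_mono_fmeasurable fmeasurable.finite_UN)
    show "cball 0 (\<rho> - (norm a + norm b)) \<subseteq> (\<Union>v\<in>?S. (+) v ` cell)"
    proof
      fix x :: plane assume x: "x \<in> cball 0 (\<rho> - (norm a + norm b))"
      obtain v where v: "v \<in> lattice_of a b" "x - v \<in> cell" using cell_cover by blast
      have "norm v \<le> norm x + norm (x - v)" using norm_triangle_sub[of v x] by (simp add: norm_minus_commute)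
      then have "v \<in> ?S" using v x cell_norm[OF v(2)] by simp
      moreover have "x \<in> (+) v ` cell" using v(2) by (intro image_eqI[of _ _ "x - v"]) simp_all
      ultimately show "x \<in> (\<Union>v\<in>?S. (+) v ` cell)" by blast
    qed
  qed (use fin tcell in auto)
  also have "\<dots> \<le> (\<Sum>v\<in>?S. measure lebesgue ((+) v ` cell))"
    using fin tcell by (intro measure_UNION_le) (auto simp: fmeasurableD)
  also have "\<dots> = card ?S * \<bar>cross a b\<bar>" by (simp only: tcell) simp
  finally show ?thesis .
qed

definition family :: "plane set \<Rightarrow> plane set set" where "family K = (\<lambda>v. (+) v ` K) ` lattice_of a b"

text \<open>A family is a set, so distinct lattice vectors must be seen to give distinct members. A
  compact set cannot coincide with a proper translate: consider its farthest point in the direction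
  of the shift.\<close>

lemma translate_inj:
  fixes v w :: plane
  assumes "compact K" "K \<noteq> {}" "(+) v ` K = (+) w ` K"
  shows "v = w"
proof (rule ccontr)
  assume "v \<noteq> w"
  define u where "u = v - w"
  have u: "u \<bullet> u > 0" using \<open>v \<noteq> w\<close> by (simp add: u_def)
  have cont: "continuous_on K (\<lambda>x. x \<bullet> u)" by (intro continuous_intros)
  from continuous_attains_sup[OF assms(1,2) cont] obtain x0 where x0: "x0 \<in> K" "\<And>y. y \<in> K \<Longrightarrow> y \<bullet> u \<le> x0 \<bullet> u"
    by blast
  have "v + x0 \<in> (+) w ` K" using assms(3) x0(1) by blast
  then obtain y where "y \<in> K" "v + x0 = w + y" by blast
  then have "y = x0 + u" "y \<in> K" by (auto simp: u_def algebra_simps)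
  then show False using x0(2)[of y] u by (simp add: inner_add_left)
qed

text \<open>Upper and lower lattice point counts differ by boundary layers only, so the density is
  area over covolume. Coverings use the first inequality, packings the second.\<close>

lemma family_density:
  assumes K: "compact K" "K \<noteq> {}"
  shows "lower_density (family K) \<le> ennreal (measure lebesgue K / \<bar>cross a b\<bar>)"
    "ennreal (measure lebesgue K / \<bar>cross a b\<bar>) \<le> upper_density (family K)"
proof -
  obtain M0 where M0: "K \<subseteq> cball 0 M0"
    using bounded_subset_ballD[OF compact_imp_bounded[OF K(1)]] ball_subset_cball by blast
  define M where "M = max M0 0"
  have M: "K \<subseteq> cball 0 M" "M \<ge> 0" using M0 by (auto simp: M_def)
  let ?A = "measure lebesgue K"
  have tr: "compact ((+) v ` K)" "measure lebesgue ((+) v ` K) = ?A" for v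
    using measure_isometry_image[OF _ K(1), of "(+) v"] by simp_all
  have "density_in_disk (family K) \<rho> \<le> ennreal (?A * (pi * (\<rho> + (M + (norm a + norm b)))\<^sup>2 / \<bar>cross a b\<bar>) / (pi * \<rho>\<^sup>2))"
    if rho: "\<rho> > 0" for \<rho>
  proof (rule density_le[OF _ rho])
    fix F' assume F': "finite F'" "F' \<subseteq> family K"
    let ?G = "{C \<in> F'. C \<inter> cball 0 \<rho> \<noteq> {}}"
    let ?S = "lattice_of a b \<inter> cball 0 (\<rho> + M)"
    have fin: "finite ?S" using rho M by (intro lattice_points_finite) simp
    have "?G \<subseteq> (\<lambda>v. (+) v ` K) ` ?S"
    proof
      fix C assume C: "C \<in> ?G"
      then have "C \<in> family K" "C \<inter> cball 0 \<rho> \<noteq> {}" using F' by blast+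
      from this(1) obtain v where v: "C = (+) v ` K" "v \<in> lattice_of a b" unfolding family_def by (rule imageE)
      obtain y where y: "y \<in> C" "y \<in> cball 0 \<rho>" using \<open>C \<inter> cball 0 \<rho> \<noteq> {}\<close> by blast
      from y(1) obtain x where "y = v + x" and xK: "x \<in> K" unfolding v(1) by (rule imageE)
      then have x: "x \<in> K" "norm (v + x) \<le> \<rho>" using y by simp_all
      have "norm x \<le> M" using x M by auto
      then have "norm v \<le> \<rho> + M" using norm_triangle_sub[of v "- x"] x(2) by simp
      then show "C \<in> (\<lambda>v. (+) v ` K) ` ?S" using v by auto
    qed
    then have "card ?G \<le> card ?S" using fin by (meson card_image_le card_mono finite_imageI le_trans)
    then have "real (card ?G) * \<bar>cross a b\<bar> \<le> card ?S * \<bar>cross a b\<bar>" by (intro mult_right_mono) auto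
    also have "\<dots> \<le> pi * (\<rho> + M + (norm a + norm b))\<^sup>2"
      using rho M fin by (intro lattice_points_upper) auto
    finally have "real (card ?G) \<le> pi * (\<rho> + (M + (norm a + norm b)))\<^sup>2 / \<bar>cross a b\<bar>"
      using cross_nz by (simp add: field_simps add.assoc)
    then have "card ?G * ?A \<le> ?A * (pi * (\<rho> + (M + (norm a + norm b)))\<^sup>2 / \<bar>cross a b\<bar>)"
      by (subst mult.commute) (intro mult_left_mono; simp)
    then show "(\<Sum>C\<in>F'. emeasure lborel (C \<inter> cball 0 \<rho>)) \<le> ennreal (?A * (pi * (\<rho> + (M + (norm a + norm b)))\<^sup>2 / \<bar>cross a b\<bar>))"
      using F' tr by (intro sum_measure_in_disk_le[where A = ?A]) (auto simp: family_def)
  qed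
  then have "upper_density (family K) \<le> ennreal (?A / \<bar>cross a b\<bar>)"
    by (intro upper_density_le[where k = "M + (norm a + norm b)"] eventually_mono[OF eventually_gt_at_top[of 0]]) auto
  then show "lower_density (family K) \<le> ennreal (?A / \<bar>cross a b\<bar>)" using lower_le_upper_density by (rule order_trans[rotated])
  have "ennreal (?A * (pi * (\<rho> + (- M - (norm a + norm b)))\<^sup>2 / \<bar>cross a b\<bar>) / (pi * \<rho>\<^sup>2)) \<le> density_in_disk (family K) \<rho>"
    if rho: "\<rho> > M + (norm a + norm b)" for \<rho>
  proof -
    let ?S = "lattice_of a b \<inter> cball 0 (\<rho> - M)"
    have r0: "0 \<le> norm a + norm b" by simp
    have fin: "finite ?S" using rho r0 by (intro lattice_points_finite) linarith
    let ?F = "(\<lambda>v. (+) v ` K) ` ?S"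
    have card: "card ?F = card ?S" using translate_inj[OF K] by (intro card_image inj_onI) blast
    have "pi * (\<rho> - M - (norm a + norm b))\<^sup>2 \<le> card ?S * \<bar>cross a b\<bar>"
      using rho by (intro lattice_points_lower) simp
    then have "pi * (\<rho> + (- M - (norm a + norm b)))\<^sup>2 / \<bar>cross a b\<bar> \<le> card ?S"
      using cross_nz by (simp add: field_simps)
    then have le: "?A * (pi * (\<rho> + (- M - (norm a + norm b)))\<^sup>2 / \<bar>cross a b\<bar>) \<le> card ?F * ?A"
      unfolding card by (subst mult.commute) (intro mult_right_mono; simp)
    show ?thesis
    proof (rule density_ge[where F' = ?F and A = ?A])
      show "finite ?F" using fin by simp
      show "?F \<subseteq> family K" by (auto simp: family_def)
      show "C \<subseteq> cball 0 \<rho> \<and> emeasure lborel C = ennreal ?A" if C: "C \<in> ?F" for C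
      proof -
        obtain v where v: "norm v \<le> \<rho> - M" "C = (+) v ` K" using C by auto
        have "v + x \<in> cball 0 \<rho>" if "x \<in> K" for x
        proof -
          have "norm x \<le> M" using that M by auto
          then show ?thesis using norm_triangle_ineq[of v x] v(1) by simp
        qed
        then show ?thesis using v(2) tr emeasure_lborel_compact by auto
      qed
      show "\<rho> > 0" using rho r0 M(2) by linarith
    qed (use le in simp_all)
  qed
  then have "ennreal (?A / \<bar>cross a b\<bar>) \<le> lower_density (family K)"
    by (intro lower_density_ge[where k = "- M - (norm a + norm b)"] eventually_mono[OF eventually_gt_at_top[of "M + (norm a + norm b)"]]) auto
  then show "ennreal (?A / \<bar>cross a b\<bar>) \<le> upper_density (family K)" using lower_le_upper_density by (rule order_trans)
qed

lemma family_lattice: "family K \<in> lattice_families K"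
  using is_lattice_of[OF cross_nz] by (auto simp: family_def lattice_families_def)

end

lemma families_subset: "lattice_families K \<subseteq> translative_families K" "translative_families K \<subseteq> congruent_families K"
proof -
  show "lattice_families K \<subseteq> translative_families K"
    by (auto simp: lattice_families_def translative_families_def translate_of_def)
  have "translate_of K C \<Longrightarrow> congruent_to K C" for C
    unfolding translate_of_def congruent_to_def by (metis dist_add_cancel)
  then show "translative_families K \<subseteq> congruent_families K"
    by (auto simp: translative_families_def congruent_families_def)
qed

text \<open>The upper bound holds in the largest class, all congruent copies, and is attained in the
  smallest, the lattice families; hence the three suprema coincide.\<close>

theorem packing_densities:
  assumes K: "compact K" "cball c r \<subseteq> K" and r: "r > 0"
    and cr: "cross a b = 2 * sqrt 3 * r\<^sup>2" and pack: "is_packing ((\<lambda>v. (+) v ` K) ` lattice_of a b)"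
  shows "packing_density K = measure lebesgue K / (2 * sqrt 3 * r\<^sup>2)"
    "packing_density_T K = measure lebesgue K / (2 * sqrt 3 * r\<^sup>2)"
    "packing_density_L K = measure lebesgue K / (2 * sqrt 3 * r\<^sup>2)"
proof -
  interpret plane_lattice a b by unfold_locales (use cr r in simp)
  let ?d = "measure lebesgue K / (2 * sqrt 3 * r\<^sup>2)"
  have abs: "\<bar>cross a b\<bar> = 2 * sqrt 3 * r\<^sup>2" by (simp add: cr)
  have ne: "K \<noteq> {}" using K(2) r by auto
  have *: "max_packing_density \<A> = ?d" if "lattice_families K \<subseteq> \<A>" "\<A> \<subseteq> congruent_families K" for \<A>
  proof -
    have "(SUP F\<in>{F \<in> \<A>. is_packing F}. upper_density F) = ennreal ?d"
    proof (rule antisym)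
      show "(SUP F\<in>{F \<in> \<A>. is_packing F}. upper_density F) \<le> ennreal ?d"
        using that packing_upper_density_le[OF _ _ K r] by (intro SUP_least) auto
      have "family K \<in> {F \<in> \<A>. is_packing F}" using family_lattice that pack by (auto simp: family_def)
      then show "ennreal ?d \<le> (SUP F\<in>{F \<in> \<A>. is_packing F}. upper_density F)"
        using family_density(2)[OF K(1) ne] unfolding abs by (rule SUP_upper2)
    qed
    then show ?thesis by (simp add: max_packing_density_def)
  qed
  note fs = families_subset[of K]
  show "packing_density K = ?d" "packing_density_T K = ?d" "packing_density_L K = ?d"
    unfolding packing_density_def packing_density_T_def packing_density_L_def
    using fs by (intro *; blast)+
qed

theorem covering_densities:
  assumes K: "compact K" "K \<noteq> {}" "K \<subseteq> cball c R" and R: "R > 0"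
    and cr: "cross a b = 3 * sqrt 3 / 2 * R\<^sup>2" and cov: "is_covering ((\<lambda>v. (+) v ` K) ` lattice_of a b)"
  shows "covering_density K = measure lebesgue K / (3 * sqrt 3 / 2 * R\<^sup>2)"
    "covering_density_T K = measure lebesgue K / (3 * sqrt 3 / 2 * R\<^sup>2)"
    "covering_density_L K = measure lebesgue K / (3 * sqrt 3 / 2 * R\<^sup>2)"
proof -
  have "0 < cross a b" unfolding cr using R by simp
  then interpret plane_lattice a b by unfold_locales simp
  let ?d = "measure lebesgue K / (3 * sqrt 3 / 2 * R\<^sup>2)"
  have abs: "\<bar>cross a b\<bar> = 3 * sqrt 3 / 2 * R\<^sup>2" by (simp add: cr)
  have *: "min_covering_density \<A> = ?d" if "lattice_families K \<subseteq> \<A>" "\<A> \<subseteq> congruent_families K" for \<A>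
  proof -
    have "(INF F\<in>{F \<in> \<A>. is_covering F}. lower_density F) = ennreal ?d"
    proof (rule antisym)
      show "ennreal ?d \<le> (INF F\<in>{F \<in> \<A>. is_covering F}. lower_density F)"
        using that covering_lower_density_ge[OF _ _ K(1,3) R] by (intro INF_greatest) auto
      have "family K \<in> {F \<in> \<A>. is_covering F}" using family_lattice that cov by (auto simp: family_def)
      then show "(INF F\<in>{F \<in> \<A>. is_covering F}. lower_density F) \<le> ennreal ?d"
        using family_density(1)[OF K(1,2)] unfolding abs by (rule INF_lower2)
    qed
    then show ?thesis by (simp add: min_covering_density_def)
  qed
  note fs = families_subset[of K]
  show "covering_density K = ?d" "covering_density_T K = ?d" "covering_density_L K = ?d"
    unfolding covering_density_def covering_density_T_def covering_density_L_def
    using fs by (intro *; blast)+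
qed

section \<open>Regular hexagons\<close>

definition ray :: "real \<Rightarrow> nat \<Rightarrow> plane" where
  "ray \<theta> k = (cos (\<theta> + real k * pi / 3), sin (\<theta> + real k * pi / 3))"

text \<open>A regular hexagon of inradius \<open>h\<close> as an intersection of half-planes, while
  \<open>hexagon\<close> is given by its vertices. The angle \<open>\<theta>\<close> points to the
  middle of a side here and to a vertex there, hence the shift by \<open>pi / 6\<close> between the
  two.\<close>

definition hexcut :: "plane \<Rightarrow> real \<Rightarrow> real \<Rightarrow> plane set" where
  "hexcut c \<theta> h = {x. \<forall>k<6. (x - c) \<bullet> ray \<theta> k \<le> h}"

definition hexagon :: "plane \<Rightarrow> real \<Rightarrow> real \<Rightarrow> plane set" where
  "hexagon c \<theta> s = convex hull ((\<lambda>k. c + s *\<^sub>R ray \<theta> k) ` {..<6})"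

lemma cos_le_cos_abs:
  assumes "0 \<le> a" "a \<le> \<bar>y\<bar>" "\<bar>y\<bar> \<le> 2 * pi - a"
  shows "cos y \<le> cos a"
proof (cases "\<bar>y\<bar> \<le> pi")
  case True
  then have "cos \<bar>y\<bar> \<le> cos a" using assms by (intro cos_monotone_0_pi_le) auto
  then show ?thesis by simp
next
  case False
  then have "cos (2 * pi - \<bar>y\<bar>) \<le> cos a" using assms by (intro cos_monotone_0_pi_le) auto
  then show ?thesis by (simp add: cos_diff)
qed

lemma ray_inner: "ray \<theta> j \<bullet> ray \<omega> k = cos ((\<theta> + real j * pi / 3) - (\<omega> + real k * pi / 3))"
  by (simp add: ray_def cos_diff)

lemma ray_self [simp]: "ray \<theta> k \<bullet> ray \<theta> k = 1"
  by (simp add: ray_inner)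

lemma norm_ray [simp]: "norm (ray \<theta> k) = 1"
  by (simp add: ray_def norm_Pair)

lemma ray_offset: "ray (\<theta> + \<psi>) k = cos \<psi> *\<^sub>R ray \<theta> k + sin \<psi> *\<^sub>R perp (ray \<theta> k)"
proof -
  have "\<theta> + \<psi> + real k * pi / 3 = (\<theta> + real k * pi / 3) + \<psi>" by simp
  then show ?thesis by (simp only: ray_def perp_def cos_add sin_add) (simp add: algebra_simps)
qed

lemma ray_opposite: "ray \<theta> (k + 3) = - ray \<theta> k"
proof -
  have "\<theta> + real (k + 3) * pi / 3 = (\<theta> + real k * pi / 3) + pi" by (simp add: field_simps)
  then show ?thesis by (simp only: ray_def) simp
qed

lemma ray_period: "ray \<theta> (k + 6) = ray \<theta> k"
  using ray_opposite[of \<theta> "k + 3"] ray_opposite[of \<theta> k] by (simp add: add.assoc)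

lemma ray_mod: "ray \<theta> (k mod 6) = ray \<theta> k"
proof (induction k rule: less_induct)
  case (less k)
  show ?case
  proof (cases "k < 6")
    case False
    then obtain j where "k = j + 6" using le_Suc_ex[of 6 k] by (auto simp: add.commute)
    then show ?thesis using less[of j] ray_period[of \<theta> j] by simp
  qed simp
qed

text \<open>Distinct directions differ by at least \<open>pi / 3\<close>, also around the full
  turn.\<close>

lemma ray_inner_le:
  assumes "j < 6" "k < 6" "j \<noteq> k"
  shows "ray \<theta> j \<bullet> ray \<theta> k \<le> 1 / 2"
proof -
  have "1 \<le> \<bar>int j - int k\<bar>" "\<bar>int j - int k\<bar> \<le> 5" using assms by auto
  then have d: "1 \<le> \<bar>real j - real k\<bar>" "\<bar>real j - real k\<bar> \<le> 5" by linarith+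
  have "cos ((real j - real k) * (pi / 3)) \<le> cos (pi / 3)"
  proof (rule cos_le_cos_abs)
    show "pi / 3 \<le> \<bar>(real j - real k) * (pi / 3)\<bar>" using d(1) by (simp add: abs_mult)
    have "\<bar>real j - real k\<bar> * (pi / 3) \<le> 5 * (pi / 3)" using d(2) by (intro mult_right_mono) auto
    then show "\<bar>(real j - real k) * (pi / 3)\<bar> \<le> 2 * pi - pi / 3" by (simp add: abs_mult)
  qed simp
  moreover have "\<theta> + real j * pi / 3 - (\<theta> + real k * pi / 3) = (real j - real k) * (pi / 3)" by (simp add: field_simps)
  ultimately show ?thesis by (simp only: ray_inner cos_60)
qed

text \<open>For \<open>\<bar>\<omega>\<bar> \<le> pi / 6\<close> the vertex with index
  \<open>k\<close> is the one nearest to the given direction, so \<open>cos \<omega>\<close> is the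
  support function of the unit hexagon there.\<close>

lemma ray_inner_normal:
  assumes "j < 6" "k < 6" "\<bar>\<omega>\<bar> \<le> pi / 6"
  shows "ray \<theta> j \<bullet> ray (\<theta> + \<omega>) k \<le> cos \<omega>"
proof -
  let ?m = "real j - real k"
  have eq: "ray \<theta> j \<bullet> ray (\<theta> + \<omega>) k = cos (?m * (pi / 3) - \<omega>)"
  proof -
    have "\<theta> + real j * pi / 3 - (\<theta> + \<omega> + real k * pi / 3) = ?m * (pi / 3) - \<omega>" by (simp add: field_simps)
    then show ?thesis by (simp only: ray_inner)
  qed
  have "cos (?m * (pi / 3) - \<omega>) \<le> cos \<bar>\<omega>\<bar>"
  proof (cases "j = k")
    case True then show ?thesis by simp
  next
    case False
    then have "1 \<le> \<bar>int j - int k\<bar>" "\<bar>int j - int k\<bar> \<le> 5" using assms by auto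
    then have d: "1 \<le> \<bar>?m\<bar>" "\<bar>?m\<bar> \<le> 5" by linarith+
    have "\<bar>?m * (pi / 3)\<bar> \<le> 5 * (pi / 3)" using d(2) by (subst abs_mult) (intro mult_mono; simp)
    moreover have "1 * (pi / 3) \<le> \<bar>?m * (pi / 3)\<bar>" using d(1) by (subst abs_mult) (intro mult_mono; simp)
    ultimately show ?thesis using assms(3) by (intro cos_le_cos_abs) linarith+
  qed
  then show ?thesis by (simp add: eq)
qed

text \<open>Polar coordinates, with the angle rounded to the nearest of the six directions.\<close>

lemma sector_decomposition:
  obtains k \<psi> where "k < 6" "\<bar>\<psi>\<bar> \<le> pi / 6" "x = norm x *\<^sub>R ray (\<theta> + \<psi>) k"
proof -
  obtain \<phi> where phi: "x = norm x *\<^sub>R (cos \<phi>, sin \<phi>)"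
  proof (cases "x = 0")
    case False
    have "(fst x / norm x)\<^sup>2 + (snd x / norm x)\<^sup>2 = 1"
      using False by (cases x) (simp add: norm_Pair power_divide add_divide_distrib[symmetric] zero_prod_def sum_power2_eq_zero_iff)
    then obtain \<phi> where "fst x / norm x = cos \<phi>" "snd x / norm x = sin \<phi>" using sincos_total_2pi_le by metis
    then have "x = norm x *\<^sub>R (cos \<phi>, sin \<phi>)" using False by (cases x) (auto simp: field_simps)
    then show ?thesis by (rule that)
  qed (rule that[of 0], simp add: zero_prod_def)
  define m where "m = round ((\<phi> - \<theta>) / (pi / 3))"
  define \<psi> where "\<psi> = \<phi> - \<theta> - of_int m * (pi / 3)"
  have psi: "\<bar>\<psi>\<bar> \<le> pi / 6"
  proof -
    define q where "q = (\<phi> - \<theta>) / (pi / 3)"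
    have "\<bar>of_int m - q\<bar> \<le> 1 / 2" unfolding m_def q_def by (rule of_int_round_abs_le)
    then have "\<bar>q - of_int m\<bar> \<le> 1 / 2" by linarith
    then have "\<bar>q - of_int m\<bar> * (pi / 3) \<le> 1 / 2 * (pi / 3)" by (intro mult_right_mono) auto
    moreover have "\<psi> = (q - of_int m) * (pi / 3)" by (simp add: \<psi>_def q_def field_simps)
    then have "\<bar>\<psi>\<bar> = \<bar>q - of_int m\<bar> * \<bar>pi / 3\<bar>" by (simp only: abs_mult)
    moreover have "\<bar>pi / 3\<bar> = pi / 3" by simp
    ultimately have "\<bar>\<psi>\<bar> \<le> 1 / 2 * (pi / 3)" by (simp only:)
    then show ?thesis by simp
  qed
  define k where "k = nat (m mod 6)"
  have k: "k < 6" by (simp add: k_def nat_less_iff)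
  have "of_int m = real k + 6 * of_int (m div 6)"
  proof -
    have "m = int k + 6 * (m div 6)" by (simp add: k_def)
    then show ?thesis by (metis of_int_add of_int_mult of_int_numeral of_int_of_nat_eq)
  qed
  then have "\<phi> = (\<theta> + \<psi> + real k * pi / 3) + 2 * pi * of_int (m div 6)"
    by (simp add: \<psi>_def algebra_simps)
  then have "cos \<phi> = cos (\<theta> + \<psi> + real k * pi / 3)" "sin \<phi> = sin (\<theta> + \<psi> + real k * pi / 3)"
    by (metis cos.plus_of_int cos_add cos_int_2pin mult.right_neutral diff_zero mult_zero_right sin_int_2pin,
        metis sin_add cos_int_2pin mult.right_neutral add_0_right mult_zero_right sin_int_2pin)
  then show ?thesis using that[OF k psi] phi by (simp add: ray_def)
qed

lemma hexcut_iff: "x \<in> hexcut c \<theta> h \<longleftrightarrow> (\<forall>k<6. ray \<theta> k \<bullet> x \<le> h + ray \<theta> k \<bullet> c)"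
proof -
  have "(x - c) \<bullet> r \<le> h \<longleftrightarrow> r \<bullet> x \<le> h + r \<bullet> c" for r
    by (simp add: inner_diff_left inner_commute[of r] algebra_simps)
  then show ?thesis by (simp add: hexcut_def)
qed

lemma closed_hexcut: "closed (hexcut c \<theta> h)" and convex_hexcut: "convex (hexcut c \<theta> h)"
proof -
  have eq: "hexcut c \<theta> h = (\<Inter>k<6. {x. ray \<theta> k \<bullet> x \<le> h + ray \<theta> k \<bullet> c})"
    by (auto simp only: hexcut_iff lessThan_iff INT_iff mem_Collect_eq)
  show "closed (hexcut c \<theta> h)" unfolding eq by (intro closed_INT ballI closed_halfspace_le)
  show "convex (hexcut c \<theta> h)" unfolding eq by (intro convex_INT convex_halfspace_le)
qed

lemma hexagon_subset_hexcut:
  assumes "s \<ge> 0" shows "hexagon c \<theta> s \<subseteq> hexcut c (\<theta> + pi / 6) (s * sqrt 3 / 2)"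
proof -
  have "convex (hexcut c (\<theta> + pi / 6) (s * sqrt 3 / 2))" by (rule convex_hexcut)
  moreover have "c + s *\<^sub>R ray \<theta> j \<in> hexcut c (\<theta> + pi / 6) (s * sqrt 3 / 2)" if "j < 6" for j
    using assms ray_inner_normal[OF that, of _ "pi / 6" \<theta>] mult_left_mono[of _ "sqrt 3 / 2" s]
    by (auto simp: hexcut_def cos_30)
  ultimately show ?thesis unfolding hexagon_def by (intro hull_minimal) auto
qed

lemma hexagon_center: "s \<ge> 0 \<Longrightarrow> c \<in> hexagon c \<theta> s"
proof -
  assume "s \<ge> 0"
  have "c + s *\<^sub>R ray \<theta> 0 \<in> hexagon c \<theta> s" "c + s *\<^sub>R ray \<theta> 3 \<in> hexagon c \<theta> s"
    unfolding hexagon_def by (rule hull_inc, rule imageI, simp)+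
  then have "(1/2) *\<^sub>R (c + s *\<^sub>R ray \<theta> 0) + (1/2) *\<^sub>R (c + s *\<^sub>R ray \<theta> 3) \<in> hexagon c \<theta> s"
    unfolding hexagon_def by (intro convexD[OF convex_convex_hull]) auto
  moreover have "(1/2) *\<^sub>R (c + s *\<^sub>R ray \<theta> 0) + (1/2) *\<^sub>R (c + s *\<^sub>R ray \<theta> 3) = c"
    using ray_opposite[of \<theta> 0] by (simp add: algebra_simps scaleR_add_left[symmetric])
  ultimately show ?thesis by simp
qed

text \<open>In the sector of the \<open>k\<close>-th side, \<open>\<alpha>\<close> and
  \<open>\<beta>\<close> are the coordinates of \<open>x - c\<close> along the two vertices of that
  side. The angle bound on \<open>\<psi>\<close> makes them nonnegative, and the half-plane of the
  side says \<open>\<alpha> + \<beta> \<le> s\<close>, which puts \<open>x\<close> into a triangle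
  with apex \<open>c\<close>.\<close>

lemma hexcut_subset_hexagon:
  assumes s: "s > 0" shows "hexcut c (\<theta> + pi / 6) (s * sqrt 3 / 2) \<subseteq> hexagon c \<theta> s"
proof
  fix x assume x: "x \<in> hexcut c (\<theta> + pi / 6) (s * sqrt 3 / 2)"
  obtain k \<psi> where k: "k < 6" "\<bar>\<psi>\<bar> \<le> pi / 6" "x - c = norm (x - c) *\<^sub>R ray ((\<theta> + pi / 6) + \<psi>) k"
    by (rule sector_decomposition)
  define t where "t = norm (x - c)"
  have t: "t \<ge> 0" by (simp add: t_def)
  define \<alpha> \<beta> where "\<alpha> = t * (cos \<psi> / sqrt 3 - sin \<psi>)" and "\<beta> = t * (cos \<psi> / sqrt 3 + sin \<psi>)"
  have cs: "\<bar>sin \<psi>\<bar> \<le> cos \<psi> / sqrt 3"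
  proof -
    have "sin \<bar>\<psi>\<bar> \<le> sin (pi / 6)" using k(2) by (intro sin_monotone_2pi_le) auto
    moreover have "cos (pi / 6) \<le> cos \<bar>\<psi>\<bar>" using k(2) by (intro cos_monotone_0_pi_le) auto
    moreover have "\<bar>sin \<psi>\<bar> = sin \<bar>\<psi>\<bar>"
    proof -
      have "0 \<le> sin \<bar>\<psi>\<bar>" using k(2) pi_gt_zero by (intro sin_ge_zero) linarith+
      then show ?thesis by (cases "\<psi> \<ge> 0") auto
    qed
    ultimately have "\<bar>sin \<psi>\<bar> \<le> 1 / 2" "sqrt 3 / 2 \<le> cos \<psi>" by (simp_all add: sin_30 cos_30)
    moreover have "(1/2) * sqrt 3 \<le> cos \<psi> \<Longrightarrow> 1/2 \<le> cos \<psi> / sqrt 3" by (simp add: field_simps)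
    ultimately show ?thesis by linarith
  qed
  have ab: "\<alpha> \<ge> 0" "\<beta> \<ge> 0" unfolding \<alpha>_def \<beta>_def using cs t by (auto intro!: mult_nonneg_nonneg)
  let ?n = "ray (\<theta> + pi / 6) k"
  have v0: "ray \<theta> k = (sqrt 3 / 2) *\<^sub>R ?n - (1/2) *\<^sub>R perp ?n"
    using ray_offset[of "\<theta> + pi / 6" "- (pi / 6)" k] by (simp add: cos_30 sin_30)
  have v1: "ray \<theta> (Suc k) = (sqrt 3 / 2) *\<^sub>R ?n + (1/2) *\<^sub>R perp ?n"
  proof -
    have "ray \<theta> (Suc k) = ray ((\<theta> + pi / 6) + pi / 6) k" by (simp add: ray_def algebra_simps add_divide_distrib)
    also have "\<dots> = cos (pi / 6) *\<^sub>R ?n + sin (pi / 6) *\<^sub>R perp ?n" by (rule ray_offset)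
    finally show ?thesis by (simp add: cos_30 sin_30)
  qed
  have "x - c = t *\<^sub>R (cos \<psi> *\<^sub>R ?n + sin \<psi> *\<^sub>R perp ?n)"
    using k(3) by (simp add: ray_offset t_def)
  also have "\<dots> = ((\<alpha> + \<beta>) * (sqrt 3 / 2)) *\<^sub>R ?n + ((\<beta> - \<alpha>) / 2) *\<^sub>R perp ?n"
    by (simp add: \<alpha>_def \<beta>_def algebra_simps)
  finally have xe: "x - c = ((\<alpha> + \<beta>) * (sqrt 3 / 2)) *\<^sub>R ?n + ((\<beta> - \<alpha>) / 2) *\<^sub>R perp ?n" .
  have "perp ?n \<bullet> ?n = 0" by (cases ?n) (simp add: perp_def)
  moreover have "?n \<bullet> ?n = 1" using norm_ray[of "\<theta> + pi/6" k] by (simp add: norm_eq_1)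
  ultimately have "(x - c) \<bullet> ?n = (\<alpha> + \<beta>) * (sqrt 3 / 2)" unfolding xe by (simp add: inner_add_left)
  moreover have "(x - c) \<bullet> ?n \<le> s * sqrt 3 / 2" using x k(1) by (simp add: hexcut_def)
  ultimately have abs: "\<alpha> + \<beta> \<le> s" by simp
  have "c + s *\<^sub>R ray \<theta> k \<in> hexagon c \<theta> s" "c + s *\<^sub>R ray \<theta> (Suc k mod 6) \<in> hexagon c \<theta> s"
    unfolding hexagon_def using k(1) by (auto intro!: hull_inc)
  then have "convex hull {c, c + s *\<^sub>R ray \<theta> k, c + s *\<^sub>R ray \<theta> (Suc k)} \<subseteq> hexagon c \<theta> s"
    using hexagon_center[of s c \<theta>] s by (intro hull_minimal) (auto simp: ray_mod hexagon_def)
  moreover have "x \<in> convex hull {c, c + s *\<^sub>R ray \<theta> k, c + s *\<^sub>R ray \<theta> (Suc k)}"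
    unfolding convex_hull_3 mem_Collect_eq
  proof (intro exI conjI)
    have "x - c = \<alpha> *\<^sub>R ray \<theta> k + \<beta> *\<^sub>R ray \<theta> (Suc k)"
      unfolding xe v0 v1 by (simp add: algebra_simps add_divide_distrib diff_divide_distrib)
    then have "x = c + (\<alpha> *\<^sub>R ray \<theta> k + \<beta> *\<^sub>R ray \<theta> (Suc k))" by (simp add: algebra_simps)
    also have "\<dots> = (1 - \<alpha> / s - \<beta> / s) *\<^sub>R c + (\<alpha> / s) *\<^sub>R (c + s *\<^sub>R ray \<theta> k) + (\<beta> / s) *\<^sub>R (c + s *\<^sub>R ray \<theta> (Suc k))"
      using s by (simp add: algebra_simps)
    finally show "x = (1 - \<alpha> / s - \<beta> / s) *\<^sub>R c + (\<alpha> / s) *\<^sub>R (c + s *\<^sub>R ray \<theta> k) + (\<beta> / s) *\<^sub>R (c + s *\<^sub>R ray \<theta> (Suc k))" .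
    have "(\<alpha> + \<beta>) / s \<le> 1" using abs s by (simp add: divide_le_eq)
    then show "0 \<le> 1 - \<alpha> / s - \<beta> / s" by (simp add: add_divide_distrib)
  qed (use ab s in auto)
  ultimately show "x \<in> hexagon c \<theta> s" by blast
qed

lemma hexagon_eq_hexcut: "s > 0 \<Longrightarrow> hexagon c \<theta> s = hexcut c (\<theta> + pi / 6) (s * sqrt 3 / 2)"
  using hexagon_subset_hexcut hexcut_subset_hexagon by (simp add: subset_antisym)

lemma cball_subset_hexcut: "h \<ge> 0 \<Longrightarrow> r \<le> h \<Longrightarrow> cball c r \<subseteq> hexcut c \<theta> h"
proof
  fix x assume "r \<le> h" "x \<in> cball c r"
  then have "norm (x - c) \<le> h" by (simp add: dist_norm norm_minus_commute)
  moreover have "(x - c) \<bullet> ray \<theta> k \<le> norm (x - c)" for k using norm_cauchy_schwarz[of "x - c" "ray \<theta> k"] by simp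
  ultimately show "x \<in> hexcut c \<theta> h" unfolding hexcut_def by (auto intro: order_trans)
qed

lemma hexagon_subset_cball: "s \<ge> 0 \<Longrightarrow> hexagon c \<theta> s \<subseteq> cball c s"
  unfolding hexagon_def by (intro hull_minimal) (auto simp: dist_norm)

lemma hexcut_mono: "h \<le> h' \<Longrightarrow> hexcut c \<theta> h \<subseteq> hexcut c \<theta> h'"
  by (auto simp: hexcut_def intro: order_trans)

section \<open>The hexagonal lattice and its tiling\<close>

abbreviation hexlat :: "real \<Rightarrow> real \<Rightarrow> plane set" where
  "hexlat \<theta> r \<equiv> lattice_of ((2 * r) *\<^sub>R ray \<theta> 0) ((2 * r) *\<^sub>R ray \<theta> 1)"

text \<open>The covolume is the area of a regular hexagon of inradius \<open>r\<close>, as it must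
  be for a tile.\<close>

lemma cross_hexlat: "cross ((2 * r) *\<^sub>R ray \<theta> 0) ((2 * r) *\<^sub>R ray \<theta> 1) = 2 * sqrt 3 * r\<^sup>2"
proof -
  have "cross (ray \<theta> 0) (ray \<theta> 1) = sin ((\<theta> + pi / 3) - \<theta>)"
    unfolding sin_diff by (simp add: cross_def ray_def algebra_simps)
  then have "cross (ray \<theta> 0) (ray \<theta> 1) = sqrt 3 / 2" by (simp add: sin_60)
  moreover have "cross ((2 * r) *\<^sub>R x) ((2 * r) *\<^sub>R y) = 4 * r\<^sup>2 * cross x y" for x y
    by (simp add: cross_def power2_eq_square algebra_simps)
  ultimately show ?thesis by simp
qed

lemma ray_2: "ray \<theta> 2 = ray \<theta> 1 - ray \<theta> 0"
proof -
  have c: "cos (pi / 3) = 1 / 2" "sin (pi / 3) = sqrt 3 / 2" by (simp_all add: cos_60 sin_60)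
  have c2: "cos (2 * pi / 3) = - 1 / 2" "sin (2 * pi / 3) = sqrt 3 / 2" using cos_120 sin_120 by (simp_all add: mult.commute)
  have "ray \<theta> 2 = ray (\<theta> + 2 * pi / 3) 0" "ray \<theta> 1 = ray (\<theta> + pi / 3) 0" by (simp_all add: ray_def)
  then show ?thesis by (simp only: ray_offset c c2) (simp add: prod_eq_iff field_simps)
qed

text \<open>If two translates shared an interior point, the difference of their lattice vectors
  would have projections less than \<open>2 * r\<close> in absolute value on three of the normals.
  In integer coordinates this reads \<open>\<bar>2 * i + j\<bar> < 2\<close>,
  \<open>\<bar>i + 2 * j\<bar> < 2\<close>, \<open>\<bar>j - i\<bar> < 2\<close>, with only the zero
  solution.\<close>

lemma hexlat_packing:
  assumes K: "K \<subseteq> hexcut c \<theta> r" and r: "r > 0"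
  shows "is_packing ((\<lambda>v. (+) v ` K) ` hexlat \<theta> r)"
proof -
  have int: "(x - c) \<bullet> ray \<theta> k < r" if x: "x \<in> interior K" and k: "k < 6" for x k
  proof -
    have "K \<subseteq> {x. ray \<theta> k \<bullet> x \<le> r + ray \<theta> k \<bullet> c}" using K k hexcut_iff by blast
    then have "interior K \<subseteq> interior {x. ray \<theta> k \<bullet> x \<le> r + ray \<theta> k \<bullet> c}" by (rule interior_mono)
    also have "\<dots> = {x. ray \<theta> k \<bullet> x < r + ray \<theta> k \<bullet> c}"
      using norm_ray[of \<theta> k] by (intro interior_halfspace_le) (metis norm_zero zero_neq_one)
    finally have "ray \<theta> k \<bullet> x < r + ray \<theta> k \<bullet> c" using x by blast
    then show ?thesis by (simp add: inner_diff_left inner_commute[of "ray \<theta> k"])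
  qed
  have main: "v = w" if v: "v \<in> hexlat \<theta> r" and w: "w \<in> hexlat \<theta> r" and xz: "x \<in> interior K" "z \<in> interior K" "v + x = w + z" for v w x z
  proof -
    obtain m n m' n' where vw: "v = of_int m *\<^sub>R ((2 * r) *\<^sub>R ray \<theta> 0) + of_int n *\<^sub>R ((2 * r) *\<^sub>R ray \<theta> 1)"
      "w = of_int m' *\<^sub>R ((2 * r) *\<^sub>R ray \<theta> 0) + of_int n' *\<^sub>R ((2 * r) *\<^sub>R ray \<theta> 1)"
      using v w unfolding lattice_of_def by blast
    define i j where "i = m - m'" and "j = n - n'"
    have "z - x = v - w" using xz(3) by (simp add: algebra_simps)
    also have "\<dots> = (2 * r) *\<^sub>R (of_int i *\<^sub>R ray \<theta> 0 + of_int j *\<^sub>R ray \<theta> 1)"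
      unfolding vw i_def j_def by (simp add: algebra_simps)
    finally have zx: "z - x = (2 * r) *\<^sub>R (of_int i *\<^sub>R ray \<theta> 0 + of_int j *\<^sub>R ray \<theta> 1)" .
    have bd: "\<bar>(z - x) \<bullet> ray \<theta> k\<bar> < 2 * r" if k: "k < 3" for k
    proof -
      have "(z - c) \<bullet> ray \<theta> k < r" "(x - c) \<bullet> ray \<theta> (k + 3) < r" "(x - c) \<bullet> ray \<theta> k < r" "(z - c) \<bullet> ray \<theta> (k + 3) < r"
        using int xz k by auto
      then show ?thesis unfolding ray_opposite by (simp add: inner_diff_left abs_less_iff)
    qed
    have r00: "ray \<theta> 0 \<bullet> ray \<theta> 0 = 1" "ray \<theta> 1 \<bullet> ray \<theta> 1 = 1" by (rule ray_self)+
    have r01: "ray \<theta> 0 \<bullet> ray \<theta> 1 = 1 / 2" "ray \<theta> 1 \<bullet> ray \<theta> 0 = 1 / 2"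
      by (simp_all only: ray_inner) (simp_all add: cos_60)
    have "\<bar>(2 * r) * (of_int i + of_int j / 2)\<bar> < 2 * r"
      using bd[of 0] unfolding zx by (simp add: inner_add_left r00 r01[unfolded One_nat_def])
    moreover have "\<bar>(2 * r) * (of_int i / 2 + of_int j)\<bar> < 2 * r"
      using bd[of 1] unfolding zx by (simp add: inner_add_left r00 r01[unfolded One_nat_def])
    moreover have "\<bar>(2 * r) * (of_int j / 2 - of_int i / 2)\<bar> < 2 * r"
      using bd[of 2] unfolding zx ray_2 by (simp add: inner_add_left inner_diff_right r01[unfolded One_nat_def] algebra_simps)
    ultimately have "\<bar>real_of_int i + of_int j / 2\<bar> < 1" "\<bar>real_of_int i / 2 + of_int j\<bar> < 1" "\<bar>real_of_int j / 2 - of_int i / 2\<bar> < 1"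
      using r by (simp_all add: abs_mult)
    then have "\<bar>2 * i + j\<bar> < 2" "\<bar>i + 2 * j\<bar> < 2" "\<bar>j - i\<bar> < 2" by linarith+
    then have "i = 0" "j = 0" by presburger+
    then show "v = w" using vw by (simp add: i_def j_def)
  qed
  show ?thesis unfolding is_packing_def
  proof (rule pairwiseI)
    fix A B assume "A \<in> (\<lambda>v. (+) v ` K) ` hexlat \<theta> r" "B \<in> (\<lambda>v. (+) v ` K) ` hexlat \<theta> r" and AB: "A \<noteq> B"
    then obtain v w where v: "v \<in> hexlat \<theta> r" "A = (+) v ` K" and w: "w \<in> hexlat \<theta> r" "B = (+) w ` K" by (elim imageE)
    show "interior A \<inter> interior B = {}"
    proof (rule ccontr)
      assume "interior A \<inter> interior B \<noteq> {}"
      then obtain y where "y \<in> (+) v ` interior K" "y \<in> (+) w ` interior K"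
        unfolding v(2) w(2) interior_translation by blast
      then obtain x z where "x \<in> interior K" "z \<in> interior K" "y = v + x" "y = w + z" by (elim imageE)
      then have "x \<in> interior K" "z \<in> interior K" "v + x = w + z" by simp_all
      then have "v = w" by (rule main[OF v(1) w(1)])
      then show False using AB v w by simp
    qed
  qed
qed

text \<open>The hexagon of inradius \<open>r\<close> is the Voronoi cell of the lattice. For
  \<open>v\<close> nearest to \<open>x - c\<close>, comparison with the six neighbors
  \<open>v + (2 * r) *\<^sub>R ray \<theta> k\<close> yields the six half-planes; passing to the
  finite set \<open>S\<close> ensures that a nearest point exists.\<close>

lemma hexlat_covering:
  assumes K: "hexcut c \<theta> r \<subseteq> K" and r: "r > 0"
  shows "is_covering ((\<lambda>v. (+) v ` K) ` hexlat \<theta> r)"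
proof -
  let ?a = "(2 * r) *\<^sub>R ray \<theta> 0" and ?b = "(2 * r) *\<^sub>R ray \<theta> 1"
  have "0 < cross ?a ?b" unfolding cross_hexlat using r by simp
  then interpret plane_lattice ?a ?b by unfold_locales simp
  have lat_ray: "v + (2 * r) *\<^sub>R ray \<theta> k \<in> hexlat \<theta> r" if v: "v \<in> hexlat \<theta> r" and k: "k < 6" for v k
  proof -
    have c: "co1 v \<in> \<int>" "co2 v \<in> \<int>" using v unfolding lattice_co by auto
    have a: "co1 ?a = 1" "co2 ?a = 0" "co1 ?b = 0" "co2 ?b = 1" using co_lin[of 1 0] co_lin[of 0 1] by simp_all
    have neg: "co1 (- x) = - co1 x" "co2 (- x) = - co2 x" for x using co_add[of x "- x"] co_lin[of 0 0] by simp_all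
    have b3: "co1 ((2 * r) *\<^sub>R ray \<theta> k) \<in> \<int> \<and> co2 ((2 * r) *\<^sub>R ray \<theta> k) \<in> \<int>" if "k < 3" for k
    proof -
      consider "k = 0" | "k = 1" | "k = 2" using \<open>k < 3\<close> by linarith
      then show ?thesis
      proof cases
        case 3
        have "(2 * r) *\<^sub>R ray \<theta> 2 = ?b + (- ?a)" by (simp add: ray_2 algebra_simps)
        then show ?thesis unfolding 3 by (simp only: co_add neg a) simp
      qed (use a in simp_all)
    qed
    have "co1 ((2 * r) *\<^sub>R ray \<theta> k) \<in> \<int> \<and> co2 ((2 * r) *\<^sub>R ray \<theta> k) \<in> \<int>"
    proof (cases "k < 3")
      case False
      then obtain j where j: "k = j + 3" "j < 3" using k le_Suc_ex[of 3 k] by (auto simp: add.commute)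
      have "(2 * r) *\<^sub>R ray \<theta> k = - ((2 * r) *\<^sub>R ray \<theta> j)" unfolding j ray_opposite by simp
      then show ?thesis using b3[OF j(2)] by (simp only: neg) simp
    qed (rule b3)
    then show ?thesis unfolding lattice_co co_add using c by simp
  qed
  have "x \<in> \<Union>((\<lambda>v. (+) v ` K) ` hexlat \<theta> r)" for x
  proof -
    define y where "y = x - c"
    obtain v0 where v0: "v0 \<in> hexlat \<theta> r" using cell_cover by blast
    define S where "S = {v \<in> hexlat \<theta> r. dist y v \<le> dist y v0}"
    have "S \<subseteq> hexlat \<theta> r \<inter> cball 0 (norm y + dist y v0)"
    proof
      fix v assume v: "v \<in> S"
      then have "norm v \<le> norm y + dist y v0" using norm_triangle_sub[of v y] by (simp add: S_def dist_norm norm_minus_commute)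
      then show "v \<in> hexlat \<theta> r \<inter> cball 0 (norm y + dist y v0)" using v by (simp add: S_def)
    qed
    moreover have "finite (hexlat \<theta> r \<inter> cball 0 (norm y + dist y v0))" by (rule lattice_points_finite) simp
    ultimately have "finite S" by (rule finite_subset)
    moreover have "v0 \<in> S" using v0 by (simp add: S_def)
    then have "S \<noteq> {}" by blast
    ultimately obtain v where v: "v \<in> S" "\<And>w. w \<in> S \<Longrightarrow> dist y v \<le> dist y w"
      by (metis arg_min_if_finite(1) arg_min_least)
    have vl: "v \<in> hexlat \<theta> r" using v(1) by (simp add: S_def)
    have min: "dist y v \<le> dist y w" if "w \<in> hexlat \<theta> r" for w
    proof (cases "dist y w \<le> dist y v0")
      case False then show ?thesis using v(1) by (simp add: S_def)
    qed (use that v(2) in \<open>simp add: S_def\<close>)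
    have "(y - v) \<bullet> ray \<theta> k \<le> r" if k: "k < 6" for k
    proof -
      define u where "u = (2 * r) *\<^sub>R ray \<theta> k"
      have "dist y v \<le> dist y (v + u)" using min[OF lat_ray[OF vl k]] by (simp add: u_def)
      then have "(norm (y - v))\<^sup>2 \<le> (norm (y - v - u))\<^sup>2" by (intro power_mono) (simp_all add: dist_norm algebra_simps)
      also have "\<dots> = (norm (y - v))\<^sup>2 - 2 * ((y - v) \<bullet> u) + u \<bullet> u"
        unfolding power2_norm_eq_inner by (simp add: inner_diff_left inner_diff_right inner_commute)
      finally have "2 * ((y - v) \<bullet> u) \<le> u \<bullet> u" by simp
      moreover have "u \<bullet> u = 4 * r\<^sup>2" using norm_ray[of \<theta> k] by (simp add: u_def norm_eq_1 power2_eq_square)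
      ultimately have "4 * r * ((y - v) \<bullet> ray \<theta> k) \<le> 4 * r * r" by (simp add: u_def power2_eq_square)
      then show ?thesis using r by simp
    qed
    then have "c + (y - v) \<in> hexcut c \<theta> r" by (simp add: hexcut_def)
    then have "c + (y - v) \<in> K" using K by blast
    moreover have "x = v + (c + (y - v))" by (simp add: y_def)
    ultimately have "x \<in> (+) v ` K" by blast
    then show ?thesis using vl by blast
  qed
  then show ?thesis unfolding is_covering_def by blast
qed

theorem body_packing_densities:
  assumes K: "compact K" "cball c r \<subseteq> K" "K \<subseteq> hexcut c \<theta> r" and r: "r > 0"
  shows "packing_density K = measure lebesgue K / (2 * sqrt 3 * r\<^sup>2)"
    "packing_density_T K = measure lebesgue K / (2 * sqrt 3 * r\<^sup>2)"
    "packing_density_L K = measure lebesgue K / (2 * sqrt 3 * r\<^sup>2)"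
  using packing_densities[OF K(1,2) r cross_hexlat hexlat_packing[OF K(3) r]] by auto

theorem body_covering_densities:
  assumes K: "compact K" "hexagon c \<theta> R \<subseteq> K" "K \<subseteq> cball c R" and R: "R > 0"
  shows "covering_density K = measure lebesgue K / (3 * sqrt 3 / 2 * R\<^sup>2)"
    "covering_density_T K = measure lebesgue K / (3 * sqrt 3 / 2 * R\<^sup>2)"
    "covering_density_L K = measure lebesgue K / (3 * sqrt 3 / 2 * R\<^sup>2)"
proof -
  have r: "R * sqrt 3 / 2 > 0" using R by simp
  have h: "hexcut c (\<theta> + pi / 6) (R * sqrt 3 / 2) \<subseteq> K" using K(2) by (simp add: hexagon_eq_hexcut[OF R])
  have "K \<noteq> {}" using K(2) hexagon_center[of R c \<theta>] R by auto
  moreover have "2 * sqrt 3 * (R * sqrt 3 / 2)\<^sup>2 = 3 * sqrt 3 / 2 * R\<^sup>2"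
    by (simp add: power_mult_distrib power_divide)
  ultimately show "covering_density K = measure lebesgue K / (3 * sqrt 3 / 2 * R\<^sup>2)"
    "covering_density_T K = measure lebesgue K / (3 * sqrt 3 / 2 * R\<^sup>2)"
    "covering_density_L K = measure lebesgue K / (3 * sqrt 3 / 2 * R\<^sup>2)"
    using covering_densities[OF K(1) _ K(3) R _ hexlat_covering[OF h r]] cross_hexlat by metis+
qed


section \<open>Areas of the cut disk and of the hull of disk and hexagon\<close>

lemma ray_sum_norm:
  assumes "j < 6" "k < 6" "j \<noteq> k"
  shows "x \<bullet> ray \<theta> j + x \<bullet> ray \<theta> k \<le> sqrt 3 * norm x"
proof -
  have "(norm (ray \<theta> j + ray \<theta> k))\<^sup>2 = 2 + 2 * (ray \<theta> j \<bullet> ray \<theta> k)"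
    unfolding power2_norm_eq_inner by (simp add: inner_add_left inner_add_right inner_commute)
  also have "\<dots> \<le> 3" using ray_inner_le[OF assms, of \<theta>] by simp
  finally have "norm (ray \<theta> j + ray \<theta> k) \<le> sqrt 3" by (rule real_le_rsqrt)
  then have "norm x * norm (ray \<theta> j + ray \<theta> k) \<le> norm x * sqrt 3" by (intro mult_left_mono) auto
  moreover have "x \<bullet> (ray \<theta> j + ray \<theta> k) \<le> norm x * norm (ray \<theta> j + ray \<theta> k)" by (rule norm_cauchy_schwarz)
  ultimately show ?thesis by (simp add: inner_add_right mult.commute)
qed

lemma measure_Un_negligible_Int:
  assumes "A \<in> lmeasurable" "B \<in> lmeasurable" "negligible (A \<inter> B)"
  shows "measure lebesgue (A \<union> B) = measure lebesgue A + measure lebesgue B"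
  using assms by (simp add: measure_Un3 negligible_imp_measure0)

lemma negligible_ray_line: "negligible {x. (x - c) \<bullet> ray \<theta> k = b}"
proof -
  have "{x. (x - c) \<bullet> ray \<theta> k = b} = {x. ray \<theta> k \<bullet> x = b + ray \<theta> k \<bullet> c}"
    by (rule Collect_cong) (simp add: inner_diff_left inner_commute[of "ray \<theta> k"] algebra_simps)
  moreover have "ray \<theta> k \<noteq> 0" using norm_ray[of \<theta> k] by (metis norm_zero zero_neq_one)
  ultimately show ?thesis using negligible_hyperplane[of "ray \<theta> k"] by simp
qed

text \<open>The unit disk without six segments of half-angle \<open>\<phi>\<close>, that is, its
  intersection with a concentric hexagon of inradius \<open>cos \<phi>\<close>.\<close>

definition cut_disk_area :: "real \<Rightarrow> real" where
  "cut_disk_area \<phi> = pi - 6 * \<phi> + 6 * (sin \<phi> * cos \<phi>)"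

lemma area_cut_disk:
  assumes phi: "0 \<le> \<phi>" "\<phi> \<le> pi / 6" and rho: "\<rho> > 0"
  shows "measure lebesgue (cball c \<rho> \<inter> hexcut c \<theta> (\<rho> * cos \<phi>)) = \<rho>\<^sup>2 * cut_disk_area \<phi>"
proof -
  define seg where "seg k = {x. \<rho> * cos \<phi> \<le> (x - c) \<bullet> ray \<theta> k \<and> dist x c \<le> \<rho>}" for k
  let ?K = "cball c \<rho> \<inter> hexcut c \<theta> (\<rho> * cos \<phi>)"
  have seg: "compact (seg k)" "measure lebesgue (seg k) = \<rho>\<^sup>2 * (\<phi> - sin \<phi> * cos \<phi>)" for k
  proof -
    have "\<phi> \<le> pi / 2" using phi(2) pi_gt_zero by linarith
    then show "compact (seg k)" "measure lebesgue (seg k) = \<rho>\<^sup>2 * (\<phi> - sin \<phi> * cos \<phi>)"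
      unfolding seg_def by (rule circular_segment[OF norm_ray rho phi(1)])+
  qed
  have cphi: "cos \<phi> \<ge> sqrt 3 / 2"
    using phi cos_monotone_0_pi_le[of \<phi> "pi / 6"] by (simp add: cos_30)
  have K: "compact ?K" using closed_hexcut by (intro compact_Int_closed) auto
  have U: "compact (\<Union>k<6. seg k)" using seg by (intro compact_UN) auto
  have "(\<Union>k<6. seg k) \<union> ?K = cball c \<rho>"
    by (auto simp: seg_def hexcut_def dist_commute not_le intro: less_imp_le)
  moreover have "negligible ((\<Union>k<6. seg k) \<inter> ?K)"
  proof (rule negligible_subset)
    show "negligible (\<Union>k<(6::nat). {x. (x - c) \<bullet> ray \<theta> k = \<rho> * cos \<phi>})"
      by (rule negligible_Union) (auto intro: negligible_ray_line)
    show "(\<Union>k<6. seg k) \<inter> ?K \<subseteq> (\<Union>k<6. {x. (x - c) \<bullet> ray \<theta> k = \<rho> * cos \<phi>})"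
    proof
      fix x assume x: "x \<in> (\<Union>k<6. seg k) \<inter> ?K"
      then obtain k where k: "k < 6" "x \<in> seg k" by blast
      have "(x - c) \<bullet> ray \<theta> k \<le> \<rho> * cos \<phi>" using x k(1) by (simp add: hexcut_def)
      then have "(x - c) \<bullet> ray \<theta> k = \<rho> * cos \<phi>" using k(2) by (simp add: seg_def)
      then show "x \<in> (\<Union>k<6. {x. (x - c) \<bullet> ray \<theta> k = \<rho> * cos \<phi>})" using k(1) by blast
    qed
  qed
  ultimately have 1: "measure lebesgue (cball c \<rho>) = measure lebesgue (\<Union>k<6. seg k) + measure lebesgue ?K"
    using measure_Un_negligible_Int[OF lmeasurable_compact[OF U] lmeasurable_compact[OF K]] by simp
  have 2: "measure lebesgue (\<Union>k<(6::nat). seg k) = (\<Sum>k<(6::nat). measure lebesgue (seg k))"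
  proof (rule measure_negligible_finite_Union_image)
    show "pairwise (\<lambda>j k. negligible (seg j \<inter> seg k)) {..<6}"
    proof (rule pairwiseI)
      fix j k :: nat assume jk: "j \<in> {..<6}" "k \<in> {..<6}" "j \<noteq> k"
      \<comment> \<open>For half-angles up to \<open>pi / 6\<close> neighboring segments meet at
        most on the circle: projections of size at least \<open>\<rho> * sqrt 3 / 2\<close> on two
        directions force, by \<open>ray_sum_norm\<close>, a norm of at least
        \<open>\<rho>\<close>.\<close>
      have "seg j \<inter> seg k \<subseteq> sphere c \<rho>"
      proof
        fix x assume "x \<in> seg j \<inter> seg k"
        then have x: "\<rho> * cos \<phi> \<le> (x - c) \<bullet> ray \<theta> j" "\<rho> * cos \<phi> \<le> (x - c) \<bullet> ray \<theta> k" "dist x c \<le> \<rho>"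
          by (simp_all add: seg_def)
        have "\<rho> * (sqrt 3 / 2) \<le> \<rho> * cos \<phi>" using cphi rho by (intro mult_left_mono) auto
        then have "\<rho> * sqrt 3 \<le> (x - c) \<bullet> ray \<theta> j + (x - c) \<bullet> ray \<theta> k" using x by linarith
        also have "\<dots> \<le> sqrt 3 * norm (x - c)" using jk by (intro ray_sum_norm) auto
        finally have "\<rho> \<le> norm (x - c)" by (simp add: mult.commute)
        then show "x \<in> sphere c \<rho>" using x(3) by (simp add: dist_norm norm_minus_commute)
      qed
      then show "negligible (seg j \<inter> seg k)" using negligible_sphere negligible_subset by blast
    qed
  qed (auto intro: lmeasurable_compact seg)
  have "pi * \<rho>\<^sup>2 = 6 * (\<rho>\<^sup>2 * (\<phi> - sin \<phi> * cos \<phi>)) + measure lebesgue ?K"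
    using 1 2 measure_cball_plane[of \<rho> c] rho by (simp add: seg(2))
  then show ?thesis by (simp add: cut_disk_area_def algebra_simps)
qed

text \<open>The support function of a hull of a union is the larger of the two support functions,
  here \<open>\<rho>\<close> for the disk and \<open>cos \<omega>\<close> for the hexagon.\<close>

lemma hull_disk_hexagon_halfplane:
  assumes x: "x \<in> convex hull (cball c \<rho> \<union> hexagon c \<theta> 1)" and k: "k < 6" and om: "\<bar>\<omega>\<bar> \<le> pi / 6" "cos \<omega> \<le> b" "\<rho> \<le> b"
  shows "(x - c) \<bullet> ray (\<theta> + \<omega>) k \<le> b"
proof -
  let ?r = "ray (\<theta> + \<omega>) k"
  let ?H = "{x. ?r \<bullet> x \<le> b + ?r \<bullet> c}"
  have "cball c \<rho> \<subseteq> ?H"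
  proof
    fix y assume "y \<in> cball c \<rho>"
    then have "norm (y - c) \<le> \<rho>" by (simp add: dist_norm norm_minus_commute)
    moreover have "?r \<bullet> (y - c) \<le> norm (y - c)" using norm_cauchy_schwarz[of ?r "y - c"] by simp
    ultimately show "y \<in> ?H" using om(3) by (simp add: inner_diff_right)
  qed
  moreover have "hexagon c \<theta> 1 \<subseteq> ?H"
    unfolding hexagon_def
  proof (intro hull_minimal convex_halfspace_le image_subsetI)
    fix j :: nat assume "j \<in> {..<6}"
    then have "ray \<theta> j \<bullet> ?r \<le> b" using ray_inner_normal[OF _ k om(1), of j \<theta>] om(2) by auto
    then show "c + 1 *\<^sub>R ray \<theta> j \<in> ?H" by (simp add: inner_add_left inner_commute[of ?r])
  qed
  ultimately have "convex hull (cball c \<rho> \<union> hexagon c \<theta> 1) \<subseteq> ?H"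
    by (intro hull_minimal convex_halfspace_le) blast
  then have "?r \<bullet> x \<le> b + ?r \<bullet> c" using x by blast
  then show ?thesis by (simp add: inner_diff_left inner_commute[of ?r])
qed

text \<open>The tangents from a vertex, at distance 1, touch the circle of radius
  \<open>cos \<phi>\<close> at angle \<open>\<phi>\<close> from the vertex, so the chord of contact
  has distance \<open>(cos \<phi>)\<^sup>2\<close> from the center. The hull is the disk cut along
  these six chords, together with the six triangular tips \<open>T k\<close> above them. For
  \<open>\<phi> = 0\<close> the tips degenerate and the slope \<open>cot\<close> has no
  meaning.\<close>

lemma area_disk_hexagon_hull:
  assumes phi: "0 \<le> \<phi>" "\<phi> \<le> pi / 6"
  shows "measure lebesgue (convex hull (cball c (cos \<phi>) \<union> hexagon c \<theta> 1))
     = (cos \<phi>)\<^sup>2 * (pi - 6 * \<phi>) + 6 * (sin \<phi> * cos \<phi>)"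
proof (cases "\<phi> = 0")
  case True
  have "convex hull (cball c 1 \<union> hexagon c \<theta> 1) = cball c 1"
    using hexagon_subset_cball[of 1 c \<theta>] by (simp add: Un_absorb2 hull_same)
  then show ?thesis using True measure_cball_plane[of 1 c] by simp
next
  case False
  define \<rho> where "\<rho> = cos \<phi>"
  have cphi: "\<rho> \<ge> sqrt 3 / 2" unfolding \<rho>_def
    using phi cos_monotone_0_pi_le[of \<phi> "pi / 6"] by (simp add: cos_30)
  moreover have "sqrt 3 / 2 > 0" by simp
  ultimately have rho: "\<rho> > 0" by linarith
  have rho1: "\<rho> \<le> 1" by (simp add: \<rho>_def)
  have sphi: "sin \<phi> > 0" using False phi pi_gt_zero by (intro sin_gt_zero) linarith+
  have sc: "(sin \<phi>)\<^sup>2 = 1 - \<rho>\<^sup>2" by (simp add: \<rho>_def sin_squared_eq)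
  let ?L = "convex hull (cball c \<rho> \<union> hexagon c \<theta> 1)"
  let ?K = "cball c \<rho> \<inter> hexcut c \<theta> (\<rho> * cos \<phi>)"
  define cot where "cot = cos \<phi> / sin \<phi>"
  have cot0: "cot \<ge> 0" using rho sphi by (simp add: cot_def \<rho>_def)
  define T where "T k = {x. \<rho>\<^sup>2 \<le> (x - c) \<bullet> ray \<theta> k \<and> (x - c) \<bullet> ray \<theta> k \<le> 1 \<and>
     \<bar>(x - c) \<bullet> perp (ray \<theta> k)\<bar> \<le> (1 - (x - c) \<bullet> ray \<theta> k) * cot}" for k
  have r21: "\<rho>\<^sup>2 \<le> 1" using rho rho1 by (simp add: power_le_one)
  have T: "compact (T k)" "measure lebesgue (T k) = sin \<phi> ^ 3 * cos \<phi>" for k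
  proof -
    define F where "F x = - ((1 - x)\<^sup>2 / 2 * cot)" for x
    have "((\<lambda>x. (1 - x) * cot) has_integral F 1 - F (\<rho>\<^sup>2)) {\<rho>\<^sup>2..1}"
    proof (rule fundamental_theorem_of_calculus[OF r21])
      fix x assume "x \<in> {\<rho>\<^sup>2..1}"
      have "(F has_field_derivative (1 - x) * cot) (at x within {\<rho>\<^sup>2..1})"
        unfolding F_def by (auto intro!: derivative_eq_intros simp: field_simps)
      then show "(F has_vector_derivative (1 - x) * cot) (at x within {\<rho>\<^sup>2..1})"
        by (simp add: has_real_derivative_iff_has_vector_derivative)
    qed
    then have I: "((\<lambda>x. (1 - x) * cot) has_integral ((sin \<phi>)\<^sup>2)\<^sup>2 / 2 * cot) {\<rho>\<^sup>2..1}"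
      by (simp add: F_def sc)
    have cont: "continuous_on {\<rho>\<^sup>2..1} (\<lambda>x. (1 - x) * cot)" by (intro continuous_intros)
    have nn: "0 \<le> (1 - x) * cot" if "x \<in> {\<rho>\<^sup>2..1}" for x using that cot0 by simp
    have "compact (T k) \<and> measure lebesgue (T k) = 2 * (((sin \<phi>)\<^sup>2)\<^sup>2 / 2 * cot)"
      unfolding T_def by (intro conjI area_framed_strip[OF norm_ray r21 cont nn I])
    moreover have "2 * (((sin \<phi>)\<^sup>2)\<^sup>2 / 2 * cot) = sin \<phi> ^ 3 * cos \<phi>"
      using sphi by (simp add: cot_def field_simps eval_nat_numeral)
    ultimately show "compact (T k)" "measure lebesgue (T k) = sin \<phi> ^ 3 * cos \<phi>" by simp_all
  qed
  have inL: "cball c \<rho> \<subseteq> ?L" "hexagon c \<theta> 1 \<subseteq> ?L"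
    by (rule order_trans[OF Un_upper1 hull_subset], rule order_trans[OF Un_upper2 hull_subset])
  have TL: "T k \<subseteq> ?L" if k: "k < 6" for k
  proof
    fix x assume x: "x \<in> T k"
    define X Y where "X = (x - c) \<bullet> ray \<theta> k" and "Y = (x - c) \<bullet> perp (ray \<theta> k)"
    have xx: "\<rho>\<^sup>2 \<le> X" "X \<le> 1" "\<bar>Y\<bar> \<le> (1 - X) * cot" using x by (simp_all add: T_def X_def Y_def)
    have xe: "x = c + X *\<^sub>R ray \<theta> k + Y *\<^sub>R perp (ray \<theta> k)"
      using frame_coords(3)[OF norm_ray, of c \<theta> k x] by (simp add: frame_map_def X_def Y_def)
    have "c + 1 *\<^sub>R ray \<theta> k \<in> hexagon c \<theta> 1"
      unfolding hexagon_def by (rule hull_inc, rule imageI) (use k in simp)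
    then have v: "c + ray \<theta> k \<in> ?L" using inL(2) by auto
    show "x \<in> ?L"
    proof (cases "X = 1")
      case True
      then show ?thesis using xx xe v by simp
    next
      case False
      \<comment> \<open>Central projection from the vertex: \<open>l\<close> is the fraction of the
        way from the vertex down to the chord of contact, and \<open>q\<close> is the point of the
        chord hit by the line through \<open>x\<close>.\<close>
      define l where "l = (1 - X) / (sin \<phi>)\<^sup>2"
      have l: "0 < l" "l \<le> 1" using False xx sphi sc by (auto simp: l_def field_simps)
      have ls: "l * (sin \<phi>)\<^sup>2 = 1 - X" using sphi by (simp add: l_def)
      define q where "q = c + \<rho>\<^sup>2 *\<^sub>R ray \<theta> k + (Y / l) *\<^sub>R perp (ray \<theta> k)"
      have "\<bar>Y / l\<bar> \<le> \<rho> * sin \<phi>"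
      proof -
        have "\<bar>Y\<bar> \<le> l * (sin \<phi>)\<^sup>2 * cot" using xx(3) ls by simp
        also have "\<dots> = (\<rho> * sin \<phi>) * l" using sphi by (simp add: cot_def \<rho>_def power2_eq_square)
        finally show ?thesis using l by (simp add: abs_divide divide_le_eq)
      qed
      then have "\<bar>Y / l\<bar>\<^sup>2 \<le> (\<rho> * sin \<phi>)\<^sup>2" by (intro power_mono) auto
      then have yl: "(Y / l)\<^sup>2 \<le> \<rho>\<^sup>2 * (1 - \<rho>\<^sup>2)" by (simp add: power_mult_distrib sc del: abs_divide)
      have "(dist q c)\<^sup>2 = (\<rho>\<^sup>2)\<^sup>2 + (Y / l)\<^sup>2"
      proof -
        have "q = frame_map c (ray \<theta> k) (\<rho>\<^sup>2, Y / l)" by (simp add: q_def frame_map_def)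
        then show ?thesis using frame_norm[OF norm_ray, of q c \<theta> k] frame_coords(1,2)[OF norm_ray, of c \<theta> k "(\<rho>\<^sup>2, Y / l)"]
          by simp
      qed
      also have "\<dots> \<le> \<rho>\<^sup>2" using yl by (simp add: power2_eq_square algebra_simps)
      finally have "dist q c \<le> \<rho>" by (rule power2_le_imp_le) (use rho in simp)
      then have "q \<in> ?L" using inL(1) by (auto simp: dist_commute)
      then have "(1 - l) *\<^sub>R (c + ray \<theta> k) + l *\<^sub>R q \<in> ?L"
        using v l by (intro convexD[OF convex_convex_hull]) auto
      moreover have "(1 - l) *\<^sub>R (c + ray \<theta> k) + l *\<^sub>R q = x"
      proof -
        have "1 - l + l * \<rho>\<^sup>2 = X" using ls unfolding sc by (simp add: algebra_simps)
        then have "(1 - l) *\<^sub>R ray \<theta> k + (l * \<rho>\<^sup>2) *\<^sub>R ray \<theta> k = X *\<^sub>R ray \<theta> k" by (simp add: scaleR_left_distrib[symmetric])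
        moreover have "(1 - l) *\<^sub>R (c + ray \<theta> k) + l *\<^sub>R q
          = c + ((1 - l) *\<^sub>R ray \<theta> k + (l * \<rho>\<^sup>2) *\<^sub>R ray \<theta> k) + Y *\<^sub>R perp (ray \<theta> k)"
          using l by (simp add: q_def algebra_simps)
        ultimately show ?thesis using xe by simp
      qed
      ultimately show ?thesis by simp
    qed
  qed
  have Lsub: "?L \<subseteq> ?K \<union> (\<Union>k<6. T k)"
  proof
    fix x assume x: "x \<in> ?L"
    note hp = hull_disk_hexagon_halfplane[OF x]
    have T_if: "x \<in> T k" if k: "k < 6" "\<rho>\<^sup>2 \<le> (x - c) \<bullet> ray \<theta> k" for k
    proof -
      define X Y where "X = (x - c) \<bullet> ray \<theta> k" and "Y = (x - c) \<bullet> perp (ray \<theta> k)"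
      \<comment> \<open>The directions at angles \<open>\<phi>\<close> and \<open>- \<phi>\<close>
        from the vertex are the normals of the two tangents through it.\<close>
      have "(x - c) \<bullet> ray (\<theta> + \<phi>) k \<le> \<rho>" "(x - c) \<bullet> ray (\<theta> + - \<phi>) k \<le> \<rho>"
        using phi by (intro hp k; simp add: \<rho>_def)+
      then have "X * cos \<phi> + Y * sin \<phi> \<le> \<rho>" "X * cos \<phi> - Y * sin \<phi> \<le> \<rho>"
        unfolding ray_offset by (simp_all add: inner_add_right inner_diff_right X_def Y_def mult.commute)
      then have "\<bar>Y\<bar> * sin \<phi> \<le> (1 - X) * cos \<phi>" by (simp add: \<rho>_def abs_if algebra_simps)
      then have y: "\<bar>Y\<bar> \<le> (1 - X) * cot" using sphi by (simp add: cot_def field_simps)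
      then have "0 \<le> (1 - X) * cot" by linarith
      moreover have "cot > 0" using rho sphi by (simp add: cot_def \<rho>_def)
      ultimately have "X \<le> 1" by (simp add: zero_le_mult_iff)
      then show ?thesis using y k(2) by (simp add: T_def X_def Y_def)
    qed
    show "x \<in> ?K \<union> (\<Union>k<6. T k)"
    proof (cases "\<exists>k<6. \<rho>\<^sup>2 \<le> (x - c) \<bullet> ray \<theta> k")
      case True then show ?thesis using T_if by blast
    next
      case False
      then have hc: "x \<in> hexcut c \<theta> (\<rho> * cos \<phi>)"
        by (auto simp: hexcut_def \<rho>_def power2_eq_square not_le intro: less_imp_le)
      obtain k \<psi> where k: "k < 6" "\<bar>\<psi>\<bar> \<le> pi / 6" "x - c = norm (x - c) *\<^sub>R ray (\<theta> + \<psi>) k"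
        by (rule sector_decomposition)
      \<comment> \<open>At an angle of at least \<open>\<phi>\<close> from the nearest vertex the
        hull extends no further than the disk. At a smaller angle the chord of contact, which
        \<open>x\<close> has not passed, already keeps \<open>x\<close> inside the disk.\<close>
      have "norm (x - c) \<le> \<rho>"
      proof (cases "\<bar>\<psi>\<bar> \<ge> \<phi>")
        case True
        have "cos \<bar>\<psi>\<bar> \<le> cos \<phi>" using True phi k(2) by (intro cos_monotone_0_pi_le) auto
        then have "(x - c) \<bullet> ray (\<theta> + \<psi>) k \<le> \<rho>" using k by (intro hp) (simp_all add: \<rho>_def)
        moreover have "(x - c) \<bullet> ray (\<theta> + \<psi>) k = norm (x - c)" by (subst k(3)) simp
        ultimately show ?thesis by simp
      next
        case lt: False
        have "cos \<phi> \<le> cos \<bar>\<psi>\<bar>" using lt phi k(2) by (intro cos_monotone_0_pi_le) auto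
        then have "norm (x - c) * \<rho> \<le> norm (x - c) * cos \<psi>" by (intro mult_left_mono) (simp_all add: \<rho>_def)
        also have "\<dots> = (x - c) \<bullet> ray \<theta> k"
        proof -
          have "perp (ray \<theta> k) \<bullet> ray \<theta> k = 0" by (cases "ray \<theta> k") (simp add: perp_def)
          then show ?thesis by (subst (2) k(3)) (simp add: ray_offset inner_add_left)
        qed
        also have "\<dots> < \<rho>\<^sup>2" using False k(1) by auto
        finally have "norm (x - c) < \<rho>" using rho by (simp add: power2_eq_square)
        then show ?thesis by simp
      qed
      then show ?thesis using hc by (simp add: dist_norm norm_minus_commute)
    qed
  qed
  have K: "compact ?K" using closed_hexcut by (intro compact_Int_closed) auto
  have U: "compact (\<Union>k<6. T k)" using T by (intro compact_UN) auto
  have Leq: "?L = (\<Union>k<6. T k) \<union> ?K" using Lsub TL inL(1) by blast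
  have neg1: "negligible ((\<Union>k<6. T k) \<inter> ?K)"
  proof (rule negligible_subset)
    show "negligible (\<Union>k<(6::nat). {x. (x - c) \<bullet> ray \<theta> k = \<rho>\<^sup>2})"
      by (rule negligible_Union) (auto intro: negligible_ray_line)
    show "(\<Union>k<6. T k) \<inter> ?K \<subseteq> (\<Union>k<6. {x. (x - c) \<bullet> ray \<theta> k = \<rho>\<^sup>2})"
    proof
      fix x assume x: "x \<in> (\<Union>k<6. T k) \<inter> ?K"
      then obtain k where k: "k < 6" "x \<in> T k" by blast
      have "(x - c) \<bullet> ray \<theta> k \<le> \<rho>\<^sup>2" using x k(1) by (simp add: hexcut_def \<rho>_def power2_eq_square)
      then have "(x - c) \<bullet> ray \<theta> k = \<rho>\<^sup>2" using k(2) by (simp add: T_def)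
      then show "x \<in> (\<Union>k<6. {x. (x - c) \<bullet> ray \<theta> k = \<rho>\<^sup>2})" using k(1) by blast
    qed
  qed
  have 1: "measure lebesgue ?L = measure lebesgue (\<Union>k<6. T k) + measure lebesgue ?K"
    unfolding Leq using neg1 by (intro measure_Un_negligible_Int lmeasurable_compact U K)
  \<comment> \<open>Each tip lies within \<open>pi / 6\<close> of its vertex direction, because
    \<open>\<rho>\<^sup>2 \<ge> 3 / 4\<close>; hence different tips meet at most on a line through
    the center.\<close>
  have Tcone: "norm (x - c) * (sqrt 3 / 2) \<le> (x - c) \<bullet> ray \<theta> k" if x: "x \<in> T k" for x k
  proof -
    define X Y where "X = (x - c) \<bullet> ray \<theta> k" and "Y = (x - c) \<bullet> perp (ray \<theta> k)"
    have xx: "\<rho>\<^sup>2 \<le> X" "X \<le> 1" "\<bar>Y\<bar> \<le> (1 - X) * cot" using x by (simp_all add: T_def X_def Y_def)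
    have "(1 - X) * cot \<le> (1 - \<rho>\<^sup>2) * cot" using xx cot0 by (intro mult_right_mono) auto
    also have "\<dots> = \<rho> * sin \<phi>" using sphi unfolding sc[symmetric] by (simp add: cot_def \<rho>_def power2_eq_square)
    finally have "\<bar>Y\<bar> \<le> \<rho> * sin \<phi>" using xx(3) by linarith
    then have "\<bar>Y\<bar>\<^sup>2 \<le> (\<rho> * sin \<phi>)\<^sup>2" by (intro power_mono) auto
    then have "Y\<^sup>2 \<le> \<rho>\<^sup>2 * (1 - \<rho>\<^sup>2)" by (simp add: power_mult_distrib sc)
    moreover have "1 - \<rho>\<^sup>2 \<le> 1/4"
    proof -
      have "(sqrt 3 / 2)\<^sup>2 \<le> \<rho>\<^sup>2" using cphi by (intro power_mono) auto
      then show ?thesis by (simp add: power_divide)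
    qed
    moreover have "(\<rho>\<^sup>2)\<^sup>2 \<le> X\<^sup>2" using xx(1) by (intro power_mono) auto
    moreover have "\<rho>\<^sup>2 * (3 * (1 - \<rho>\<^sup>2)) \<le> \<rho>\<^sup>2 * \<rho>\<^sup>2"
      using \<open>1 - \<rho>\<^sup>2 \<le> 1/4\<close> by (intro mult_left_mono) auto
    moreover have "\<rho>\<^sup>2 * (3 * (1 - \<rho>\<^sup>2)) = 3 * (\<rho>\<^sup>2 * (1 - \<rho>\<^sup>2))" "\<rho>\<^sup>2 * \<rho>\<^sup>2 = (\<rho>\<^sup>2)\<^sup>2"
      by (simp_all only: power2_eq_square mult_ac)
    ultimately have "3 * Y\<^sup>2 \<le> X\<^sup>2" by linarith
    moreover have "(norm (x - c))\<^sup>2 = X\<^sup>2 + Y\<^sup>2" using frame_norm[OF norm_ray, of x c \<theta> k] by (simp add: X_def Y_def dist_norm)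
    ultimately have "(norm (x - c) * (sqrt 3 / 2))\<^sup>2 \<le> X\<^sup>2" by (simp add: power_mult_distrib power_divide)
    then show ?thesis unfolding X_def[symmetric] by (rule power2_le_imp_le) (use xx(1) zero_le_power2[of \<rho>] in linarith)
  qed
  have 2: "measure lebesgue (\<Union>k<(6::nat). T k) = (\<Sum>k<(6::nat). measure lebesgue (T k))"
  proof (rule measure_negligible_finite_Union_image)
    show "pairwise (\<lambda>j k. negligible (T j \<inter> T k)) {..<6}"
    proof (rule pairwiseI)
      fix j k :: nat assume jk: "j \<in> {..<6}" "k \<in> {..<6}" "j \<noteq> k"
      define n where "n = ray \<theta> j - ray \<theta> k"
      have "n \<noteq> 0"
      proof
        assume "n = 0"
        then have "ray \<theta> j \<bullet> ray \<theta> k = 1" by (simp add: n_def)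
        then show False using ray_inner_le[of j k \<theta>] jk by simp
      qed
      have "T j \<inter> T k \<subseteq> {x. n \<bullet> x = n \<bullet> c}"
      proof
        fix x assume "x \<in> T j \<inter> T k"
        then have "norm (x - c) * (sqrt 3 / 2) \<le> (x - c) \<bullet> ray \<theta> j" "norm (x - c) * (sqrt 3 / 2) \<le> (x - c) \<bullet> ray \<theta> k"
          using Tcone by auto
        moreover have "(x - c) \<bullet> ray \<theta> j + (x - c) \<bullet> ray \<theta> k \<le> sqrt 3 * norm (x - c)"
          using jk by (intro ray_sum_norm) auto
        ultimately have "(x - c) \<bullet> ray \<theta> j = (x - c) \<bullet> ray \<theta> k" by (simp add: mult.commute)
        then have "(x - c) \<bullet> n = 0" by (simp add: n_def inner_diff_right)
        then show "x \<in> {x. n \<bullet> x = n \<bullet> c}" by (simp add: inner_diff_left inner_commute[of n])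
      qed
      then show "negligible (T j \<inter> T k)" using negligible_hyperplane[of n] \<open>n \<noteq> 0\<close> negligible_subset by blast
    qed
  qed (auto intro: lmeasurable_compact T)
  have "measure lebesgue ?L = 6 * (sin \<phi> ^ 3 * cos \<phi>) + \<rho>\<^sup>2 * cut_disk_area \<phi>"
    using 1 2 area_cut_disk[OF phi rho, of c \<theta>] by (simp add: T(2))
  also have "\<dots> = (cos \<phi>)\<^sup>2 * (pi - 6 * \<phi>) + 6 * (sin \<phi> * cos \<phi>) * ((sin \<phi>)\<^sup>2 + (cos \<phi>)\<^sup>2)"
  proof -
    have "6 * (s ^ 3 * z) + z\<^sup>2 * (pi - 6 * \<phi> + 6 * (s * z)) = z\<^sup>2 * (pi - 6 * \<phi>) + 6 * (s * z) * (s\<^sup>2 + z\<^sup>2)" for s z :: real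
      by (simp add: power2_eq_square power3_eq_cube algebra_simps)
    then show ?thesis unfolding cut_disk_area_def \<rho>_def .
  qed
  finally show ?thesis by (simp add: \<rho>_def)
qed

section \<open>The region of densities\<close>

definition hull_area :: "real \<Rightarrow> real" where
  "hull_area \<phi> = (cos \<phi>)\<^sup>2 * (pi - 6 * \<phi>) + 6 * (sin \<phi> * cos \<phi>)"

text \<open>The denominators are the areas of the regular hexagons of inradius
  \<open>cos \<phi>\<close> and of circumradius 1, the tiles of the extremal packing and
  covering.\<close>

definition density_point :: "real \<Rightarrow> real \<Rightarrow> real \<times> real" where
  "density_point \<phi> a = (a / (2 * sqrt 3 * (cos \<phi>)\<^sup>2), a / (3 * sqrt 3 / 2))"

lemma angle_bounds:
  assumes "\<phi> \<in> {0..pi/6}"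
  shows "cos \<phi> \<ge> sqrt 3 / 2" "cos \<phi> > 0" "sin \<phi> \<ge> 0" "sin \<phi> \<le> 1 / 2" "(cos \<phi>)\<^sup>2 \<ge> 3 / 4" "tan \<phi> \<ge> 0" "(tan \<phi>)\<^sup>2 \<le> 1 / 3" "tan \<phi> \<le> 3 / 4"
proof -
  show c: "cos \<phi> \<ge> sqrt 3 / 2" using assms cos_monotone_0_pi_le[of \<phi> "pi / 6"] by (simp add: cos_30)
  moreover have "sqrt 3 / 2 > 0" by simp
  ultimately show c0: "cos \<phi> > 0" by linarith
  show s: "sin \<phi> \<ge> 0" using assms pi_gt_zero by (intro sin_ge_zero) auto
  show s2: "sin \<phi> \<le> 1 / 2" using assms pi_gt_zero sin_monotone_2pi_le[of \<phi> "pi / 6"] by (simp add: sin_30)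
  have "(sqrt 3 / 2)\<^sup>2 \<le> (cos \<phi>)\<^sup>2" using c by (intro power_mono) auto
  then show c2: "(cos \<phi>)\<^sup>2 \<ge> 3 / 4" by (simp add: power_divide)
  show t0: "tan \<phi> \<ge> 0" using c0 s by (simp add: tan_def)
  have "(sin \<phi>)\<^sup>2 \<le> 1 / 4" using c2 by (simp add: sin_squared_eq)
  then show t2: "(tan \<phi>)\<^sup>2 \<le> 1 / 3" using c2 c0 by (simp add: tan_def power_divide divide_le_eq)
  have "(tan \<phi>)\<^sup>2 \<le> (3 / 4)\<^sup>2" using t2 by (simp add: power2_eq_square)
  then show "tan \<phi> \<le> 3 / 4" by (rule power2_le_imp_le) simp
qed

lemma one_plus_tan: "cos \<phi> \<noteq> 0 \<Longrightarrow> 1 + (tan \<phi>)\<^sup>2 = 1 / (cos \<phi>)\<^sup>2"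
  using tan_sec[of \<phi>] by (simp add: inverse_eq_divide power_one_over)

lemma hull_area_tan:
  assumes "cos \<phi> \<noteq> 0"
  shows "hull_area \<phi> = (cos \<phi>)\<^sup>2 * (pi - 6 * \<phi> + 6 * tan \<phi>)"
  using assms by (simp add: hull_area_def tan_def power2_eq_square algebra_simps)

text \<open>The factored form shows that on \<open>{0..pi/6}\<close> the two areas agree exactly at
  the ends.\<close>

lemma cut_minus_hull: "cut_disk_area \<phi> - hull_area \<phi> = (sin \<phi>)\<^sup>2 * (pi - 6 * \<phi>)"
  by (simp add: cut_disk_area_def hull_area_def cos_squared_eq algebra_simps)

lemma tan_ge_self:
  assumes "0 \<le> x" "x \<le> pi/6" shows "x \<le> tan x"
proof -
  have "tan 0 - 0 \<le> tan x - x"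
  proof (rule DERIV_nonneg_imp_nondecreasing[OF assms(1)])
    fix z assume z: "0 \<le> z" "z \<le> x"
    then have c: "cos z \<noteq> 0" using angle_bounds(2)[of z] assms(2) by auto
    have "((\<lambda>x. tan x - x) has_field_derivative (tan z)\<^sup>2) (at z)"
      by (rule derivative_eq_intros refl c | simp)+ (use tan_sec[OF c] in \<open>simp add: power_inverse\<close>)
    then show "\<exists>y. ((\<lambda>x. tan x - x) has_field_derivative y) (at z) \<and> 0 \<le> y" by (intro exI[of _ "(tan z)\<^sup>2"]) simp
  qed
  then show ?thesis by simp
qed

lemma area_pos:
  assumes "\<phi> \<in> {0..pi/6}"
  shows "3 \<le> pi - 6 * \<phi> + 6 * tan \<phi>" "0 < hull_area \<phi>" "hull_area \<phi> \<le> cut_disk_area \<phi>" "0 < cut_disk_area \<phi>"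
proof -
  show 1: "3 \<le> pi - 6 * \<phi> + 6 * tan \<phi>" using tan_ge_self[of \<phi>] assms pi_gt3 by auto
  then show 2: "0 < hull_area \<phi>" using angle_bounds(2)[OF assms] by (simp add: hull_area_tan)
  have "0 \<le> (sin \<phi>)\<^sup>2 * (pi - 6 * \<phi>)" using assms by (intro mult_nonneg_nonneg) auto
  then show 3: "hull_area \<phi> \<le> cut_disk_area \<phi>" using cut_minus_hull[of \<phi>] by linarith
  then show "0 < cut_disk_area \<phi>" using 2 by linarith
qed

lemma hull_area_less:
  assumes "\<phi> \<in> {0..pi/6}" "\<phi> \<noteq> 0" "\<phi> \<noteq> pi/6"
  shows "hull_area \<phi> < cut_disk_area \<phi>"
proof -
  have "sin \<phi> > 0" using assms pi_gt_zero by (intro sin_gt_zero) auto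
  then have "(sin \<phi>)\<^sup>2 * (pi - 6 * \<phi>) > 0" using assms by (intro mult_pos_pos) auto
  then show ?thesis using cut_minus_hull[of \<phi>] by linarith
qed

text \<open>Here \<open>m\<close> is the derivative of \<open>f\<close> with respect to
  \<open>T\<close>. Being nondecreasing, it makes \<open>f\<close> a convex function of
  \<open>T\<close>, which lies above its tangents; \<open>T\<close> never has to be
  inverted.\<close>

lemma tangent_inequality:
  fixes f T T' m :: "real \<Rightarrow> real"
  assumes f: "\<And>x. x \<in> {a..b} \<Longrightarrow> (f has_field_derivative T' x * m x) (at x)"
    and T: "\<And>x. x \<in> {a..b} \<Longrightarrow> (T has_field_derivative T' x) (at x)" "\<And>x. x \<in> {a..b} \<Longrightarrow> 0 \<le> T' x"
    and m: "\<And>x y. x \<in> {a..b} \<Longrightarrow> y \<in> {a..b} \<Longrightarrow> x \<le> y \<Longrightarrow> m x \<le> m y"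
    and x: "x \<in> {a..b}" "x0 \<in> {a..b}"
  shows "f x0 + m x0 * (T x - T x0) \<le> f x"
proof -
  define G where "G z = f z - m x0 * T z" for z
  have G: "(G has_field_derivative T' z * (m z - m x0)) (at z)" if "z \<in> {a..b}" for z
    unfolding G_def using f[OF that] T(1)[OF that] by (auto intro!: derivative_eq_intros simp: algebra_simps)
  have "G x0 \<le> G x"
  proof (cases "x0 \<le> x")
    case True
    show ?thesis
    proof (rule DERIV_nonneg_imp_nondecreasing[OF True])
      fix z assume z: "x0 \<le> z" "z \<le> x"
      then have "z \<in> {a..b}" "0 \<le> T' z * (m z - m x0)" using x T(2)[of z] m[of x0 z] by auto
      then show "\<exists>y. (G has_field_derivative y) (at z) \<and> 0 \<le> y" using G by blast
    qed
  next
    case False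
    then have "x \<le> x0" by simp
    then show ?thesis
    proof (rule DERIV_nonpos_imp_nonincreasing)
      fix z assume z: "x \<le> z" "z \<le> x0"
      then have "z \<in> {a..b}" "T' z * (m z - m x0) \<le> 0" using x T(2)[of z] m[of z x0] by (auto intro: mult_nonneg_nonpos)
      then show "\<exists>y. (G has_field_derivative y) (at z) \<and> y \<le> 0" using G by blast
    qed
  qed
  then show ?thesis by (simp add: G_def algebra_simps)
qed

section \<open>Curvature of the two boundary curves\<close>

definition tan_sq :: "real \<Rightarrow> real" where "tan_sq \<phi> = (tan \<phi>)\<^sup>2"
text \<open>This and \<open>hull_slope\<close> are the derivatives of the reciprocal areas with
  respect to \<open>tan_sq\<close>. The common factor \<open>tan \<phi>\<close> has been cancelled,
  so both are defined at 0, where \<open>tan_sq\<close> has derivative zero.\<close>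

definition cut_slope :: "real \<Rightarrow> real" where "cut_slope \<phi> = 6 * sin \<phi> * cos \<phi> ^ 3 / (cut_disk_area \<phi>)\<^sup>2"
definition hull_slope :: "real \<Rightarrow> real" where
  "hull_slope \<phi> = 1 / (pi - 6 * \<phi> + 6 * tan \<phi>) - 3 * tan \<phi> / (pi - 6 * \<phi> + 6 * tan \<phi>)\<^sup>2"

lemma deriv_tan_sq:
  assumes "\<phi> \<in> {0..pi/6}"
  shows "(tan_sq has_field_derivative 2 * tan \<phi> / (cos \<phi>)\<^sup>2) (at \<phi>)"
proof -
  have c: "cos \<phi> \<noteq> 0" using angle_bounds(2)[OF assms] by simp
  show ?thesis unfolding tan_sq_def
    by (rule derivative_eq_intros refl c | simp)+ (simp add: field_simps)
qed

lemma deriv_cut_area: "(cut_disk_area has_field_derivative - 12 * (sin \<phi>)\<^sup>2) (at \<phi>)"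
proof -
  have "(cut_disk_area has_field_derivative - 6 + 6 * (cos \<phi> * cos \<phi> - sin \<phi> * sin \<phi>)) (at \<phi>)"
    unfolding cut_disk_area_def[abs_def] by (auto intro!: derivative_eq_intros)
  moreover have "cos \<phi> * cos \<phi> = 1 - (sin \<phi>)\<^sup>2" by (simp add: power2_eq_square[symmetric] cos_squared_eq)
  ultimately show ?thesis by (simp add: power2_eq_square)
qed

text \<open>The slope increases because \<open>(cos z)\<^sup>2 - 3 * (sin z)\<^sup>2\<close> stays
  nonnegative up to \<open>pi / 6\<close>, so the reciprocal area is convex in
  \<open>tan_sq\<close>.\<close>

lemma cut_tangent:
  assumes "\<phi> \<in> {0..pi/6}" "\<phi>0 \<in> {0..pi/6}"
  shows "1 / cut_disk_area \<phi>0 + cut_slope \<phi>0 * (tan_sq \<phi> - tan_sq \<phi>0) \<le> 1 / cut_disk_area \<phi>"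
proof (rule tangent_inequality[where T' = "\<lambda>x. 2 * tan x / (cos x)\<^sup>2", OF _ deriv_tan_sq _ _ assms])
  fix x assume x: "x \<in> {0..pi/6}"
  have A: "cut_disk_area x \<noteq> 0" using area_pos(4)[OF x] by simp
  have c: "cos x \<noteq> 0" using angle_bounds(2)[OF x] by simp
  have "((\<lambda>x. 1 / cut_disk_area x) has_field_derivative (0 * cut_disk_area x - 1 * (- 12 * (sin x)\<^sup>2)) / (cut_disk_area x * cut_disk_area x)) (at x)"
    by (rule DERIV_divide[OF DERIV_const deriv_cut_area A])
  also have "(0 * cut_disk_area x - 1 * (- 12 * (sin x)\<^sup>2)) / (cut_disk_area x * cut_disk_area x) = 2 * tan x / (cos x)\<^sup>2 * cut_slope x"
    using A c by (simp add: cut_slope_def tan_def field_simps eval_nat_numeral)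
  finally show "((\<lambda>x. 1 / cut_disk_area x) has_field_derivative 2 * tan x / (cos x)\<^sup>2 * cut_slope x) (at x)" .
  show "0 \<le> 2 * tan x / (cos x)\<^sup>2" using angle_bounds(6)[OF x] by simp
next
  fix x y :: real assume xy: "x \<in> {0..pi/6}" "y \<in> {0..pi/6}" "x \<le> y"
  show "cut_slope x \<le> cut_slope y"
  proof (rule DERIV_nonneg_imp_nondecreasing[OF xy(3)])
    fix z assume "x \<le> z" "z \<le> y"
    then have z: "z \<in> {0..pi/6}" using xy by auto
    note ab = angle_bounds[OF z]
    have A: "cut_disk_area z > 0" by (rule area_pos(4)[OF z])
    let ?N' = "6 * (cos z * cos z ^ 3 + sin z * (3 * (cos z)\<^sup>2 * (- sin z)))"
    have "(cut_slope has_field_derivative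
       (?N' * (cut_disk_area z)\<^sup>2 - 6 * sin z * cos z ^ 3 * (2 * cut_disk_area z * (- 12 * (sin z)\<^sup>2))) / ((cut_disk_area z)\<^sup>2 * (cut_disk_area z)\<^sup>2)) (at z)"
      unfolding cut_slope_def[abs_def] using A
      by (auto intro!: derivative_eq_intros deriv_cut_area simp: algebra_simps power2_eq_square power3_eq_cube)
    moreover have "0 \<le> ?N' * (cut_disk_area z)\<^sup>2 - 6 * sin z * cos z ^ 3 * (2 * cut_disk_area z * (- 12 * (sin z)\<^sup>2))"
    proof -
      have "?N' = 6 * (cos z)\<^sup>2 * ((cos z)\<^sup>2 - 3 * (sin z)\<^sup>2)"
        by (simp add: power2_eq_square power3_eq_cube algebra_simps)
      moreover have "(cos z)\<^sup>2 - 3 * (sin z)\<^sup>2 \<ge> 0" using ab(5) by (simp add: sin_squared_eq)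
      ultimately have "0 \<le> ?N' * (cut_disk_area z)\<^sup>2" by simp
      moreover have "0 \<le> 6 * sin z * cos z ^ 3 * (2 * cut_disk_area z * (12 * (sin z)\<^sup>2))"
        using ab A by (intro mult_nonneg_nonneg) auto
      ultimately show ?thesis by simp
    qed
    ultimately show "\<exists>d. (cut_slope has_field_derivative d) (at z) \<and> 0 \<le> d"
      by (blast intro: divide_nonneg_nonneg mult_nonneg_nonneg zero_le_power2)
  qed
qed

lemma deriv_tan_linear:
  assumes "\<phi> \<in> {0..pi/6}"
  shows "((\<lambda>x. pi - 6 * x + 6 * tan x) has_field_derivative 6 * (tan \<phi>)\<^sup>2) (at \<phi>)"
proof -
  have c: "cos \<phi> \<noteq> 0" using angle_bounds(2)[OF assms] by simp
  have "((\<lambda>x. pi - 6 * x + 6 * tan x) has_field_derivative - 6 + 6 * inverse ((cos \<phi>)\<^sup>2)) (at \<phi>)"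
    by (rule derivative_eq_intros refl c | simp)+
  moreover have "- 6 + 6 * inverse ((cos \<phi>)\<^sup>2) = 6 * (tan \<phi>)\<^sup>2"
    using one_plus_tan[OF c] by (simp add: inverse_eq_divide)
  ultimately show ?thesis by simp
qed

text \<open>Here the reciprocal area is concave, so \<open>tangent_inequality\<close> is applied to
  its negative. In terms of \<open>t = tan z\<close> and \<open>b = B z\<close>, the slope decreases
  if \<open>36 * t ^ 3 \<le> b * (3 + 9 * t\<^sup>2)\<close>, which follows from
  \<open>t \<le> 3 / 4\<close> and \<open>b \<ge> 3\<close>.\<close>

lemma hull_tangent:
  assumes "\<phi> \<in> {0..pi/6}" "\<phi>0 \<in> {0..pi/6}"
  shows "1 / hull_area \<phi> \<le> 1 / hull_area \<phi>0 + hull_slope \<phi>0 * (tan_sq \<phi> - tan_sq \<phi>0)"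
proof -
  define B where "B x = pi - 6 * x + 6 * tan x" for x :: real
  define f where "f x = - ((1 + tan_sq x) / B x)" for x
  have dB: "(B has_field_derivative 6 * (tan x)\<^sup>2) (at x)" if "x \<in> {0..pi/6}" for x
    unfolding B_def[abs_def] by (rule deriv_tan_linear[OF that])
  have B3: "B x \<ge> 3" if "x \<in> {0..pi/6}" for x unfolding B_def by (rule area_pos(1)[OF that])
  have slope: "hull_slope x = 1 / B x - 3 * tan x / (B x)\<^sup>2" for x by (simp add: hull_slope_def B_def)
  have "f \<phi>0 + - hull_slope \<phi>0 * (tan_sq \<phi> - tan_sq \<phi>0) \<le> f \<phi>"
  proof (rule tangent_inequality[where m = "\<lambda>x. - hull_slope x" and T' = "\<lambda>x. 2 * tan x / (cos x)\<^sup>2", OF _ deriv_tan_sq _ _ assms])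
    fix x assume x: "x \<in> {0..pi/6}"
    have c: "cos x \<noteq> 0" using angle_bounds(2)[OF x] by simp
    have Bp: "B x > 0" using B3[OF x] by simp
    have "(f has_field_derivative - ((2 * tan x / (cos x)\<^sup>2 * B x - (1 + tan_sq x) * (6 * (tan x)\<^sup>2)) / (B x * B x))) (at x)"
      unfolding f_def[abs_def] using Bp
      by (intro DERIV_minus DERIV_divide dB x) (auto intro!: derivative_eq_intros deriv_tan_sq x)
    also have "(1 + tan_sq x) = 1 / (cos x)\<^sup>2" unfolding tan_sq_def by (rule one_plus_tan[OF c])
    also have "- ((2 * tan x / (cos x)\<^sup>2 * B x - 1 / (cos x)\<^sup>2 * (6 * (tan x)\<^sup>2)) / (B x * B x)) = 2 * tan x / (cos x)\<^sup>2 * - hull_slope x"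
      unfolding slope using Bp c by (simp add: field_simps power2_eq_square)
    finally show "(f has_field_derivative 2 * tan x / (cos x)\<^sup>2 * - hull_slope x) (at x)" .
    show "0 \<le> 2 * tan x / (cos x)\<^sup>2" using angle_bounds(6)[OF x] by simp
  next
    fix x y :: real assume xy: "x \<in> {0..pi/6}" "y \<in> {0..pi/6}" "x \<le> y"
    have "hull_slope y \<le> hull_slope x"
    proof (rule DERIV_nonpos_imp_nonincreasing[OF xy(3)])
      fix z assume "x \<le> z" "z \<le> y"
      then have z: "z \<in> {0..pi/6}" using xy by auto
      note ab = angle_bounds[OF z]
      have c: "cos z \<noteq> 0" using ab(2) by simp
      define t b where "t = tan z" and "b = B z"
      have b: "b \<ge> 3" and t: "t \<ge> 0" "t \<le> 3 / 4" using B3[OF z] ab by (simp_all add: t_def b_def)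
      have inv: "inverse ((cos z)\<^sup>2) = 1 + (tan z)\<^sup>2" using one_plus_tan[OF c] by (simp add: inverse_eq_divide)
      have "(hull_slope has_field_derivative
         (0 * b - 1 * (6 * t\<^sup>2)) / (b * b) - (3 * (1 + t\<^sup>2) * b\<^sup>2 - 3 * t * (2 * b * (6 * t\<^sup>2))) / (b\<^sup>2 * b\<^sup>2)) (at z)"
        unfolding slope[abs_def] t_def b_def using b
        by (intro DERIV_diff DERIV_divide dB[OF z] DERIV_const)
          (auto intro!: derivative_eq_intros dB[OF z] simp: b_def c inv)
      moreover have "(0 * b - 1 * (6 * t\<^sup>2)) / (b * b) - (3 * (1 + t\<^sup>2) * b\<^sup>2 - 3 * t * (2 * b * (6 * t\<^sup>2))) / (b\<^sup>2 * b\<^sup>2)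
         = (36 * t ^ 3 - b * (3 + 9 * t\<^sup>2)) / b ^ 3"
        using b by (simp add: field_simps eval_nat_numeral)
      moreover have "(36 * t ^ 3 - b * (3 + 9 * t\<^sup>2)) / b ^ 3 \<le> 0"
      proof -
        have "36 * t ^ 3 = 36 * t\<^sup>2 * t" by (simp add: power2_eq_square power3_eq_cube)
        also have "\<dots> \<le> 36 * t\<^sup>2 * (3 / 4)" using t by (intro mult_left_mono) auto
        also have "\<dots> \<le> 3 * (3 + 9 * t\<^sup>2)" by simp
        also have "\<dots> \<le> b * (3 + 9 * t\<^sup>2)" using b by (intro mult_right_mono) auto
        finally show ?thesis using b by (intro divide_nonpos_nonneg) auto
      qed
      ultimately show "\<exists>d. (hull_slope has_field_derivative d) (at z) \<and> d \<le> 0" by metis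
    qed
    then show "- hull_slope x \<le> - hull_slope y" by simp
  qed
  moreover have "f x = - (1 / hull_area x)" if "x \<in> {0..pi/6}" for x
  proof -
    have c: "cos x \<noteq> 0" using angle_bounds(2)[OF that] by simp
    show ?thesis unfolding f_def hull_area_tan[OF c] tan_sq_def one_plus_tan[OF c] B_def by simp
  qed
  ultimately show ?thesis using assms by simp
qed

section \<open>The region, its convexity and its frontier\<close>

definition density_region :: "(real \<times> real) set" where
  "density_region = {density_point \<phi> a |\<phi> a. \<phi> \<in> {0..pi/6} \<and> hull_area \<phi> \<le> a \<and> a \<le> cut_disk_area \<phi>}"

definition cut_curve :: "(real \<times> real) set" where
  "cut_curve = (\<lambda>\<phi>. density_point \<phi> (cut_disk_area \<phi>)) ` {0..pi/6}"

definition hull_curve :: "(real \<times> real) set" where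
  "hull_curve = (\<lambda>\<phi>. density_point \<phi> (hull_area \<phi>)) ` {0..pi/6}"

text \<open>The quotient of the coordinates of a density point determines its angle, by
  \<open>4 / 3 * fst z / snd z = 1 / (cos \<phi>)\<^sup>2\<close>.\<close>

definition point_angle :: "real \<times> real \<Rightarrow> real" where
  "point_angle z = arctan (sqrt (4 / 3 * fst z / snd z - 1))"

lemma density_point_coords:
  assumes "\<phi> \<in> {0..pi/6}" "a > 0"
  shows "snd (density_point \<phi> a) > 0" "3 * sqrt 3 / 2 * snd (density_point \<phi> a) = a"
    "4 / 3 * fst (density_point \<phi> a) / snd (density_point \<phi> a) = 1 + tan_sq \<phi>"
    "4 / 3 * fst (density_point \<phi> a) = (1 + tan_sq \<phi>) * snd (density_point \<phi> a)"
    "point_angle (density_point \<phi> a) = \<phi>"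
proof -
  have c: "cos \<phi> \<noteq> 0" using angle_bounds(2)[OF assms(1)] by simp
  show 1: "snd (density_point \<phi> a) > 0" "3 * sqrt 3 / 2 * snd (density_point \<phi> a) = a"
    using assms by (simp_all add: density_point_def)
  show 2: "4 / 3 * fst (density_point \<phi> a) / snd (density_point \<phi> a) = 1 + tan_sq \<phi>"
    unfolding tan_sq_def one_plus_tan[OF c] using assms c by (simp add: density_point_def field_simps)
  then show "4 / 3 * fst (density_point \<phi> a) = (1 + tan_sq \<phi>) * snd (density_point \<phi> a)"
    using 1(1) by (simp add: field_simps)
  have "0 \<le> \<phi>" "\<phi> \<le> pi / 6" using assms by auto
  then have "arctan (tan \<phi>) = \<phi>" using pi_gt_zero by (intro arctan_tan) linarith+
  then show "point_angle (density_point \<phi> a) = \<phi>"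
    unfolding point_angle_def 2 using angle_bounds(6)[OF assms(1)] by (simp add: tan_sq_def)
qed

lemma density_point_inj:
  assumes "density_point \<phi> a = density_point \<phi>' a'" "\<phi> \<in> {0..pi/6}" "\<phi>' \<in> {0..pi/6}" "a > 0" "a' > 0"
  shows "\<phi> = \<phi>'" "a = a'"
  using density_point_coords(2,5)[OF assms(2,4)] density_point_coords(2,5)[OF assms(3,5)] assms(1) by metis+

text \<open>The bounds on \<open>fst z / snd z\<close> express that
  \<open>(tan \<phi>)\<^sup>2\<close> ranges from 0 to 1/3, its values at the angles 0 and
  \<open>pi / 6\<close>.\<close>

lemma point_angle_surj:
  assumes z: "snd z > 0" "3 / 4 * snd z \<le> fst z" "fst z \<le> snd z"
  shows "point_angle z \<in> {0..pi/6}" "density_point (point_angle z) (3 * sqrt 3 / 2 * snd z) = z"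
    "tan_sq (point_angle z) = 4 / 3 * fst z / snd z - 1"
proof -
  define T where "T = 4 / 3 * fst z / snd z - 1"
  have T: "0 \<le> T" "T \<le> 1 / 3" using z by (simp_all add: T_def field_simps)
  have pa: "point_angle z = arctan (sqrt T)" by (simp only: point_angle_def T_def)
  have "sqrt T \<le> sqrt (1 / 3)" using T by simp
  then have "arctan (sqrt T) \<le> arctan (1 / sqrt 3)" by (simp add: arctan_le_iff real_sqrt_divide)
  also have "arctan (1 / sqrt 3) = pi / 6"
    using arctan_tan[of "pi/6"] pi_gt_zero by (simp add: tan_30)
  finally show a: "point_angle z \<in> {0..pi/6}" using T by (simp add: pa)
  show t: "tan_sq (point_angle z) = 4 / 3 * fst z / snd z - 1"
    using T(1) unfolding tan_sq_def pa tan_arctan by (simp add: T_def)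
  have c: "cos (point_angle z) \<noteq> 0" using angle_bounds(2)[OF a] by simp
  have "1 / (cos (point_angle z))\<^sup>2 = 4 / 3 * fst z / snd z"
    using t one_plus_tan[OF c] by (simp add: tan_sq_def)
  then have c2: "(cos (point_angle z))\<^sup>2 * (4 / 3 * fst z) = snd z" using z c by (simp add: field_simps)
  show "density_point (point_angle z) (3 * sqrt 3 / 2 * snd z) = z"
    using c c2 z by (simp add: density_point_def prod_eq_iff field_simps)
qed

lemma density_region_iff:
  "z \<in> density_region \<longleftrightarrow> snd z > 0 \<and> 3 / 4 * snd z \<le> fst z \<and> fst z \<le> snd z \<and>
     hull_area (point_angle z) \<le> 3 * sqrt 3 / 2 * snd z \<and> 3 * sqrt 3 / 2 * snd z \<le> cut_disk_area (point_angle z)"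
proof
  assume "z \<in> density_region"
  then obtain \<phi> a where z: "z = density_point \<phi> a" "\<phi> \<in> {0..pi/6}" "hull_area \<phi> \<le> a" "a \<le> cut_disk_area \<phi>"
    by (auto simp: density_region_def)
  have a: "a > 0" using area_pos(2)[OF z(2)] z(3) by linarith
  note dc = density_point_coords[OF z(2) a]
  have "0 \<le> tan_sq \<phi>" "tan_sq \<phi> \<le> 1 / 3" using angle_bounds(7)[OF z(2)] by (simp_all add: tan_sq_def)
  then have "1 * snd z \<le> 4 / 3 * fst z" "4 / 3 * fst z \<le> (4 / 3) * snd z"
    unfolding z(1) dc(4) using dc(1) by (intro mult_right_mono; simp)+
  then show "snd z > 0 \<and> 3 / 4 * snd z \<le> fst z \<and> fst z \<le> snd z \<and>
     hull_area (point_angle z) \<le> 3 * sqrt 3 / 2 * snd z \<and> 3 * sqrt 3 / 2 * snd z \<le> cut_disk_area (point_angle z)"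
    using dc(1,2,5) z(3,4) unfolding z(1) by simp
next
  assume *: "snd z > 0 \<and> 3 / 4 * snd z \<le> fst z \<and> fst z \<le> snd z \<and>
     hull_area (point_angle z) \<le> 3 * sqrt 3 / 2 * snd z \<and> 3 * sqrt 3 / 2 * snd z \<le> cut_disk_area (point_angle z)"
  then have "point_angle z \<in> {0..pi/6}" "density_point (point_angle z) (3 * sqrt 3 / 2 * snd z) = z"
    using point_angle_surj by auto
  then show "z \<in> density_region" unfolding density_region_def using * by (intro CollectI exI[of _ "point_angle z"] exI[of _ "3 * sqrt 3 / 2 * snd z"]) simp
qed

text \<open>In the projective coordinates \<open>(tan_sq \<phi>, 1 / a)\<close> the two boundary curves are the graphs of a
  convex and of a concave function, whose tangent inequalities become linear in \<open>(x, y)\<close>.\<close>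
lemma convex_density_region: "convex density_region"
proof -
  let ?k = "3 * sqrt 3 / 2"
  define HK where "HK \<phi> = {z :: real \<times> real. ((4 / 3 * cut_slope \<phi>) , 1 / cut_disk_area \<phi> - cut_slope \<phi> * (1 + tan_sq \<phi>)) \<bullet> z \<le> 1 / ?k}" for \<phi>
  define HL where "HL \<phi> = {z :: real \<times> real. ((4 / 3 * hull_slope \<phi>) , 1 / hull_area \<phi> - hull_slope \<phi> * (1 + tan_sq \<phi>)) \<bullet> z \<ge> 1 / ?k}" for \<phi>
  define C where "C = {z :: real \<times> real. (0, 1) \<bullet> z > 0} \<inter> {z. (1, - (3/4)) \<bullet> z \<ge> 0} \<inter> {z. (1, - 1) \<bullet> z \<le> 0}
     \<inter> (\<Inter>\<phi>\<in>{0..pi/6}. HK \<phi>) \<inter> (\<Inter>\<phi>\<in>{0..pi/6}. HL \<phi>)"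
  \<comment> \<open>\<open>T\<close> is the value of \<open>tan_sq\<close> on the ray of
    \<open>z\<close>. The half-plane inequality, homogenized by the factor \<open>snd z\<close>, is
    the tangent inequality at \<open>T\<close>.\<close>
  have HK: "z \<in> HK \<phi> \<longleftrightarrow> 1 / cut_disk_area \<phi> + cut_slope \<phi> * (T - tan_sq \<phi>) \<le> 1 / (?k * snd z)"
    if "snd z > 0" "4 / 3 * fst z = (1 + T) * snd z" for z \<phi> T
  proof -
    have "4 / 3 * cut_slope \<phi> * fst z = cut_slope \<phi> * ((1 + T) * snd z)" unfolding that(2)[symmetric] by simp
    then have "((4 / 3 * cut_slope \<phi>) , 1 / cut_disk_area \<phi> - cut_slope \<phi> * (1 + tan_sq \<phi>)) \<bullet> z
       = snd z * (1 / cut_disk_area \<phi> + cut_slope \<phi> * (T - tan_sq \<phi>))"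
      by (simp add: inner_prod_def algebra_simps)
    moreover have "1 / ?k = snd z * (1 / (?k * snd z))" using that(1) by simp
    ultimately show ?thesis unfolding HK_def mem_Collect_eq using that(1) by (metis mult_le_cancel_left_pos)
  qed
  have HL: "z \<in> HL \<phi> \<longleftrightarrow> 1 / hull_area \<phi> + hull_slope \<phi> * (T - tan_sq \<phi>) \<ge> 1 / (?k * snd z)"
    if "snd z > 0" "4 / 3 * fst z = (1 + T) * snd z" for z \<phi> T
  proof -
    have "4 / 3 * hull_slope \<phi> * fst z = hull_slope \<phi> * ((1 + T) * snd z)" unfolding that(2)[symmetric] by simp
    then have "((4 / 3 * hull_slope \<phi>) , 1 / hull_area \<phi> - hull_slope \<phi> * (1 + tan_sq \<phi>)) \<bullet> z
       = snd z * (1 / hull_area \<phi> + hull_slope \<phi> * (T - tan_sq \<phi>))"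
      by (simp add: inner_prod_def algebra_simps)
    moreover have "1 / ?k = snd z * (1 / (?k * snd z))" using that(1) by simp
    ultimately show ?thesis unfolding HL_def mem_Collect_eq using that(1) by (metis mult_le_cancel_left_pos)
  qed
  have "density_region = C"
  proof (intro equalityI subsetI)
    fix z assume z: "z \<in> density_region"
    then have s: "snd z > 0" "3 / 4 * snd z \<le> fst z" "fst z \<le> snd z"
      and a: "hull_area (point_angle z) \<le> ?k * snd z" "?k * snd z \<le> cut_disk_area (point_angle z)"
      by (simp_all add: density_region_iff)
    let ?\<phi> = "point_angle z"
    have phi: "?\<phi> \<in> {0..pi/6}" and t: "4 / 3 * fst z = (1 + tan_sq ?\<phi>) * snd z"
      using point_angle_surj[OF s] s(1) by simp_all
    have kz: "?k * snd z > 0" using s(1) by simp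
    have 1: "1 / cut_disk_area ?\<phi> \<le> 1 / (?k * snd z)" by (rule frac_le[OF _ _ kz a(2)]) simp_all
    have 2: "1 / (?k * snd z) \<le> 1 / hull_area ?\<phi>" by (rule frac_le[OF _ _ area_pos(2)[OF phi] a(1)]) simp_all
    have "z \<in> HK \<phi>0" if "\<phi>0 \<in> {0..pi/6}" for \<phi>0
      unfolding HK[OF s(1) t] using cut_tangent[OF phi that] 1 by linarith
    moreover have "z \<in> HL \<phi>0" if "\<phi>0 \<in> {0..pi/6}" for \<phi>0
      unfolding HL[OF s(1) t] using hull_tangent[OF phi that] 2 by linarith
    ultimately show "z \<in> C" using s by (simp add: C_def inner_prod_def)
  next
    fix z assume z: "z \<in> C"
    then have s: "snd z > 0" "3 / 4 * snd z \<le> fst z" "fst z \<le> snd z" by (simp_all add: C_def inner_prod_def)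
    let ?\<phi> = "point_angle z"
    have phi: "?\<phi> \<in> {0..pi/6}" and t: "4 / 3 * fst z = (1 + tan_sq ?\<phi>) * snd z"
      using point_angle_surj[OF s] s(1) by simp_all
    have "z \<in> HK ?\<phi>" "z \<in> HL ?\<phi>" using z phi unfolding C_def by blast+
    then have "1 / cut_disk_area ?\<phi> \<le> 1 / (?k * snd z)" "1 / (?k * snd z) \<le> 1 / hull_area ?\<phi>"
      unfolding HK[OF s(1) t] HL[OF s(1) t] by simp_all
    moreover have "?k * snd z > 0" using s(1) by simp
    ultimately have "hull_area ?\<phi> \<le> ?k * snd z" "?k * snd z \<le> cut_disk_area ?\<phi>"
      using area_pos(2,4)[OF phi] by (simp_all add: divide_le_cancel frac_le_eq field_simps)
    then show "z \<in> density_region" using s by (simp add: density_region_iff)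
  qed
  moreover have "convex C" unfolding C_def HK_def HL_def
    by (intro convex_Int convex_INT convex_halfspace_gt convex_halfspace_ge convex_halfspace_le)
  ultimately show ?thesis by simp
qed

lemma continuous_on_density_point:
  fixes f g :: "'a::t2_space \<Rightarrow> real"
  assumes "continuous_on S f" "continuous_on S g" "\<And>x. x \<in> S \<Longrightarrow> f x \<in> {0..pi/6}"
  shows "continuous_on S (\<lambda>x. density_point (f x) (g x))"
proof -
  have "cos (f x) \<noteq> 0" if "x \<in> S" for x using angle_bounds(2)[OF assms(3)[OF that]] by simp
  then show ?thesis unfolding density_point_def by (intro continuous_intros assms(1,2)) auto
qed

lemma continuous_on_areas:
  fixes f :: "'a::t2_space \<Rightarrow> real"
  assumes "continuous_on S f"
  shows "continuous_on S (\<lambda>x. hull_area (f x))" "continuous_on S (\<lambda>x. cut_disk_area (f x))"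
  unfolding hull_area_def cut_disk_area_def by (intro continuous_intros assms)+

lemma compact_density_region: "compact density_region"
proof -
  let ?f = "\<lambda>(\<phi>, l). density_point \<phi> ((1 - l) * hull_area \<phi> + l * cut_disk_area \<phi>)"
  have "density_region = ?f ` ({0..pi/6} \<times> {0..1})"
  proof (intro equalityI subsetI)
    fix z assume "z \<in> density_region"
    then obtain \<phi> a where z: "z = density_point \<phi> a" "\<phi> \<in> {0..pi/6}" "hull_area \<phi> \<le> a" "a \<le> cut_disk_area \<phi>"
      by (auto simp: density_region_def)
    have "a \<in> closed_segment (hull_area \<phi>) (cut_disk_area \<phi>)" using z by (simp add: closed_segment_eq_real_ivl)
    then obtain l where "0 \<le> l" "l \<le> 1" "a = (1 - l) * hull_area \<phi> + l * cut_disk_area \<phi>"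
      by (auto simp: closed_segment_def)
    then show "z \<in> ?f ` ({0..pi/6} \<times> {0..1})" using z by (intro image_eqI[of _ _ "(\<phi>, l)"]) auto
  next
    fix z assume "z \<in> ?f ` ({0..pi/6} \<times> {0..1})"
    then obtain \<phi> l where z: "\<phi> \<in> {0..pi/6}" "0 \<le> l" "l \<le> 1" "z = density_point \<phi> ((1 - l) * hull_area \<phi> + l * cut_disk_area \<phi>)"
      by auto
    have "(1 - l) * hull_area \<phi> + l * cut_disk_area \<phi> \<in> closed_segment (hull_area \<phi>) (cut_disk_area \<phi>)"
      using z by (auto simp: closed_segment_def)
    then show "z \<in> density_region" using z area_pos(3)[OF z(1)]
      unfolding density_region_def closed_segment_eq_real_ivl by (auto split: if_splits)
  qed
  moreover have "compact (?f ` ({0..pi/6} \<times> {0..1}))"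
  proof (rule compact_continuous_image)
    show "continuous_on ({0..pi/6} \<times> {0..1}) ?f"
      unfolding case_prod_beta
      by (intro continuous_on_density_point continuous_on_areas continuous_intros) auto
  qed (intro compact_Times compact_Icc)
  ultimately show ?thesis by simp
qed

lemma curves_subset: "cut_curve \<subseteq> density_region" "hull_curve \<subseteq> density_region"
  unfolding cut_curve_def hull_curve_def density_region_def using area_pos(3) by fastforce+

text \<open>All inequalities of \<open>density_region_iff\<close> made strict. This set is open, so
  it lies in the interior of the region.\<close>

definition open_density_region :: "(real \<times> real) set" where
  "open_density_region = {z. snd z > 0 \<and> 3 / 4 * snd z < fst z \<and> fst z < snd z \<and>
     hull_area (point_angle z) < 3 * sqrt 3 / 2 * snd z \<and> 3 * sqrt 3 / 2 * snd z < cut_disk_area (point_angle z)}"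

lemma open_open_density_region: "open open_density_region"
proof -
  define W where "W = {z :: real \<times> real. snd z > 0 \<and> 3 / 4 * snd z < fst z \<and> fst z < snd z}"
  have oW: "open W" unfolding W_def by (intro open_Collect_conj open_Collect_less continuous_intros)
  have "continuous_on W point_angle" unfolding point_angle_def W_def by (intro continuous_intros) auto
  note ca = continuous_on_areas[OF this]
  have 1: "open (W \<inter> (\<lambda>z. 3 * sqrt 3 / 2 * snd z - hull_area (point_angle z)) -` {0<..})"
    by (intro continuous_open_preimage[OF _ oW] continuous_intros ca) simp
  have 2: "open (W \<inter> (\<lambda>z. cut_disk_area (point_angle z) - 3 * sqrt 3 / 2 * snd z) -` {0<..})"
    by (intro continuous_open_preimage[OF _ oW] continuous_intros ca) simp
  have 3: "open_density_region = (W \<inter> (\<lambda>z. 3 * sqrt 3 / 2 * snd z - hull_area (point_angle z)) -` {0<..})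
      \<inter> (W \<inter> (\<lambda>z. cut_disk_area (point_angle z) - 3 * sqrt 3 / 2 * snd z) -` {0<..})"
    by (auto simp: open_density_region_def W_def)
  show ?thesis unfolding 3 by (rule open_Int[OF 1 2])
qed

lemma interior_scale:
  fixes z :: "'a::real_normed_vector"
  assumes "z \<in> interior S"
  shows "\<exists>s>1. s *\<^sub>R z \<in> S" "\<exists>s>0. s < 1 \<and> s *\<^sub>R z \<in> S"
proof -
  have "((\<lambda>s. s *\<^sub>R z) \<longlongrightarrow> 1 *\<^sub>R z) (at 1)" by (intro tendsto_intros)
  then have "eventually (\<lambda>s. s *\<^sub>R z \<in> interior S) (at 1)" using assms by (intro topological_tendstoD) auto
  then obtain d where d: "d > 0" "\<And>s. s \<noteq> 1 \<Longrightarrow> dist s 1 < d \<Longrightarrow> s *\<^sub>R z \<in> interior S"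
    by (auto simp: eventually_at)
  define e where "e = min d 1 / 2"
  have e: "0 < e" "e < 1" "e < d" using d(1) by (auto simp: e_def min_def)
  have "(1 + e) *\<^sub>R z \<in> interior S" "(1 - e) *\<^sub>R z \<in> interior S"
    by (rule d(2); use e in \<open>simp add: dist_real_def\<close>)+
  then have "(1 + e) *\<^sub>R z \<in> S" "(1 - e) *\<^sub>R z \<in> S" using interior_subset by blast+
  moreover have "1 + e > 1" "1 - e > 0" "1 - e < 1" using e by simp_all
  ultimately show "\<exists>s>1. s *\<^sub>R z \<in> S" "\<exists>s>0. s < 1 \<and> s *\<^sub>R z \<in> S" by blast+
qed

lemma density_point_scale: "s *\<^sub>R density_point \<phi> a = density_point \<phi> (s * a)"
  by (simp add: density_point_def)

text \<open>Off the two curves the area is strictly between its bounds; since these agree at the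
  ends, the angle is then strictly between 0 and \<open>pi / 6\<close> and the point is interior.
  Conversely, scaling preserves the angle and multiplies the area, so points of the cut curve leave
  the region when enlarged and points of the hull curve when shrunk.\<close>

lemma frontier_density_region: "frontier density_region = cut_curve \<union> hull_curve"
proof -
  have cl: "closed density_region" using compact_density_region by (rule compact_imp_closed)
  have sub: "open_density_region \<subseteq> density_region"
    by (auto simp: open_density_region_def density_region_iff)
  then have "open_density_region \<subseteq> interior density_region"
    using open_open_density_region by (rule interior_maximal)
  moreover have "density_region - open_density_region \<subseteq> cut_curve \<union> hull_curve"
  proof
    fix z assume z: "z \<in> density_region - open_density_region"
    then obtain \<phi> a where za: "z = density_point \<phi> a" "\<phi> \<in> {0..pi/6}" "hull_area \<phi> \<le> a" "a \<le> cut_disk_area \<phi>"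
      by (auto simp: density_region_def)
    have a: "a > 0" using area_pos(2)[OF za(2)] za(3) by linarith
    note dc = density_point_coords[OF za(2) a]
    have "a = hull_area \<phi> \<or> a = cut_disk_area \<phi>"
    proof (rule ccontr)
      assume ne: "\<not> (a = hull_area \<phi> \<or> a = cut_disk_area \<phi>)"
      then have lt: "hull_area \<phi> < a" "a < cut_disk_area \<phi>" using za by auto
      have "0 < (sin \<phi>)\<^sup>2 * (pi - 6 * \<phi>)" using cut_minus_hull[of \<phi>] lt by linarith
      then have "(sin \<phi>)\<^sup>2 \<noteq> 0" "pi - 6 * \<phi> \<noteq> 0" by (metis less_irrefl mult_zero_left, metis less_irrefl mult_zero_right)
      then have "sin \<phi> \<noteq> 0" "\<phi> \<noteq> pi / 6" by simp_all
      then have "\<phi> \<noteq> 0" "\<phi> < pi / 6" using za(2) by auto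
      have "tan \<phi> < tan (pi / 6)" using \<open>\<phi> < pi / 6\<close> za(2) pi_gt_zero by (intro tan_monotone) auto
      then have "(tan \<phi>)\<^sup>2 < (tan (pi / 6))\<^sup>2" using angle_bounds(6)[OF za(2)] by (intro power_strict_mono) auto
      then have t1: "tan_sq \<phi> < 1 / 3" by (simp add: tan_sq_def tan_30 power_divide)
      have "sin \<phi> > 0" using \<open>sin \<phi> \<noteq> 0\<close> angle_bounds(3)[OF za(2)] by simp
      then have t0: "tan_sq \<phi> > 0" using angle_bounds(2)[OF za(2)] by (simp add: tan_sq_def tan_def)
      have "1 * snd z < 4 / 3 * fst z" "4 / 3 * fst z < (4 / 3) * snd z"
        unfolding za(1) dc(4) using dc(1) t0 t1 by (intro mult_strict_right_mono; simp)+
      then have "z \<in> open_density_region"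
        using dc(1,2,5) lt unfolding open_density_region_def za(1) by simp
      then show False using z by blast
    qed
    then show "z \<in> cut_curve \<union> hull_curve" using za by (auto simp: cut_curve_def hull_curve_def)
  qed
  moreover have "z \<notin> interior density_region" if z: "z \<in> cut_curve \<union> hull_curve" for z
  proof
    assume int: "z \<in> interior density_region"
    from z show False
    proof
      assume "z \<in> cut_curve"
      then obtain \<phi> where p: "\<phi> \<in> {0..pi/6}" "z = density_point \<phi> (cut_disk_area \<phi>)" by (auto simp: cut_curve_def)
      obtain s where s: "s > 1" "s *\<^sub>R z \<in> density_region" using interior_scale(1)[OF int] by blast
      then obtain \<phi>' a where q: "density_point \<phi> (s * cut_disk_area \<phi>) = density_point \<phi>' a" "\<phi>' \<in> {0..pi/6}" "hull_area \<phi>' \<le> a" "a \<le> cut_disk_area \<phi>'"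
        unfolding p(2) density_point_scale by (auto simp: density_region_def)
      have "a > 0" using area_pos(2)[OF q(2)] q(3) by linarith
      moreover have "s * cut_disk_area \<phi> > 0" using s area_pos(4)[OF p(1)] by simp
      ultimately have "\<phi> = \<phi>'" "s * cut_disk_area \<phi> = a" using density_point_inj[OF q(1) p(1) q(2)] by auto
      then have "s * cut_disk_area \<phi> \<le> 1 * cut_disk_area \<phi>" using q(4) by simp
      then show False using s area_pos(4)[OF p(1)] by simp
    next
      assume "z \<in> hull_curve"
      then obtain \<phi> where p: "\<phi> \<in> {0..pi/6}" "z = density_point \<phi> (hull_area \<phi>)" by (auto simp: hull_curve_def)
      obtain s where s: "s > 0" "s < 1" "s *\<^sub>R z \<in> density_region" using interior_scale(2)[OF int] by blast
      then obtain \<phi>' a where q: "density_point \<phi> (s * hull_area \<phi>) = density_point \<phi>' a" "\<phi>' \<in> {0..pi/6}" "hull_area \<phi>' \<le> a" "a \<le> cut_disk_area \<phi>'"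
        unfolding p(2) density_point_scale by (auto simp: density_region_def)
      have "a > 0" using area_pos(2)[OF q(2)] q(3) by linarith
      moreover have "s * hull_area \<phi> > 0" using s area_pos(2)[OF p(1)] by simp
      ultimately have "\<phi> = \<phi>'" "s * hull_area \<phi> = a" using density_point_inj[OF q(1) p(1) q(2)] by auto
      then have "1 * hull_area \<phi> \<le> s * hull_area \<phi>" using q(3) by simp
      then show False using s area_pos(2)[OF p(1)] by simp
    qed
  qed
  ultimately have "density_region - interior density_region = cut_curve \<union> hull_curve"
    using curves_subset by blast
  then show ?thesis using cl by (simp add: frontier_def)
qed

lemma interior_density_region_nonempty: "interior density_region \<noteq> {}"
proof
  assume "interior density_region = {}"
  then have eq: "density_region = cut_curve \<union> hull_curve"
    using frontier_density_region compact_imp_closed[OF compact_density_region] by (simp add: frontier_def)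
  let ?\<phi> = "pi / 12"
  have p: "?\<phi> \<in> {0..pi/6}" by simp
  have lt: "hull_area ?\<phi> < cut_disk_area ?\<phi>" by (rule hull_area_less[OF p]) auto
  let ?a = "(hull_area ?\<phi> + cut_disk_area ?\<phi>) / 2"
  have a0: "?a > 0" using area_pos(2,4)[OF p] by simp
  have "density_point ?\<phi> ?a \<in> density_region"
    unfolding density_region_def using p lt by (intro CollectI exI[of _ ?\<phi>] exI[of _ ?a]) auto
  then obtain \<phi>' where "\<phi>' \<in> {0..pi/6}" "density_point ?\<phi> ?a = density_point \<phi>' (cut_disk_area \<phi>') \<or> density_point ?\<phi> ?a = density_point \<phi>' (hull_area \<phi>')"
    unfolding eq cut_curve_def hull_curve_def by auto
  then have "?a = cut_disk_area ?\<phi> \<or> ?a = hull_area ?\<phi>"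
    using density_point_inj[of ?\<phi> ?a \<phi>'] p a0 area_pos(2,4)[of \<phi>'] by metis
  then show False using lt by auto
qed

section \<open>The boundary curves as arcs\<close>

definition curve_path :: "(real \<Rightarrow> real) \<Rightarrow> real \<Rightarrow> real \<times> real" where
  "curve_path f s = density_point ((1 - s) * (pi / 6)) (f ((1 - s) * (pi / 6)))"

text \<open>The angle runs down from \<open>pi / 6\<close> to 0, so that the path starts at the
  point \<open>(1, 1)\<close>. It is injective because a density point determines its angle.\<close>

lemma curve_path_arc:
  assumes cont: "continuous_on {0..1} (\<lambda>s. f ((1 - s) * (pi / 6)))" and pos: "\<And>\<phi>. \<phi> \<in> {0..pi/6} \<Longrightarrow> f \<phi> > 0"
  shows "arc (curve_path f)" "path_image (curve_path f) = (\<lambda>\<phi>. density_point \<phi> (f \<phi>)) ` {0..pi/6}"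
    "pathstart (curve_path f) = density_point (pi / 6) (f (pi / 6))" "pathfinish (curve_path f) = density_point 0 (f 0)"
proof -
  have r: "(1 - s) * (pi / 6) \<in> {0..pi/6}" if "s \<in> {0..1}" for s :: real
    using that by (auto intro: mult_left_le_one_le)
  have "path (curve_path f)" unfolding path_def curve_path_def[abs_def]
    by (intro continuous_on_density_point cont r continuous_intros)
  moreover have "inj_on (curve_path f) {0..1}"
  proof (rule inj_onI)
    fix s t :: real assume st: "s \<in> {0..1}" "t \<in> {0..1}" "curve_path f s = curve_path f t"
    then have "(1 - s) * (pi / 6) = (1 - t) * (pi / 6)"
      unfolding curve_path_def using density_point_inj(1) r pos by blast
    then show "s = t" by simp
  qed
  ultimately show "arc (curve_path f)" by (simp add: arc_def)
  have "(\<lambda>s. (1 - s) * (pi / 6)) ` {0..1} = {0..pi/6}"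
  proof (intro equalityI subsetI)
    fix \<phi> assume p: "\<phi> \<in> {0..pi/6}"
    then have "1 - \<phi> / (pi / 6) \<in> {0..1}" by (auto simp: field_simps)
    moreover have "\<phi> = (1 - (1 - \<phi> / (pi / 6))) * (pi / 6)" by simp
    ultimately show "\<phi> \<in> (\<lambda>s. (1 - s) * (pi / 6)) ` {0..1}" by (rule rev_image_eqI)
  qed (use r in blast)
  then have "(\<lambda>\<phi>. density_point \<phi> (f \<phi>)) ` ((\<lambda>s. (1 - s) * (pi / 6)) ` {0..1}) = (\<lambda>\<phi>. density_point \<phi> (f \<phi>)) ` {0..pi/6}"
    by simp
  then show "path_image (curve_path f) = (\<lambda>\<phi>. density_point \<phi> (f \<phi>)) ` {0..pi/6}"
    by (simp add: path_image_def curve_path_def[abs_def] image_comp o_def)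
  show "pathstart (curve_path f) = density_point (pi / 6) (f (pi / 6))" "pathfinish (curve_path f) = density_point 0 (f 0)"
    by (simp_all add: pathstart_def pathfinish_def curve_path_def)
qed

text \<open>At \<open>pi / 6\<close> the bodies on both curves are regular hexagons, which tile; at
  0 they are disks.\<close>

lemma curve_ends:
  "density_point (pi / 6) (cut_disk_area (pi / 6)) = (1, 1)" "density_point (pi / 6) (hull_area (pi / 6)) = (1, 1)"
  "density_point 0 (cut_disk_area 0) = (pi / sqrt 12, 2 * pi / sqrt 27)" "density_point 0 (hull_area 0) = (pi / sqrt 12, 2 * pi / sqrt 27)"
proof -
  have s: "sqrt 12 = 2 * sqrt 3" "sqrt 27 = 3 * sqrt 3"
    using real_sqrt_mult[of 4 3] real_sqrt_mult[of 9 3] by simp_all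
  show "density_point (pi / 6) (cut_disk_area (pi / 6)) = (1, 1)" "density_point (pi / 6) (hull_area (pi / 6)) = (1, 1)"
    by (simp_all add: density_point_def cut_disk_area_def hull_area_def sin_30 cos_30 power_divide)
  show "density_point 0 (cut_disk_area 0) = (pi / sqrt 12, 2 * pi / sqrt 27)" "density_point 0 (hull_area 0) = (pi / sqrt 12, 2 * pi / sqrt 27)"
    unfolding s by (simp_all add: density_point_def cut_disk_area_def hull_area_def)
qed

text \<open>A common point of the two curves has the same angle and the same area on both, which by
  \<open>hull_area_less\<close> occurs only at the two ends.\<close>

lemma curves_arcs:
  "arc_joining cut_curve (1, 1) (pi / sqrt 12, 2 * pi / sqrt 27)"
  "arc_joining hull_curve (1, 1) (pi / sqrt 12, 2 * pi / sqrt 27)"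
  "simple_closed_curve (cut_curve \<union> hull_curve)"
proof -
  let ?g = "curve_path cut_disk_area" and ?h = "curve_path hull_area"
  have c: "continuous_on {0..1} (\<lambda>s. cut_disk_area ((1 - s) * (pi / 6)))" "continuous_on {0..1} (\<lambda>s. hull_area ((1 - s) * (pi / 6)))"
    by (intro continuous_on_areas continuous_intros)+
  have g: "arc ?g" "path_image ?g = cut_curve" "pathstart ?g = (1, 1)" "pathfinish ?g = (pi / sqrt 12, 2 * pi / sqrt 27)"
    unfolding cut_curve_def curve_ends(1,3)[symmetric] by (rule curve_path_arc[OF c(1) area_pos(4)]; assumption)+
  have h: "arc ?h" "path_image ?h = hull_curve" "pathstart ?h = (1, 1)" "pathfinish ?h = (pi / sqrt 12, 2 * pi / sqrt 27)"
    unfolding hull_curve_def curve_ends(2,4)[symmetric] by (rule curve_path_arc[OF c(2) area_pos(2)]; assumption)+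
  show "arc_joining cut_curve (1, 1) (pi / sqrt 12, 2 * pi / sqrt 27)"
    unfolding arc_joining_def using g by blast
  show "arc_joining hull_curve (1, 1) (pi / sqrt 12, 2 * pi / sqrt 27)"
    unfolding arc_joining_def using h by blast
  have "path_image ?g \<inter> path_image (reversepath ?h) \<subseteq> {pathstart ?g, pathstart (reversepath ?h)}"
  proof
    fix z assume "z \<in> path_image ?g \<inter> path_image (reversepath ?h)"
    then have "z \<in> cut_curve" "z \<in> hull_curve" by (simp_all add: g(2) h(2))
    then obtain \<phi> \<phi>' where p: "\<phi> \<in> {0..pi/6}" "\<phi>' \<in> {0..pi/6}" "z = density_point \<phi> (cut_disk_area \<phi>)" "z = density_point \<phi>' (hull_area \<phi>')"
      unfolding cut_curve_def hull_curve_def by (elim imageE)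
    have "\<phi> = \<phi>'" "cut_disk_area \<phi> = hull_area \<phi>'"
      using density_point_inj[of \<phi> "cut_disk_area \<phi>" \<phi>' "hull_area \<phi>'"] p area_pos(4)[OF p(1)] area_pos(2)[OF p(2)] by simp_all
    then have "\<phi> = 0 \<or> \<phi> = pi / 6" using hull_area_less[OF p(1)] by fastforce
    then show "z \<in> {pathstart ?g, pathstart (reversepath ?h)}"
    proof
      assume "\<phi> = 0"
      then have "z = (pi / sqrt 12, 2 * pi / sqrt 27)" using p(3) curve_ends(3) by (simp only:)
      then show ?thesis by (simp add: h)
    next
      assume "\<phi> = pi / 6"
      then have "z = (1, 1)" using p(3) curve_ends(1) by (simp only:)
      then show ?thesis by (simp add: g)
    qed
  qed
  then have "simple_path (?g +++ reversepath ?h)"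
    using g h by (intro simple_path_join_loop) (auto simp: arc_reversepath)
  moreover have "path_image (?g +++ reversepath ?h) = cut_curve \<union> hull_curve"
    using g h by (simp add: path_image_join)
  moreover have "pathfinish (?g +++ reversepath ?h) = pathstart (?g +++ reversepath ?h)" using g h by simp
  ultimately show "simple_closed_curve (cut_curve \<union> hull_curve)" unfolding simple_closed_curve_def by blast
qed

text \<open>The parameter \<open>u = 2 * sin \<phi>\<close> is the length of the chord that a side
  of the hexagon cuts out of the unit disk.\<close>

lemma half_chord_angles: "(\<lambda>u. arcsin (u / 2)) ` {0..1} = {0..pi/6}"
proof (intro equalityI subsetI)
  fix \<phi> assume "\<phi> \<in> (\<lambda>u. arcsin (u / 2)) ` {0..1}"
  then obtain u where u: "0 \<le> u" "u \<le> 1" "\<phi> = arcsin (u / 2)" by auto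
  have "arcsin 0 \<le> arcsin (u / 2)" "arcsin (u / 2) \<le> arcsin (1 / 2)" using u by (intro arcsin_le_arcsin; simp)+
  moreover have "arcsin (1 / 2) = pi / 6" using arcsin_sin[of "pi / 6"] by (simp add: sin_30)
  ultimately show "\<phi> \<in> {0..pi/6}" using u by simp
next
  fix \<phi> assume p: "\<phi> \<in> {0..pi/6}"
  have "arcsin (sin \<phi>) = \<phi>" using p pi_gt_zero by (intro arcsin_sin) auto
  then show "\<phi> \<in> (\<lambda>u. arcsin (u / 2)) ` {0..1}" using angle_bounds(3,4)[OF p] by (intro image_eqI[of _ _ "2 * sin \<phi>"]) auto
qed

lemma half_chord:
  assumes "u \<in> {0..1}"
  shows "u = 2 * sin (arcsin (u / 2))" "sqrt (4 - u\<^sup>2) = 2 * cos (arcsin (u / 2))" "arcsin (u / 2) \<in> {0..pi/6}"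
    "4 - u\<^sup>2 = 4 * (cos (arcsin (u / 2)))\<^sup>2"
proof -
  show p: "arcsin (u / 2) \<in> {0..pi/6}" using assms half_chord_angles by blast
  show u: "u = 2 * sin (arcsin (u / 2))" using assms by (subst sin_arcsin) auto
  show "4 - u\<^sup>2 = 4 * (cos (arcsin (u / 2)))\<^sup>2"
    by (subst u) (simp add: power_mult_distrib cos_squared_eq)
  then have "4 - u\<^sup>2 = (2 * cos (arcsin (u / 2)))\<^sup>2" by (simp only: power_mult_distrib) simp
  then have "sqrt (4 - u\<^sup>2) = \<bar>2 * cos (arcsin (u / 2))\<bar>" by (simp only: real_sqrt_abs)
  then show "sqrt (4 - u\<^sup>2) = 2 * cos (arcsin (u / 2))" using angle_bounds(2)[OF p] by simp
qed

lemma cut_curve_parametric: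
  "cut_curve = (\<lambda>u. ((2 * pi - 12 * arcsin (u / 2) + 3 * u * sqrt (4 - u\<^sup>2)) / (sqrt 3 * (4 - u\<^sup>2)),
                (2 * pi - 12 * arcsin (u / 2) + 3 * u * sqrt (4 - u\<^sup>2)) / (3 * sqrt 3))) ` {0..1}"
  unfolding cut_curve_def half_chord_angles[symmetric] image_image
proof (rule image_cong[OF refl])
  fix u :: real assume u: "u \<in> {0..1}"
  define \<phi> where "\<phi> = arcsin (u / 2)"
  note hc = half_chord[OF u, folded \<phi>_def]
  have n: "2 * pi - 12 * \<phi> + 3 * u * sqrt (4 - u\<^sup>2) = 2 * cut_disk_area \<phi>"
    unfolding hc(2) by (subst hc(1)) (simp add: cut_disk_area_def)
  note d = hc(4)
  show "density_point (arcsin (u / 2)) (cut_disk_area (arcsin (u / 2))) = ((2 * pi - 12 * arcsin (u / 2) + 3 * u * sqrt (4 - u\<^sup>2)) / (sqrt 3 * (4 - u\<^sup>2)),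
                (2 * pi - 12 * arcsin (u / 2) + 3 * u * sqrt (4 - u\<^sup>2)) / (3 * sqrt 3))"
    unfolding \<phi>_def[symmetric] n unfolding d density_point_def by simp
qed

lemma hull_curve_parametric:
  "hull_curve = (\<lambda>v. (sqrt 3 * (pi / 6 - arcsin (v / 2) + v / sqrt (4 - v\<^sup>2)),
                sqrt 3 / 3 * ((4 - v\<^sup>2) * (pi / 6 - arcsin (v / 2)) + v * sqrt (4 - v\<^sup>2)))) ` {0..1}"
  unfolding hull_curve_def half_chord_angles[symmetric] image_image
proof (rule image_cong[OF refl])
  fix v :: real assume v: "v \<in> {0..1}"
  define \<phi> where "\<phi> = arcsin (v / 2)"
  note hc = half_chord[OF v, folded \<phi>_def]
  have c: "cos \<phi> > 0" by (rule angle_bounds(2)[OF hc(3)])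
  note d = hc(4)
  have s3: "sqrt 3 * (sqrt 3 * z) = 3 * z" for z :: real by (simp add: mult.assoc[symmetric])
  have x: "hull_area \<phi> / (2 * sqrt 3 * (cos \<phi>)\<^sup>2) = sqrt 3 * (pi / 6 - \<phi> + v / sqrt (4 - v\<^sup>2))"
  proof -
    have "v / sqrt (4 - v\<^sup>2) = tan \<phi>" unfolding hc(2) by (subst hc(1)) (simp add: tan_def)
    moreover have "hull_area \<phi> / (2 * sqrt 3 * (cos \<phi>)\<^sup>2) = (pi - 6 * \<phi> + 6 * tan \<phi>) / (2 * sqrt 3)"
      using c by (simp add: hull_area_tan)
    moreover have "\<dots> = sqrt 3 * (pi / 6 - \<phi> + tan \<phi>)" by (simp add: field_simps s3)
    ultimately show ?thesis by simp
  qed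
  have y: "hull_area \<phi> / (3 * sqrt 3 / 2) = sqrt 3 / 3 * ((4 - v\<^sup>2) * (pi / 6 - \<phi>) + v * sqrt (4 - v\<^sup>2))"
  proof -
    have "v * sqrt (4 - v\<^sup>2) = 4 * (sin \<phi> * cos \<phi>)" unfolding hc(2) by (subst hc(1)) simp
    then have "(4 - v\<^sup>2) * (pi / 6 - \<phi>) + v * sqrt (4 - v\<^sup>2) = 2 / 3 * hull_area \<phi>"
      unfolding d by (simp add: hull_area_def field_simps)
    then show ?thesis by (simp add: field_simps s3)
  qed
  show "density_point (arcsin (v / 2)) (hull_area (arcsin (v / 2))) = (sqrt 3 * (pi / 6 - arcsin (v / 2) + v / sqrt (4 - v\<^sup>2)),
                sqrt 3 / 3 * ((4 - v\<^sup>2) * (pi / 6 - arcsin (v / 2)) + v * sqrt (4 - v\<^sup>2)))"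
    unfolding \<phi>_def[symmetric] density_point_def x y ..
qed

section \<open>Bodies between disks and hexagons\<close>

lemma body_densities:
  assumes M: "compact M" "cball c (R * cos \<phi>) \<subseteq> M" "M \<subseteq> hexcut c (\<theta> + pi / 6) (R * cos \<phi>)"
      "hexagon c \<theta> R \<subseteq> M" "M \<subseteq> cball c R"
    and R: "R > 0" and phi: "\<phi> \<in> {0..pi/6}" and area: "measure lebesgue M = R\<^sup>2 * a"
  shows "(packing_density M, covering_density M) = density_point \<phi> a"
    "(packing_density_T M, covering_density_T M) = density_point \<phi> a"
    "(packing_density_L M, covering_density_L M) = density_point \<phi> a"
proof -
  have r: "R * cos \<phi> > 0" using R angle_bounds(2)[OF phi] by simp
  have d: "density_point \<phi> a = (measure lebesgue M / (2 * sqrt 3 * (R * cos \<phi>)\<^sup>2), measure lebesgue M / (3 * sqrt 3 / 2 * R\<^sup>2))"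
    using R by (simp add: density_point_def area power_mult_distrib)
  show "(packing_density M, covering_density M) = density_point \<phi> a"
    "(packing_density_T M, covering_density_T M) = density_point \<phi> a"
    "(packing_density_L M, covering_density_L M) = density_point \<phi> a"
    unfolding d using body_packing_densities[OF M(1-3) r] body_covering_densities[OF M(1,4,5) R] by simp_all
qed

text \<open>The dilates of \<open>L\<close> about \<open>c\<close>, cut by \<open>K\<close>, run
  from \<open>L\<close> at factor 1 to \<open>K\<close> at factor 2. Each is convex and symmetric,
  and the area is Lipschitz in the factor, so the intermediate value theorem supplies the area
  \<open>a\<close>.\<close>

lemma intermediate_body:
  fixes L K :: "plane set"
  assumes L: "compact L" "convex L" "c \<in> L" and K: "compact K" "convex K"
    and sub: "L \<subseteq> K" "\<And>x. x \<in> K \<Longrightarrow> c + (1/2) *\<^sub>R (x - c) \<in> L"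
    and sym: "\<And>x. x \<in> L \<Longrightarrow> 2 *\<^sub>R c - x \<in> L" "\<And>x. x \<in> K \<Longrightarrow> 2 *\<^sub>R c - x \<in> K"
    and a: "measure lebesgue L \<le> a" "a \<le> measure lebesgue K"
  obtains M where "compact M" "convex M" "L \<subseteq> M" "M \<subseteq> K" "\<And>x. x \<in> M \<Longrightarrow> 2 *\<^sub>R c - x \<in> M" "measure lebesgue M = a"
proof -
  define S where "S s = (\<lambda>x. s *\<^sub>R x + (1 - s) *\<^sub>R c) ` L" for s :: real
  define M where "M s = K \<inter> S s" for s
  have mS: "measure lebesgue (S s) = s\<^sup>2 * measure lebesgue L" if "s \<ge> 0" for s
    unfolding S_def using that by (subst measure_lebesgue_affine) (simp add: power2_eq_square)
  have cS: "compact (S s)" "convex (S s)" for s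
  proof -
    have eq: "S s = (+) ((1 - s) *\<^sub>R c) ` ((*\<^sub>R) s ` L)" by (simp add: S_def image_image add.commute)
    show "compact (S s)" unfolding eq by (intro compact_translation compact_scaling L)
    show "convex (S s)" unfolding eq by (intro convex_translation convex_scaling L)
  qed
  have mono: "S s \<subseteq> S t" if "1 \<le> s" "s \<le> t" for s t
  proof
    fix y assume "y \<in> S s"
    then obtain x where x: "x \<in> L" "y = s *\<^sub>R x + (1 - s) *\<^sub>R c" by (auto simp: S_def)
    have "(s / t) *\<^sub>R x + (1 - s / t) *\<^sub>R c \<in> L" using that x L by (intro convexD[OF L(2)]) auto
    moreover have "y = t *\<^sub>R ((s / t) *\<^sub>R x + (1 - s / t) *\<^sub>R c) + (1 - t) *\<^sub>R c"
      using that by (simp add: x(2) algebra_simps)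
    ultimately show "y \<in> S t" unfolding S_def by blast
  qed
  have S1: "S 1 = L" by (simp add: S_def)
  have S2: "K \<subseteq> S 2"
  proof
    fix x assume "x \<in> K"
    then have "c + (1/2) *\<^sub>R (x - c) \<in> L" by (rule sub(2))
    moreover have "x = 2 *\<^sub>R (c + (1/2) *\<^sub>R (x - c)) + (1 - 2) *\<^sub>R c" by (simp add: algebra_simps) (simp add: scaleR_2)
    ultimately show "x \<in> S 2" unfolding S_def by blast
  qed
  have cM: "compact (M s)" for s unfolding M_def using K cS by (intro compact_Int)
  define f where "f s = measure lebesgue (M s)" for s
  \<comment> \<open>Cutting with \<open>K\<close> loses part of the ring between the two dilates of \<open>L\<close>.\<close>
  have step: "f s \<le> f t \<and> f t - f s \<le> 4 * measure lebesgue L * (t - s)" if st: "1 \<le> s" "s \<le> t" "t \<le> 2" for s t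
  proof
    note me = lmeasurable_compact[OF cM] lmeasurable_compact[OF cS(1)]
    have Ms: "M s \<subseteq> M t" using mono[OF st(1,2)] by (auto simp: M_def)
    then show "f s \<le> f t" unfolding f_def using me by (intro measure_mono_fmeasurable) (auto simp: fmeasurableD)
    have "f t - f s = measure lebesgue (M t - M s)" unfolding f_def
      using Ms me by (intro measurable_measure_Diff[symmetric]) (auto simp: fmeasurableD)
    also have "\<dots> \<le> measure lebesgue (S t - S s)"
      using me by (intro measure_mono_fmeasurable) (auto simp: M_def fmeasurableD fmeasurable.Diff sets.Diff)
    also have "\<dots> = measure lebesgue (S t) - measure lebesgue (S s)"
      using mono[OF st(1,2)] me by (intro measurable_measure_Diff) (auto simp: fmeasurableD)
    also have "\<dots> = (t + s) * (t - s) * measure lebesgue L"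
      using st by (simp add: mS power2_eq_square algebra_simps)
    also have "\<dots> \<le> 4 * (t - s) * measure lebesgue L" using st by (intro mult_right_mono) auto
    also have "\<dots> = 4 * measure lebesgue L * (t - s)" by (simp only: mult_ac)
    finally show "f t - f s \<le> 4 * measure lebesgue L * (t - s)" .
  qed
  have "continuous_on {1..2} f"
  proof (rule lipschitz_on_continuous_on[where L = "4 * measure lebesgue L"])
    show "(4 * measure lebesgue L)-lipschitz_on {1..2} f"
    proof (rule lipschitz_onI)
      fix s t :: real assume st: "s \<in> {1..2}" "t \<in> {1..2}"
      show "dist (f s) (f t) \<le> 4 * measure lebesgue L * dist s t"
      proof (cases "s \<le> t")
        case True then show ?thesis using step[of s t] st by (simp add: dist_real_def)
      next
        case False then show ?thesis using step[of t s] st by (simp add: dist_real_def)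
      qed
    qed simp
  qed
  moreover have "f 1 \<le> a" "a \<le> f 2"
    using a sub(1) S1 S2 by (simp_all add: f_def M_def Int_absorb1 Int_absorb2)
  ultimately obtain s where s: "1 \<le> s" "s \<le> 2" "f s = a" using IVT'[of f 1 a 2] by auto
  show ?thesis
  proof (rule that[of "M s"])
    show "convex (M s)" unfolding M_def using K cS by (intro convex_Int)
    show "L \<subseteq> M s" using sub(1) mono[of 1 s] s S1 by (auto simp: M_def)
    show "2 *\<^sub>R c - x \<in> M s" if "x \<in> M s" for x
    proof -
      have "x \<in> S s" using that by (simp add: M_def)
      then obtain y where y: "x = s *\<^sub>R y + (1 - s) *\<^sub>R c" "y \<in> L" unfolding S_def by (rule imageE)
      have "2 *\<^sub>R c - x = s *\<^sub>R (2 *\<^sub>R c - y) + (1 - s) *\<^sub>R c"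
        by (simp add: y(1) algebra_simps scaleR_2)
      then have "2 *\<^sub>R c - x \<in> S s" unfolding S_def using sym(1)[OF y(2)] by blast
      then show ?thesis using that sym(2) by (simp add: M_def)
    qed
  qed (use cM s in \<open>auto simp: M_def f_def\<close>)
qed

lemma reflect_hexcut:
  assumes "x \<in> hexcut c \<theta> h" shows "2 *\<^sub>R c - x \<in> hexcut c \<theta> h"
  unfolding hexcut_def
proof (intro CollectI allI impI)
  fix k :: nat assume "k < 6"
  have "(2 *\<^sub>R c - x - c) \<bullet> ray \<theta> k = (x - c) \<bullet> ray \<theta> ((k + 3) mod 6)"
    unfolding ray_mod ray_opposite by (simp add: scaleR_2 inner_diff_left)
  also have "\<dots> \<le> h" using assms by (simp add: hexcut_def)
  finally show "(2 *\<^sub>R c - x - c) \<bullet> ray \<theta> k \<le> h" .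
qed

lemma reflect_cball:
  fixes c :: "'a::real_normed_vector"
  shows "x \<in> cball c r \<Longrightarrow> 2 *\<^sub>R c - x \<in> cball c r"
  by (simp add: dist_norm scaleR_2 norm_minus_commute)

lemma reflect_hull:
  fixes c :: "'a::real_normed_vector"
  assumes "\<And>x. x \<in> S \<Longrightarrow> 2 *\<^sub>R c - x \<in> S" "x \<in> convex hull S"
  shows "2 *\<^sub>R c - x \<in> convex hull S"
proof -
  have "convex ((\<lambda>x. 2 *\<^sub>R c - x) ` (convex hull S))"
  proof -
    have "(\<lambda>x. 2 *\<^sub>R c - x) ` (convex hull S) = (+) (2 *\<^sub>R c) ` uminus ` (convex hull S)" by (simp add: image_image)
    then show ?thesis by (simp only: convex_translation convex_negations convex_convex_hull)
  qed
  moreover have "S \<subseteq> (\<lambda>x. 2 *\<^sub>R c - x) ` (convex hull S)"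
  proof
    fix y assume "y \<in> S"
    then have "2 *\<^sub>R c - y \<in> convex hull S" using assms(1) hull_inc by metis
    then show "y \<in> (\<lambda>x. 2 *\<^sub>R c - x) ` (convex hull S)" by (rule rev_image_eqI) simp
  qed
  ultimately have "convex hull S \<subseteq> (\<lambda>x. 2 *\<^sub>R c - x) ` (convex hull S)" by (rule hull_minimal[rotated])
  then show ?thesis using assms(2) by auto
qed

lemma disk_hexagon_hull:
  fixes c :: plane and \<theta> :: real
  assumes phi: "\<phi> \<in> {0..pi/6}"
  defines "L \<equiv> convex hull (cball c (cos \<phi>) \<union> hexagon c \<theta> 1)"
  shows "compact L" "cball c (cos \<phi>) \<subseteq> L" "hexagon c \<theta> 1 \<subseteq> L"
    "L \<subseteq> cball c 1 \<inter> hexcut c (\<theta> + pi / 6) (cos \<phi>)" "measure lebesgue L = hull_area \<phi>"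
proof -
  note ab = angle_bounds[OF phi]
  have "compact (hexagon c \<theta> 1)" unfolding hexagon_def by (intro finite_imp_compact_convex_hull) simp
  then show "compact L" unfolding L_def by (intro compact_convex_hull compact_Un) auto
  show "cball c (cos \<phi>) \<subseteq> L" unfolding L_def by (rule order_trans[OF Un_upper1 hull_subset])
  show "hexagon c \<theta> 1 \<subseteq> L" unfolding L_def by (rule order_trans[OF Un_upper2 hull_subset])
  have "hexagon c \<theta> 1 \<subseteq> hexcut c (\<theta> + pi / 6) (cos \<phi>)"
    using hexagon_subset_hexcut[of 1 c \<theta>] hexcut_mono[of "1 * sqrt 3 / 2" "cos \<phi>" c "\<theta> + pi / 6"] ab(1) by auto
  moreover have "hexagon c \<theta> 1 \<subseteq> cball c 1" by (rule hexagon_subset_cball) simp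
  moreover have "cball c (cos \<phi>) \<subseteq> hexcut c (\<theta> + pi / 6) (cos \<phi>)" using ab(2) by (intro cball_subset_hexcut) auto
  moreover have "cball c (cos \<phi>) \<subseteq> cball c 1" by (rule subset_cball) simp
  ultimately show "L \<subseteq> cball c 1 \<inter> hexcut c (\<theta> + pi / 6) (cos \<phi>)"
    unfolding L_def by (intro hull_minimal convex_Int convex_cball convex_hexcut) blast
  show "measure lebesgue L = hull_area \<phi>"
    unfolding L_def hull_area_def using phi by (intro area_disk_hexagon_hull) auto
qed

lemma density_region_realized:
  assumes "z \<in> density_region"
  obtains M where "convex_disk M" "centrally_symmetric M" "(packing_density M, covering_density M) = z"
    "(packing_density_T M, covering_density_T M) = z" "(packing_density_L M, covering_density_L M) = z"
proof -
  obtain \<phi> a where z: "z = density_point \<phi> a" "\<phi> \<in> {0..pi/6}" "hull_area \<phi> \<le> a" "a \<le> cut_disk_area \<phi>"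
    using assms by (auto simp: density_region_def)
  note ab = angle_bounds[OF z(2)]
  define c :: plane where "c = 0"
  define \<theta> :: real where "\<theta> = 0"
  let ?L = "convex hull (cball c (cos \<phi>) \<union> hexagon c \<theta> 1)"
  let ?K = "cball c 1 \<inter> hexcut c (\<theta> + pi / 6) (cos \<phi>)"
  note L = disk_hexagon_hull[OF z(2), of c \<theta>]
  have cK: "compact ?K" using closed_hexcut by (intro compact_Int_closed) auto
  have aK: "measure lebesgue ?K = cut_disk_area \<phi>"
    using area_cut_disk[of \<phi> 1 c "\<theta> + pi / 6"] z(2) by simp
  obtain M where M: "compact M" "convex M" "?L \<subseteq> M" "M \<subseteq> ?K" "\<And>x. x \<in> M \<Longrightarrow> 2 *\<^sub>R c - x \<in> M" "measure lebesgue M = a"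
  proof (rule intermediate_body[of ?L c ?K a])
    show "c \<in> ?L" using L(2) ab(2) by (auto intro: less_imp_le)
    show "convex ?K" by (intro convex_Int convex_cball convex_hexcut)
    \<comment> \<open>The unit disk halved lies in the inner disk, whose radius
      \<open>cos \<phi>\<close> is at least \<open>sqrt 3 / 2\<close>.\<close>
    show "c + (1/2) *\<^sub>R (x - c) \<in> ?L" if "x \<in> ?K" for x
    proof -
      have "sqrt 3 \<ge> 1" by simp
      then have "1 / 2 \<le> cos \<phi>" using ab(1) by linarith
      moreover have "norm (x - c) \<le> 1" using that by (simp add: dist_norm norm_minus_commute)
      ultimately have "c + (1/2) *\<^sub>R (x - c) \<in> cball c (cos \<phi>)" by (simp add: dist_norm)
      then show ?thesis using L(2) by blast
    qed
    show "2 *\<^sub>R c - x \<in> ?L" if "x \<in> ?L" for x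
    proof (rule reflect_hull[OF _ that])
      show "2 *\<^sub>R c - y \<in> cball c (cos \<phi>) \<union> hexagon c \<theta> 1" if "y \<in> cball c (cos \<phi>) \<union> hexagon c \<theta> 1" for y
        using that reflect_cball[of y c] reflect_hexcut[of y c] by (auto simp only: Un_iff hexagon_eq_hexcut zero_less_one)
    qed
    show "2 *\<^sub>R c - x \<in> ?K" if "x \<in> ?K" for x using that reflect_cball reflect_hexcut by blast
  qed (use L(1,4,5) cK aK z in auto)
  have sub: "cball c (1 * cos \<phi>) \<subseteq> M" "M \<subseteq> hexcut c (\<theta> + pi / 6) (1 * cos \<phi>)" "hexagon c \<theta> 1 \<subseteq> M" "M \<subseteq> cball c 1"
    using L M by auto
  have "ball c (cos \<phi>) \<subseteq> M" using sub(1) ball_subset_cball by fastforce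
  then have "ball c (cos \<phi>) \<subseteq> interior M" by (simp add: interior_maximal)
  moreover have "c \<in> ball c (cos \<phi>)" using ab(2) by simp
  ultimately have "convex_disk M" using M by (auto simp: convex_disk_def)
  moreover have "centrally_symmetric M" unfolding centrally_symmetric_def by (intro exI[of _ c] ballI M(5))
  ultimately show ?thesis
    by (rule that) (use body_densities[OF M(1) sub(1,2,3,4) _ z(2), of a] M(6) z(1) in simp_all)
qed

theorem mainTheorem1:
  fixes H :: "plane set" and c :: plane and \<rho> :: "real \<Rightarrow> real"
    and D K L :: "real \<Rightarrow> plane set" and \<alpha> \<beta> \<Lambda> :: "(real \<times> real) set"
  assumes H: "regular_hexagon c 1 H"
    and \<rho>_cont: "continuous_on {0..1} \<rho>"
    and \<rho>_mono: "antimono_on {0..1} \<rho>"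
    and \<rho>_0: "\<rho> 0 = 1"
    and \<rho>_1: "\<rho> 1 = sqrt 3 / 2"
    and D: "\<And>t. D t = cball c (\<rho> t)"
    and K: "\<And>t. K t = D t \<inter> H"
    and L: "\<And>t. L t = convex hull (D t \<union> H)"
    and \<alpha>: "\<alpha> = (\<lambda>t. (packing_density (K t), covering_density (K t))) ` {0..1}"
    and \<beta>: "\<beta> = (\<lambda>t. (packing_density (L t), covering_density (L t))) ` {0..1}"
    and \<Lambda>: "\<Lambda> = (\<alpha> \<union> \<beta>) \<union> inside (\<alpha> \<union> \<beta>)"
  shows
    "(\<forall>t\<in>{0..1}.
        packing_density (K t) = packing_density_T (K t) \<and>
        packing_density_T (K t) = packing_density_L (K t) \<and>
        covering_density (K t) = covering_density_T (K t) \<and>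
        covering_density_T (K t) = covering_density_L (K t) \<and>
        packing_density (L t) = packing_density_T (L t) \<and>
        packing_density_T (L t) = packing_density_L (L t) \<and>
        covering_density (L t) = covering_density_T (L t) \<and>
        covering_density_T (L t) = covering_density_L (L t))
     \<and> \<alpha> = (\<lambda>u. ((2 * pi - 12 * arcsin (u / 2) + 3 * u * sqrt (4 - u\<^sup>2)) / (sqrt 3 * (4 - u\<^sup>2)),
                (2 * pi - 12 * arcsin (u / 2) + 3 * u * sqrt (4 - u\<^sup>2)) / (3 * sqrt 3))) ` {0..1}
     \<and> \<beta> = (\<lambda>v. (sqrt 3 * (pi / 6 - arcsin (v / 2) + v / sqrt (4 - v\<^sup>2)),
                sqrt 3 / 3 * ((4 - v\<^sup>2) * (pi / 6 - arcsin (v / 2)) + v * sqrt (4 - v\<^sup>2)))) ` {0..1}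
     \<and> arc_joining \<alpha> (1, 1) (pi / sqrt 12, 2 * pi / sqrt 27)
     \<and> arc_joining \<beta> (1, 1) (pi / sqrt 12, 2 * pi / sqrt 27)
     \<and> simple_closed_curve (\<alpha> \<union> \<beta>)
     \<and> convex_disk \<Lambda> \<and> frontier \<Lambda> = \<alpha> \<union> \<beta>
     \<and> \<Lambda> \<subseteq> Omega \<and> \<Lambda> \<subseteq> Omega_T \<and> \<Lambda> \<subseteq> Omega_L
     \<and> \<Lambda> \<subseteq> Omega_sym \<and> \<Lambda> \<subseteq> Omega_T_sym \<and> \<Lambda> \<subseteq> Omega_L_sym"
  proof -
  obtain \<theta> where H': "H = hexagon c \<theta> 1"
    using H unfolding regular_hexagon_def hexagon_def ray_def by auto
  have mono: "\<rho> t \<le> \<rho> s" if "0 \<le> s" "s \<le> t" "t \<le> 1" for s t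
    using \<rho>_mono that by (auto simp: monotone_on_def)
  have rng: "sqrt 3 / 2 \<le> \<rho> t" "\<rho> t \<le> 1" if "t \<in> {0..1}" for t
    using mono[of t 1] mono[of 0 t] that \<rho>_0 \<rho>_1 by auto
  have s3: "sqrt 3 / 2 > 0" by simp
  have pos: "\<rho> t > 0" if "t \<in> {0..1}" for t using rng(1)[OF that] s3 by linarith
  \<comment> \<open>The curves do not depend on how the radius is parametrized; only the interval of
    values taken matters.\<close>
  have onto: "\<exists>t\<in>{0..1}. \<rho> t = r" if "sqrt 3 / 2 \<le> r" "r \<le> 1" for r
    using IVT2'[of \<rho> 1 r 0] \<rho>_cont \<rho>_0 \<rho>_1 that by auto
  have angle: "arccos x \<in> {0..pi/6}" "cos (arccos x) = x" if "sqrt 3 / 2 \<le> x" "x \<le> 1" for x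
  proof -
    have x0: "0 \<le> x" using that s3 by linarith
    have "arccos x \<le> arccos (cos (pi / 6))" using that x0 by (intro arccos_le_arccos) (auto simp: cos_30 intro: order_trans[of _ 0])
    then show "arccos x \<in> {0..pi/6}" using that x0 by (simp add: arccos_cos arccos_lbound)
    show "cos (arccos x) = x" using that x0 by simp
  qed
  have quot: "sqrt 3 / 2 \<le> sqrt 3 / 2 / \<rho> t" "sqrt 3 / 2 / \<rho> t \<le> 1" if "t \<in> {0..1}" for t
    using rng[OF that] pos[OF that] by (simp_all add: field_simps)
  \<comment> \<open>For \<open>K t\<close> the outer disk has radius \<open>\<rho> t\<close> and the
    hexagon inradius \<open>sqrt 3 / 2\<close>; for \<open>L t\<close> the inner disk has radius
    \<open>\<rho> t\<close> and the hexagon circumradius 1. In both cases the cosine is the inner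
    radius divided by the outer one.\<close>
  define \<phi>K \<phi>L where "\<phi>K t = arccos (sqrt 3 / 2 / \<rho> t)" and "\<phi>L t = arccos (\<rho> t)" for t
  have phiK: "\<phi>K t \<in> {0..pi/6}" "\<rho> t * cos (\<phi>K t) = sqrt 3 / 2" if "t \<in> {0..1}" for t
    unfolding \<phi>K_def using angle[OF quot[OF that]] pos[OF that] by (simp_all add: field_simps)
  have phiL: "\<phi>L t \<in> {0..pi/6}" "cos (\<phi>L t) = \<rho> t" if "t \<in> {0..1}" for t
    unfolding \<phi>L_def using angle[OF rng[OF that]] by simp_all
  have Kd: "(packing_density (K t), covering_density (K t)) = density_point (\<phi>K t) (cut_disk_area (\<phi>K t))"
    "(packing_density_T (K t), covering_density_T (K t)) = density_point (\<phi>K t) (cut_disk_area (\<phi>K t))"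
    "(packing_density_L (K t), covering_density_L (K t)) = density_point (\<phi>K t) (cut_disk_area (\<phi>K t))"
    if t: "t \<in> {0..1}" for t
  proof -
    note p = pos[OF t] and q = phiK[OF t] and ab = angle_bounds[OF phiK(1)[OF t]]
    have Kt: "K t = cball c (\<rho> t) \<inter> hexcut c (\<theta> + pi / 6) (\<rho> t * cos (\<phi>K t))"
      unfolding K D H' q(2) by (simp add: hexagon_eq_hexcut)
    have c1: "compact (K t)" unfolding Kt using closed_hexcut by (intro compact_Int_closed) auto
    have "\<rho> t * cos (\<phi>K t) \<le> \<rho> t" using p by (simp add: mult_left_le)
    then have c2: "cball c (\<rho> t * cos (\<phi>K t)) \<subseteq> K t"
      unfolding Kt using p ab(2) by (intro Int_greatest subset_cball cball_subset_hexcut) auto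
    have "\<rho> t * sqrt 3 / 2 \<le> \<rho> t * cos (\<phi>K t)" using ab(1) p by simp
    then have "hexagon c \<theta> (\<rho> t) \<subseteq> hexcut c (\<theta> + pi / 6) (\<rho> t * cos (\<phi>K t))"
      using hexagon_subset_hexcut[of "\<rho> t" c \<theta>] hexcut_mono p by (meson less_imp_le order_trans)
    then have c3: "hexagon c \<theta> (\<rho> t) \<subseteq> K t" unfolding Kt using hexagon_subset_cball p by (simp add: less_imp_le)
    have c4: "K t \<subseteq> hexcut c (\<theta> + pi / 6) (\<rho> t * cos (\<phi>K t))" "K t \<subseteq> cball c (\<rho> t)" unfolding Kt by auto
    have "measure lebesgue (K t) = (\<rho> t)\<^sup>2 * cut_disk_area (\<phi>K t)"
      unfolding Kt using q(1) p by (intro area_cut_disk) auto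
    from body_densities[OF c1 c2 c4(1) c3 c4(2) p q(1) this]
    show "(packing_density (K t), covering_density (K t)) = density_point (\<phi>K t) (cut_disk_area (\<phi>K t))"
      "(packing_density_T (K t), covering_density_T (K t)) = density_point (\<phi>K t) (cut_disk_area (\<phi>K t))"
      "(packing_density_L (K t), covering_density_L (K t)) = density_point (\<phi>K t) (cut_disk_area (\<phi>K t))" .
  qed
  have Ld: "(packing_density (L t), covering_density (L t)) = density_point (\<phi>L t) (hull_area (\<phi>L t))"
    "(packing_density_T (L t), covering_density_T (L t)) = density_point (\<phi>L t) (hull_area (\<phi>L t))"
    "(packing_density_L (L t), covering_density_L (L t)) = density_point (\<phi>L t) (hull_area (\<phi>L t))"
    if t: "t \<in> {0..1}" for t
  proof -
    have Lt: "L t = convex hull (cball c (cos (\<phi>L t)) \<union> hexagon c \<theta> 1)"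
      unfolding L D H' phiL(2)[OF t] ..
    note dh = disk_hexagon_hull[OF phiL(1)[OF t], of c \<theta>, folded Lt]
    have "cball c (1 * cos (\<phi>L t)) \<subseteq> L t" "L t \<subseteq> hexcut c (\<theta> + pi / 6) (1 * cos (\<phi>L t))" "L t \<subseteq> cball c 1"
      "measure lebesgue (L t) = 1\<^sup>2 * hull_area (\<phi>L t)"
      using dh by simp_all
    from body_densities[OF dh(1) this(1,2) dh(3) this(3) _ phiL(1)[OF t] this(4)]
    show "(packing_density (L t), covering_density (L t)) = density_point (\<phi>L t) (hull_area (\<phi>L t))"
      "(packing_density_T (L t), covering_density_T (L t)) = density_point (\<phi>L t) (hull_area (\<phi>L t))"
      "(packing_density_L (L t), covering_density_L (L t)) = density_point (\<phi>L t) (hull_area (\<phi>L t))" by simp_all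
  qed
  have imK: "\<phi>K ` {0..1} = {0..pi/6}"
  proof (intro equalityI subsetI)
    fix \<phi> assume p: "\<phi> \<in> {0..pi/6}"
    note ab = angle_bounds[OF p]
    have "sqrt 3 / 2 \<le> sqrt 3 / 2 / cos \<phi>" "sqrt 3 / 2 / cos \<phi> \<le> 1" using ab(1,2) by (simp_all add: field_simps)
    then obtain t where t: "t \<in> {0..1}" "\<rho> t = sqrt 3 / 2 / cos \<phi>" using onto by blast
    have "\<phi>K t = arccos (cos \<phi>)" using t(2) ab(2) by (simp add: \<phi>K_def)
    also have "\<dots> = \<phi>" using p pi_gt_zero by (intro arccos_cos) auto
    finally show "\<phi> \<in> \<phi>K ` {0..1}" using t(1) by blast
  qed (use phiK in blast)
  have imL: "\<phi>L ` {0..1} = {0..pi/6}"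
  proof (intro equalityI subsetI)
    fix \<phi> assume p: "\<phi> \<in> {0..pi/6}"
    then obtain t where t: "t \<in> {0..1}" "\<rho> t = cos \<phi>" using onto angle_bounds(1)[OF p] by (metis cos_le_one)
    have "\<phi>L t = arccos (cos \<phi>)" using t(2) by (simp add: \<phi>L_def)
    also have "\<dots> = \<phi>" using p pi_gt_zero by (intro arccos_cos) auto
    finally show "\<phi> \<in> \<phi>L ` {0..1}" using t(1) by blast
  qed (use phiL in blast)
  have \<alpha>': "\<alpha> = cut_curve"
    unfolding \<alpha> cut_curve_def imK[symmetric] image_image using Kd(1) by (intro image_cong) auto
  have \<beta>': "\<beta> = hull_curve"
    unfolding \<beta> hull_curve_def imL[symmetric] image_image using Ld(1) by (intro image_cong) auto
  have fr: "frontier density_region = \<alpha> \<union> \<beta>" unfolding \<alpha>' \<beta>' by (rule frontier_density_region)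
  \<comment> \<open>The inside of the frontier of a bounded convex set is its interior, so the
    closed curve together with its inside is the region again.\<close>
  have "inside (\<alpha> \<union> \<beta>) = interior density_region"
    unfolding fr[symmetric] using compact_imp_bounded[OF compact_density_region] convex_density_region
    by (rule inside_frontier_eq_interior)
  moreover have "frontier density_region \<union> interior density_region = density_region"
    using compact_imp_closed[OF compact_density_region] interior_subset[of density_region]
    by (auto simp: frontier_def)
  ultimately have \<Lambda>': "\<Lambda> = density_region" unfolding \<Lambda> using fr by simp
  have disk: "convex_disk \<Lambda>" unfolding \<Lambda>' convex_disk_def
    using compact_density_region convex_density_region interior_density_region_nonempty by simp
  have real: "z \<in> Omega \<and> z \<in> Omega_T \<and> z \<in> Omega_L \<and> z \<in> Omega_sym \<and> z \<in> Omega_T_sym \<and> z \<in> Omega_L_sym"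
    if z: "z \<in> \<Lambda>" for z
  proof -
    obtain M where M: "convex_disk M" "centrally_symmetric M" "(packing_density M, covering_density M) = z"
      "(packing_density_T M, covering_density_T M) = z" "(packing_density_L M, covering_density_L M) = z"
      using density_region_realized z unfolding \<Lambda>' by blast
    show ?thesis
      unfolding Omega_def Omega_T_def Omega_L_def Omega_sym_def Omega_T_sym_def Omega_L_sym_def mem_Collect_eq
      using M(1,2) M(3,4,5)[symmetric] by (intro conjI exI[of _ M])
  qed
  then have sub: "\<Lambda> \<subseteq> Omega" "\<Lambda> \<subseteq> Omega_T" "\<Lambda> \<subseteq> Omega_L" "\<Lambda> \<subseteq> Omega_sym" "\<Lambda> \<subseteq> Omega_T_sym" "\<Lambda> \<subseteq> Omega_L_sym"
    by blast+
  have eqs: "\<forall>t\<in>{0..1}.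
        packing_density (K t) = packing_density_T (K t) \<and>
        packing_density_T (K t) = packing_density_L (K t) \<and>
        covering_density (K t) = covering_density_T (K t) \<and>
        covering_density_T (K t) = covering_density_L (K t) \<and>
        packing_density (L t) = packing_density_T (L t) \<and>
        packing_density_T (L t) = packing_density_L (L t) \<and>
        covering_density (L t) = covering_density_T (L t) \<and>
        covering_density_T (L t) = covering_density_L (L t)"
  proof
    fix t :: real assume t: "t \<in> {0..1}"
    show "packing_density (K t) = packing_density_T (K t) \<and>
        packing_density_T (K t) = packing_density_L (K t) \<and>
        covering_density (K t) = covering_density_T (K t) \<and>
        covering_density_T (K t) = covering_density_L (K t) \<and>
        packing_density (L t) = packing_density_T (L t) \<and>
        packing_density_T (L t) = packing_density_L (L t) \<and>
        covering_density (L t) = covering_density_T (L t) \<and>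
        covering_density_T (L t) = covering_density_L (L t)"
      using Kd[OF t] Ld[OF t] by (metis Pair_inject)
  qed
  show ?thesis
    by (intro conjI eqs disk sub fr[folded \<Lambda>'] cut_curve_parametric[folded \<alpha>'] hull_curve_parametric[folded \<beta>']
        curves_arcs[folded \<alpha>' \<beta>'])
qed

end
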